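(* For $2w\le n$, let $\mathbb{F}_2^{n,w}$ be the set of binary vectors of length $n$ with exactly $w$ ones, with distance $\tau(x,y)=|\{i:x_i\ne y_i\}|/2$, and let $A(\mathbb{F}_2^{n,w},s)$ be the maximum cardinality of a subset $X\subset\mathbb{F}_2^{n,w}$ whose set of distances between distinct elements has exactly $s$ elements. (1) For $14\le n\le 58$ and $5\le w\le n/2$, $A(\mathbb{F}_2^{n,w},4)\le \binom{n}{4}-\binom{n}{3}+\binom{n}{2}$. (2) If $n,w$ satisfy one of: $15\le n\le 16$ and $w=5$; $17\le n\le 19$ and $5\le w\le 6$; $20\le n\le 24$ and $5\le w\le 7$; $25\le n\le 29$ and $5\le w\le 8$; ($30\le n\le 34$ or $41\le n\le 47$) and $5\le w\le 9$; ($35\le n\le 40$ or $48\le n\le 59$) and $5\le w\le 10$; $60\le n\le 70$ and $5\le w\le 11$; then $A(\mathbb{F}_2^{n,w},4)=\binom{n-w+4}{4}$.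
   Context: None beyond the definitions in the claim. *)

theory Defs
  imports Complex_Main "HOL-Library.Z2"
begin

definition johnson_space :: "nat \<Rightarrow> nat \<Rightarrow> bit list set" where
  "johnson_space n w = {x. length x = n \<and> card {i. i < n \<and> x ! i = 1} = w}"

definition tau :: "bit list \<Rightarrow> bit list \<Rightarrow> real" where
  "tau x y = real (card {i. i < length x \<and> x ! i \<noteq> y ! i}) / 2"

definition distances :: "('a \<Rightarrow> 'a \<Rightarrow> real) \<Rightarrow> 'a set \<Rightarrow> real set" where
  "distances d X = {d x y | x y. x \<in> X \<and> y \<in> X \<and> x \<noteq> y}"

text \<open>The maximum ranges over a finite set of naturals, since \<open>johnson_space n w\<close> is finite.
  It is only meaningful if some \<open>X\<close> with exactly \<open>s\<close> distances exists. For \<open>s = 4\<close> and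
  \<open>5 \<le> w \<le> n / 2\<close>, such an \<open>X\<close> is given by all vectors having ones in \<open>w - 4\<close> prescribed
  positions.\<close>

definition max_s_distance :: "nat \<Rightarrow> nat \<Rightarrow> nat \<Rightarrow> nat" where
  "max_s_distance n w s =
     Max (card ` {X. X \<subseteq> johnson_space n w \<and> card (distances tau X) = s})"

end

theory Submission
  imports Defs "HOL-Computational_Algebra.Polynomial"
begin

text \<open>Identify vectors with their supports, so that \<open>X\<close> is a family of \<open>w\<close>-subsets of an \<open>n\<close>-set and
  \<open>\<tau>\<close> becomes \<open>card (S - T)\<close>. Let \<open>a\<^sub>1 < a\<^sub>2 < a\<^sub>3 < a\<^sub>4\<close> be the distances, and suppose
  \<open>card X > n choose 3\<close>. Then some nonzero integer vector on \<open>X\<close> is annihilated by all polynomials of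
  degree \<open>3\<close> in the distance, which forces all numbers \<open>K\<^sub>i = (\<Prod>j\<noteq>i. a\<^sub>j / (a\<^sub>j - a\<^sub>i))\<close> to be integers
  and \<open>a\<^sub>2 \<le> 2 a\<^sub>1\<close>. Only 367 quadruples with \<open>a\<^sub>4 \<le> 29\<close> survive.

  If \<open>a\<^sub>1 + a\<^sub>2 + a\<^sub>3 + a\<^sub>4\<close> is small, the annihilator polynomial has a nonpositive component on the third
  harmonic space, whose dimension can be subtracted from the absolute bound \<open>n choose 4\<close>; this is the
  bound of the first part. For the other quadruples Delsarte's linear programming bound suffices. A bound
  for \<open>(n', w')\<close> also holds for \<open>(n, w)\<close> with \<open>0 \<le> w' - w \<le> n' - n\<close>, by adding points common to all
  sets, so a few hundred certificates are enough. In the second part, the distances \<open>1, 2, 3, 4\<close> are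
  handled by Wilson's proof of the Erdos-Ko-Rado theorem, and the family of all \<open>w\<close>-sets containing
  \<open>w - 4\<close> given points attains the bound.\<close>

section \<open>Harmonic functions on the Johnson scheme\<close>

text \<open>Why \<open>K\<close> is an integer: a family larger than \<open>n choose 3\<close>
  carries a nonzero integral \<open>c\<close> satisfying one equation per 3-set, and the cubic
  vanishing at three of the four distances turns these equations into \<open>K c + A c = 0\<close>,
  where \<open>A\<close> is the 0/1 adjacency matrix of the remaining distance. So
  \<open>- K\<close> is a rational eigenvalue of an integer matrix. The limit 29 is half of 58,
  since distances never exceed \<open>w\<close>. The reduction to finitely many quadruples is
  indispensable: the absolute bound \<open>n choose 4\<close> lies above both targets, and a linear
  programming certificate needs the set of distances as input. For the distances
  \<open>1, 2, 3, 4\<close> the bound of the second part is attained; Wilson's matrix is an explicit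
  dual solution there, uniform in \<open>n\<close> and \<open>w\<close>. All kernels are expanded in
  the binomials \<open>card (S - T) choose j\<close>, which count the \<open>j\<close>-subsets of
  \<open>S\<close> disjoint from \<open>T\<close>. Their eigenvalues are then explicit sums, and
  dimensions of eigenspaces are replaced by counts of linear equations.\<close>

lemma nontrivial_solution_exists:
  fixes v :: "'a \<Rightarrow> 'b \<Rightarrow> 'r::idom"
  assumes "finite I" "finite X" "card I < card X"
  shows "\<exists>c. (\<exists>x\<in>X. c x \<noteq> 0) \<and> (\<forall>i\<in>I. (\<Sum>x\<in>X. c x * v x i) = 0)"
  using assms
proof (induction I arbitrary: X v rule: finite_induct)
  case empty
  then show ?case by (intro exI[of _ "\<lambda>_. 1"]) (auto simp: card_gt_0_iff)
next
  case (insert i I)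
  show ?case
  proof (cases "\<forall>x\<in>X. v x i = 0")
    case True
    have "card I < card X" using insert by simp
    from insert.IH[OF \<open>finite X\<close> this, of v] True show ?thesis by auto
  next
    case False
    then obtain x0 where x0: "x0 \<in> X" "v x0 i \<noteq> 0" by blast
    let ?X = "X - {x0}"
    have "card I < card ?X" using insert x0 by simp
    from insert.IH[OF _ this, of "\<lambda>x j. v x0 i * v x j - v x i * v x0 j"] \<open>finite X\<close>
    obtain c where c: "\<exists>x\<in>?X. c x \<noteq> 0"
      "\<And>j. j \<in> I \<Longrightarrow> (\<Sum>x\<in>?X. c x * (v x0 i * v x j - v x i * v x0 j)) = 0" by auto
    \<comment> \<open>The unknown at \<open>x0\<close> is eliminated through equation
      \<open>i\<close>. Scaling the others by the pivot \<open>v x0 i\<close> avoids a quotient, so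
      the solution stays in the ring; over \<open>int\<close> this integrality is what the
      divisibility argument rests on.\<close>
    define d where "d x = (if x = x0 then - (\<Sum>x\<in>?X. c x * v x i) else v x0 i * c x)" for x
    have "(\<Sum>x\<in>X. d x * v x j) = (\<Sum>x\<in>?X. c x * (v x0 i * v x j - v x i * v x0 j))" for j
    proof -
      have "(\<Sum>x\<in>X. d x * v x j) = d x0 * v x0 j + (\<Sum>x\<in>?X. d x * v x j)"
        using \<open>finite X\<close> x0 by (simp add: sum.remove)
      also have "(\<Sum>x\<in>?X. d x * v x j) = (\<Sum>x\<in>?X. v x0 i * c x * v x j)"
        by (intro sum.cong) (auto simp: d_def)
      finally show ?thesis
        by (simp add: d_def right_diff_distrib sum_subtractf sum_distrib_right mult.assoc mult.left_commute)
    qed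
    moreover have "\<exists>x\<in>X. d x \<noteq> 0" using c(1) x0(2) by (auto simp: d_def)
    ultimately show ?thesis using c(2) by (intro exI[of _ d]) (auto simp: mult.commute)
  qed
qed

section \<open>Layers of a finite set and inclusion-exclusion\<close>

definition layer :: "'a set \<Rightarrow> nat \<Rightarrow> 'a set set" where
  "layer N k = {S. S \<subseteq> N \<and> card S = k}"

lemma finite_layer [simp]: "finite N \<Longrightarrow> finite (layer N k)"
  by (rule finite_subset[of _ "Pow N"]) (auto simp: layer_def)

lemma card_layer: "finite N \<Longrightarrow> card (layer N k) = card N choose k"
  by (simp add: layer_def n_subsets)

lemma layer_eq_empty: "finite N \<Longrightarrow> card N < k \<Longrightarrow> layer N k = {}"
  by (metis card_0_eq card_layer binomial_eq_0 finite_layer)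

lemma finite_in_layer: "finite N \<Longrightarrow> S \<in> layer N k \<Longrightarrow> finite S"
  by (auto simp: layer_def intro: finite_subset)

lemma card_layer_between:
  assumes "finite N" "R \<subseteq> N" "J \<subseteq> N" "R \<inter> J = {}" "card R \<le> w"
  shows "card {T \<in> layer N w. R \<subseteq> T \<and> T \<inter> J = {}} = (card N - card J - card R) choose (w - card R)"
proof -
  have fin: "finite R" "finite J" using assms by (auto intro: finite_subset)
  have "bij_betw (\<lambda>T. T \<union> R) (layer (N - J - R) (w - card R)) {T \<in> layer N w. R \<subseteq> T \<and> T \<inter> J = {}}"
  proof (rule bij_betw_byWitness[where f' = "\<lambda>T. T - R"])
    show "(\<lambda>T. T \<union> R) ` layer (N - J - R) (w - card R) \<subseteq> {T \<in> layer N w. R \<subseteq> T \<and> T \<inter> J = {}}"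
    proof safe
      fix T assume T: "T \<in> layer (N - J - R) (w - card R)"
      have "finite T" using T assms(1) finite_in_layer[of "N - J - R" T] by simp
      then have "card (T \<union> R) = card T + card R"
        using T fin by (intro card_Un_disjoint) (auto simp: layer_def)
      then show "T \<union> R \<in> layer N w" using T assms by (auto simp: layer_def)
    qed (use assms in \<open>auto simp: layer_def\<close>)
    show "(\<lambda>T. T - R) ` {T \<in> layer N w. R \<subseteq> T \<and> T \<inter> J = {}} \<subseteq> layer (N - J - R) (w - card R)"
      using fin by (auto simp: layer_def card_Diff_subset)
  qed (auto simp: layer_def)
  then have "card {T \<in> layer N w. R \<subseteq> T \<and> T \<inter> J = {}} = card (layer (N - J - R) (w - card R))"
    by (simp add: bij_betw_same_card)
  also have "card (N - J - R) = card N - card J - card R"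
    using assms fin by (subst card_Diff_subset; (subst card_Diff_subset)?) auto
  then have "card (layer (N - J - R) (w - card R)) = (card N - card J - card R) choose (w - card R)"
    using assms(1) by (simp add: card_layer)
  finally show ?thesis .
qed

lemma card_layer_supersets:
  assumes "finite N" "R \<subseteq> N" "card R \<le> w"
  shows "card {T \<in> layer N w. R \<subseteq> T} = (card N - card R) choose (w - card R)"
  using card_layer_between[of N R "{}" w] assms by simp

lemma sum_alternating_Pow:
  assumes "finite B"
  shows "(\<Sum>A\<in>Pow B. (-1) ^ card A) = (if B = {} then 1 else 0 :: 'r::comm_ring_1)"
  using assms
proof (induction B rule: finite_induct)
  case (insert x B)
  have "(\<Sum>A\<in>insert x ` Pow B. (-1) ^ card A) = (\<Sum>A\<in>Pow B. (-1) ^ card (insert x A) :: 'r)"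
    using insert by (subst sum.reindex) (auto simp: inj_on_def)
  also have "\<dots> = (\<Sum>A\<in>Pow B. - ((-1) ^ card A))"
    using insert by (intro sum.cong refl) (subst card_insert_disjoint, auto intro: finite_subset)
  finally have *: "(\<Sum>A\<in>insert x ` Pow B. (-1) ^ card A) = - (\<Sum>A\<in>Pow B. (-1) ^ card A :: 'r)"
    by (simp add: sum_negf)
  show ?case using insert
    by (subst Pow_insert, subst sum.union_disjoint) (auto simp: *)
qed simp

lemma sum_alternating_Pow_mult:
  assumes "finite B"
  shows "(\<Sum>A\<in>Pow B. (-1) ^ card A * x) = (if B = {} then x else 0 :: 'r::comm_ring_1)"
  unfolding sum_distrib_right[symmetric] sum_alternating_Pow[OF assms] by simp

section \<open>Harmonic functions and their extensions to larger layers\<close>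

definition extend :: "nat \<Rightarrow> ('a set \<Rightarrow> real) \<Rightarrow> 'a set \<Rightarrow> real" where
  "extend k p S = (\<Sum>R\<in>layer S k. p R)"

text \<open>The kernel of the map from \<open>k\<close>-sets to \<open>(k - 1)\<close>-sets that
  sums over supersets. Writing \<open>Suc (card R) = k\<close> avoids truncated subtraction: for
  \<open>k = 0\<close> every function is harmonic.\<close>

definition harmonic :: "'a set \<Rightarrow> nat \<Rightarrow> ('a set \<Rightarrow> real) \<Rightarrow> bool" where
  "harmonic N k p \<longleftrightarrow>
     (\<forall>R. R \<subseteq> N \<longrightarrow> Suc (card R) = k \<longrightarrow> (\<Sum>S | S \<in> layer N k \<and> R \<subseteq> S. p S) = 0)"

text \<open>Double counting: a set \<open>S\<close> containing \<open>R\<close> is met once for each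
  of its \<open>k - card R\<close> elements outside \<open>R\<close>.\<close>

lemma sum_supersets_step:
  fixes g :: "'a set \<Rightarrow> 'r::comm_ring_1"
  assumes "finite N" "R \<subseteq> N" "\<X> \<subseteq> layer N k"
  shows "(\<Sum>x\<in>N - R. \<Sum>S | S \<in> \<X> \<and> insert x R \<subseteq> S. g S)
       = of_nat (k - card R) * (\<Sum>S | S \<in> \<X> \<and> R \<subseteq> S. g S)"
proof -
  have fin: "finite \<X>" using assms finite_layer finite_subset by metis
  have "(\<Sum>x\<in>N - R. \<Sum>S | S \<in> \<X> \<and> insert x R \<subseteq> S. g S)
      = (\<Sum>x\<in>N - R. \<Sum>S | S \<in> {S \<in> \<X>. R \<subseteq> S} \<and> x \<in> S. g S)"
    by (intro sum.cong) auto
  also have "\<dots> = (\<Sum>S | S \<in> \<X> \<and> R \<subseteq> S. \<Sum>x | x \<in> N - R \<and> x \<in> S. g S)"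
    by (rule sum.swap_restrict) (use assms fin in auto)
  also have "\<dots> = (\<Sum>S | S \<in> \<X> \<and> R \<subseteq> S. of_nat (k - card R) * g S)"
  proof (intro sum.cong refl)
    fix S assume S: "S \<in> {S \<in> \<X>. R \<subseteq> S}"
    then have "{x. x \<in> N - R \<and> x \<in> S} = S - R" "card S = k" "finite R"
      using assms finite_subset by (auto simp: layer_def)
    then show "(\<Sum>x | x \<in> N - R \<and> x \<in> S. g S) = of_nat (k - card R) * g S"
      using S by (simp add: card_Diff_subset)
  qed
  finally show ?thesis by (simp add: sum_distrib_left)
qed

text \<open>Induction from larger \<open>R\<close> to smaller ones, cancelling the factor
  \<open>k - card R\<close> of the double count. A general \<open>\<X>\<close> allows both the full
  layer and a family of sets.\<close>

lemma sum_supersets_eq_0_mono: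
  fixes g :: "'a set \<Rightarrow> 'r::{comm_ring_1,semiring_char_0,ring_no_zero_divisors}"
  assumes "finite N" "\<X> \<subseteq> layer N k" "m \<le> k"
    and "\<And>R. R \<in> layer N m \<Longrightarrow> (\<Sum>S | S \<in> \<X> \<and> R \<subseteq> S. g S) = 0"
    and "R \<subseteq> N" "card R \<le> m"
  shows "(\<Sum>S | S \<in> \<X> \<and> R \<subseteq> S. g S) = 0"
  using assms(5,6)
proof (induction "m - card R" arbitrary: R)
  case 0
  then show ?case using assms(4) by (auto simp: layer_def)
next
  case (Suc d)
  have fin: "finite R" using Suc assms finite_subset by auto
  have "(\<Sum>S | S \<in> \<X> \<and> insert x R \<subseteq> S. g S) = 0" if "x \<in> N - R" for x
    using that Suc fin by (intro Suc(1)) auto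
  then have "of_nat (k - card R) * (\<Sum>S | S \<in> \<X> \<and> R \<subseteq> S. g S) = 0"
    using sum_supersets_step[OF assms(1) Suc(3) assms(2), of g] by simp
  moreover have "k - card R \<noteq> 0" using Suc assms(3) by simp
  ultimately show ?case by simp
qed

lemma harmonic_sum_supersets:
  assumes "finite N" "harmonic N k p" "R \<subseteq> N" "card R < k"
  shows "(\<Sum>S | S \<in> layer N k \<and> R \<subseteq> S. p S) = 0"
proof (rule sum_supersets_eq_0_mono[of N "layer N k" k "k - 1"])
  fix R assume "R \<in> layer N (k - 1)"
  then have "R \<subseteq> N" "Suc (card R) = k" using assms(4) by (auto simp: layer_def)
  then show "(\<Sum>S | S \<in> layer N k \<and> R \<subseteq> S. p S) = 0" using assms(2) by (simp add: harmonic_def)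
qed (use assms in auto)

text \<open>Inclusion-exclusion over \<open>A \<subseteq> J\<close>: harmonicity kills the terms
  with \<open>card A < k\<close>, no \<open>k\<close>-set contains a larger \<open>A\<close>, and
  the \<open>k\<close>-subsets of \<open>J\<close> remain with sign \<open>(-1) ^ k\<close>.\<close>

lemma harmonic_sum_disjoint:
  assumes "finite N" "harmonic N k p" "J \<subseteq> N"
  shows "(\<Sum>R | R \<in> layer N k \<and> R \<inter> J = {}. p R) = (-1) ^ k * extend k p J"
proof -
  have finJ: "finite J" using assms finite_subset by auto
  have "(\<Sum>R | R \<in> layer N k \<and> R \<inter> J = {}. p R)
      = (\<Sum>R\<in>layer N k. if R \<inter> J = {} then p R else 0)"
    using assms by (subst sum.inter_filter[symmetric]) auto
  also have "\<dots> = (\<Sum>R\<in>layer N k. \<Sum>A\<in>Pow (R \<inter> J). (-1) ^ card A * p R)"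
    using finJ by (intro sum.cong refl) (subst sum_alternating_Pow_mult, auto)
  also have "\<dots> = (\<Sum>R\<in>layer N k. \<Sum>A | A \<in> Pow J \<and> A \<subseteq> R. (-1) ^ card A * p R)"
    by (intro sum.cong) auto
  also have "\<dots> = (\<Sum>A\<in>Pow J. \<Sum>R | R \<in> layer N k \<and> A \<subseteq> R. (-1) ^ card A * p R)"
    using assms finJ by (intro sum.swap_restrict) auto
  also have "\<dots> = (\<Sum>A\<in>Pow J. if card A = k then (-1) ^ k * p A else 0)"
  proof (intro sum.cong refl)
    fix A assume A: "A \<in> Pow J"
    then have fA: "finite A" "A \<subseteq> N" using finJ assms finite_subset by auto
    consider "card A < k" | "card A = k" | "card A > k" by linarith
    then show "(\<Sum>R | R \<in> layer N k \<and> A \<subseteq> R. (-1) ^ card A * p R)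
        = (if card A = k then (-1) ^ k * p A else 0)"
    proof cases
      case 1
      then show ?thesis using harmonic_sum_supersets[OF assms(1,2) fA(2)]
        by (simp flip: sum_distrib_left)
    next
      case 2
      have "{R. R \<in> layer N k \<and> A \<subseteq> R} = {A}"
      proof (intro equalityI subsetI)
        fix R assume "R \<in> {R. R \<in> layer N k \<and> A \<subseteq> R}"
        then show "R \<in> {A}"
          using card_subset_eq[of R A] finite_in_layer[OF assms(1), of R k] 2 by (auto simp: layer_def)
      qed (use 2 fA in \<open>auto simp: layer_def\<close>)
      then show ?thesis using 2 by simp
    next
      case 3
      have e: "{R. R \<in> layer N k \<and> A \<subseteq> R} = {}"
      proof (intro equals0I)
        fix R assume "R \<in> {R. R \<in> layer N k \<and> A \<subseteq> R}"
        then show False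
          using card_mono[of R A] finite_in_layer[OF assms(1), of R k] 3 by (auto simp: layer_def)
      qed
      show ?thesis using 3 unfolding e by simp
    qed
  qed
  also have "\<dots> = (-1) ^ k * extend k p J"
    using finJ by (simp add: extend_def sum_distrib_left layer_def Pow_def flip: sum.inter_filter)
  finally show ?thesis .
qed

text \<open>A \<open>k\<close>-subset of \<open>S\<close> lies in
  \<open>(card S - k) choose (j - k)\<close> of the \<open>j\<close>-subsets of
  \<open>S\<close>.\<close>

lemma extend_extend:
  assumes "finite S" "k \<le> j"
  shows "(\<Sum>J\<in>layer S j. extend k p J) = real ((card S - k) choose (j - k)) * extend k p S"
proof -
  have "(\<Sum>J\<in>layer S j. extend k p J) = (\<Sum>J\<in>layer S j. \<Sum>R | R \<in> layer S k \<and> R \<subseteq> J. p R)"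
    unfolding extend_def by (intro sum.cong) (auto simp: layer_def)
  also have "\<dots> = (\<Sum>R\<in>layer S k. \<Sum>J | J \<in> layer S j \<and> R \<subseteq> J. p R)"
    using assms by (intro sum.swap_restrict) auto
  also have "\<dots> = (\<Sum>R\<in>layer S k. real ((card S - k) choose (j - k)) * p R)"
  proof (intro sum.cong refl)
    fix R assume "R \<in> layer S k"
    then show "(\<Sum>J | J \<in> layer S j \<and> R \<subseteq> J. p R) = real ((card S - k) choose (j - k)) * p R"
      using card_layer_supersets[of S R j] assms by (auto simp: layer_def[of S k])
  qed
  finally show ?thesis by (simp add: extend_def sum_distrib_left)
qed

lemma harmonic_extend_sum_disjoint:
  assumes "finite N" "harmonic N k p" "J \<subseteq> N" "k \<le> w"
  shows "(\<Sum>T | T \<in> layer N w \<and> T \<inter> J = {}. extend k p T)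
       = (-1) ^ k * real ((card N - card J - k) choose (w - k)) * extend k p J"
proof -
  have "(\<Sum>T | T \<in> layer N w \<and> T \<inter> J = {}. extend k p T)
      = (\<Sum>T | T \<in> layer N w \<and> T \<inter> J = {}. \<Sum>R | R \<in> layer N k \<and> R \<subseteq> T. p R)"
    unfolding extend_def by (intro sum.cong) (auto simp: layer_def)
  also have "\<dots> = (\<Sum>R\<in>layer N k. \<Sum>T | T \<in> {T \<in> layer N w. T \<inter> J = {}} \<and> R \<subseteq> T. p R)"
    using assms by (intro sum.swap_restrict) auto
  also have "\<dots> = (\<Sum>R\<in>layer N k. if R \<inter> J = {} then
        real ((card N - card J - k) choose (w - k)) * p R else 0)"
  proof (intro sum.cong refl)
    fix R assume R: "R \<in> layer N k"
    have *: "{T. T \<in> {T \<in> layer N w. T \<inter> J = {}} \<and> R \<subseteq> T} = {T \<in> layer N w. R \<subseteq> T \<and> T \<inter> J = {}}"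
      by auto
    show "(\<Sum>T | T \<in> {T \<in> layer N w. T \<inter> J = {}} \<and> R \<subseteq> T. p R) = (if R \<inter> J = {} then
        real ((card N - card J - k) choose (w - k)) * p R else 0)"
    proof (cases "R \<inter> J = {}")
      case True
      then show ?thesis
        using card_layer_between[OF assms(1) _ assms(3) True, of w] R assms(4) unfolding *
        by (simp add: layer_def[of N k])
    next
      case False
      then have "{T \<in> layer N w. R \<subseteq> T \<and> T \<inter> J = {}} = {}" by auto
      then show ?thesis using False unfolding * by (simp only: sum.empty if_False)
    qed
  qed
  also have "\<dots> = real ((card N - card J - k) choose (w - k)) * (\<Sum>R | R \<in> layer N k \<and> R \<inter> J = {}. p R)"
    using assms(1) by (simp add: sum_distrib_left sum.inter_filter[symmetric])
  finally show ?thesis using harmonic_sum_disjoint[OF assms(1-3)] by simp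
qed

text \<open>Reading \<open>card (S - T) choose j\<close> as the number of \<open>j\<close>-subsets
  \<open>J\<close> of \<open>S\<close> disjoint from \<open>T\<close> factors the kernel through
  \<open>layer S j\<close>: the sum over \<open>T\<close> for fixed \<open>J\<close> is a multiple
  of \<open>extend k p J\<close>, and summing these over \<open>J\<close> gives a multiple of
  \<open>extend k p S\<close>.\<close>

lemma harmonic_eigenvector:
  assumes "finite N" "harmonic N k p" "S \<in> layer N w" "k \<le> w"
  shows "(\<Sum>T\<in>layer N w. real (card (S - T) choose j) * extend k p T)
       = (if k \<le> j then (-1) ^ k * real ((w - k) choose (j - k))
            * real ((card N - j - k) choose (w - k)) else 0) * extend k p S"
proof -
  have S: "S \<subseteq> N" "card S = w" "finite S" using assms finite_subset by (auto simp: layer_def)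
  have "(\<Sum>T\<in>layer N w. real (card (S - T) choose j) * extend k p T)
      = (\<Sum>T\<in>layer N w. \<Sum>J | J \<in> layer S j \<and> T \<inter> J = {}. extend k p T)"
  proof (intro sum.cong refl)
    fix T
    have "{J. J \<in> layer S j \<and> T \<inter> J = {}} = layer (S - T) j" by (auto simp: layer_def)
    then show "real (card (S - T) choose j) * extend k p T = (\<Sum>J | J \<in> layer S j \<and> T \<inter> J = {}. extend k p T)"
      using S by (simp add: card_layer)
  qed
  also have "\<dots> = (\<Sum>J\<in>layer S j. \<Sum>T | T \<in> layer N w \<and> T \<inter> J = {}. extend k p T)"
    using assms S by (intro sum.swap_restrict) auto
  also have "\<dots> = (\<Sum>J\<in>layer S j. (-1) ^ k * real ((card N - j - k) choose (w - k)) * extend k p J)"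
    using S assms by (intro sum.cong refl) (subst harmonic_extend_sum_disjoint, auto simp: layer_def)
  also have "\<dots> = (-1) ^ k * real ((card N - j - k) choose (w - k)) * (\<Sum>J\<in>layer S j. extend k p J)"
    by (simp add: sum_distrib_left)
  also have "\<dots> = (if k \<le> j then (-1) ^ k * real ((w - k) choose (j - k))
            * real ((card N - j - k) choose (w - k)) else 0) * extend k p S"
  proof (cases "k \<le> j")
    case False
    have "extend k p J = 0" if "J \<in> layer S j" for J
      using that False S finite_subset[of J S] by (auto simp: extend_def layer_def layer_eq_empty[unfolded layer_def])
    then show ?thesis using False by simp
  qed (use S extend_extend[of S k j p] in auto)
  finally show ?thesis .
qed

text \<open>Inclusion-exclusion over \<open>A \<subseteq> R\<close> replaces the containment
  \<open>R \<subseteq> S\<close> by disjointness from \<open>A\<close>. Each term is then a multiple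
  of \<open>extend k p A\<close>, an empty sum because \<open>card A < k\<close>.\<close>

lemma harmonic_extend_sum_supersets:
  assumes "finite N" "harmonic N k p" "k \<le> w" "R \<subseteq> N" "card R < k"
  shows "(\<Sum>S | S \<in> layer N w \<and> R \<subseteq> S. extend k p S) = 0"
proof -
  have fin: "finite R" using assms finite_subset by auto
  have "(\<Sum>S | S \<in> layer N w \<and> R \<subseteq> S. extend k p S)
      = (\<Sum>S\<in>layer N w. if R - S = {} then extend k p S else 0)"
    using assms by (subst sum.inter_filter[symmetric]) (auto intro: sum.cong)
  also have "\<dots> = (\<Sum>S\<in>layer N w. \<Sum>A\<in>Pow (R - S). (-1) ^ card A * extend k p S)"
    using fin by (intro sum.cong refl) (subst sum_alternating_Pow_mult, auto)
  also have "\<dots> = (\<Sum>S\<in>layer N w. \<Sum>A | A \<in> Pow R \<and> S \<inter> A = {}. (-1) ^ card A * extend k p S)"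
    by (intro sum.cong) auto
  also have "\<dots> = (\<Sum>A\<in>Pow R. \<Sum>S | S \<in> layer N w \<and> S \<inter> A = {}. (-1) ^ card A * extend k p S)"
    using assms fin by (intro sum.swap_restrict) auto
  also have "\<dots> = (\<Sum>A\<in>Pow R. 0)"
  proof (intro sum.cong refl)
    fix A assume A: "A \<in> Pow R"
    then have "finite A" "card A < k" "A \<subseteq> N"
      using fin assms card_mono[of R A] finite_subset by auto
    then have "extend k p A = 0" by (simp add: extend_def layer_eq_empty)
    then show "(\<Sum>S | S \<in> layer N w \<and> S \<inter> A = {}. (-1) ^ card A * extend k p S) = 0"
      using harmonic_extend_sum_disjoint[OF assms(1,2) \<open>A \<subseteq> N\<close> assms(3)] by (simp flip: sum_distrib_left)
  qed
  finally show ?thesis by simp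
qed

text \<open>Extension and summation over supersets are adjoint to each other.\<close>

lemma sum_mult_extend:
  assumes "finite N"
  shows "(\<Sum>S\<in>layer N w. c S * extend k p S)
       = (\<Sum>R\<in>layer N k. p R * (\<Sum>S | S \<in> layer N w \<and> R \<subseteq> S. c S))"
proof -
  have "(\<Sum>S\<in>layer N w. c S * extend k p S)
      = (\<Sum>S\<in>layer N w. \<Sum>R | R \<in> layer N k \<and> R \<subseteq> S. c S * p R)"
    unfolding extend_def sum_distrib_left by (intro sum.cong) (auto simp: layer_def)
  also have "\<dots> = (\<Sum>R\<in>layer N k. \<Sum>S | S \<in> layer N w \<and> R \<subseteq> S. c S * p R)"
    using assms by (intro sum.swap_restrict) auto
  finally show ?thesis by (simp add: sum_distrib_left mult.commute)
qed

text \<open>Adjointness moves the extension of lower degree to the other side, where the extension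
  of higher degree is summed over the supersets of a set too small for a nonzero sum.\<close>

lemma harmonic_orthogonal:
  assumes "finite N" "harmonic N i p" "harmonic N j q" "i \<le> w" "j \<le> w" "i \<noteq> j"
  shows "(\<Sum>S\<in>layer N w. extend i p S * extend j q S) = 0"
proof -
  have *: "(\<Sum>S\<in>layer N w. extend j q S * extend i p S) = 0"
    if "harmonic N j q" "j \<le> w" "i < j" for i j p q
    using that assms(1) harmonic_extend_sum_supersets[of N j q w]
    by (subst sum_mult_extend) (auto simp: layer_def intro!: sum.neutral)
  from assms(6) consider "i < j" | "j < i" by linarith
  then show ?thesis
  proof cases
    case 1
    then show ?thesis using *[of j q i p] assms by (simp add: mult.commute)
  next
    case 2
    then show ?thesis using *[of i p j q] assms by simp
  qed
qed

section \<open>Splitting functions on a layer into harmonic parts\<close>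

lemma orthogonal_residual_exists:
  fixes a :: "'j \<Rightarrow> 'i \<Rightarrow> real"
  assumes "finite J" "finite I"
  shows "\<exists>u. \<forall>j\<in>J. (\<Sum>i\<in>I. (g i - (\<Sum>l\<in>J. u l * a l i)) * a j i) = 0"
  using assms(1)
proof (induction J arbitrary: g rule: finite_induct)
  case (insert j0 J)
  obtain u where u: "\<And>j. j \<in> J \<Longrightarrow> (\<Sum>i\<in>I. (g i - (\<Sum>l\<in>J. u l * a l i)) * a j i) = 0"
    using insert.IH by blast
  obtain v where v: "\<And>j. j \<in> J \<Longrightarrow> (\<Sum>i\<in>I. (a j0 i - (\<Sum>l\<in>J. v l * a l i)) * a j i) = 0"
    using insert.IH by blast
  define r where "r i = g i - (\<Sum>l\<in>J. u l * a l i)" for i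
  define e where "e i = a j0 i - (\<Sum>l\<in>J. v l * a l i)" for i
  define s where "s = (\<Sum>i\<in>I. r i * e i) / (\<Sum>i\<in>I. e i * e i)"
  define z where "z l = (if l = j0 then s else u l - s * v l)" for l
  have z: "g i - (\<Sum>l\<in>insert j0 J. z l * a l i) = r i - s * e i" for i
  proof -
    have "(\<Sum>l\<in>J. z l * a l i) = (\<Sum>l\<in>J. u l * a l i - s * (v l * a l i))"
      using insert by (intro sum.cong) (auto simp: z_def algebra_simps)
    then show ?thesis using insert
      by (simp add: r_def e_def z_def sum_subtractf algebra_simps flip: sum_distrib_left)
  qed
  \<comment> \<open>If \<open>e\<close> vanishes on \<open>I\<close>, then \<open>a j0\<close>
    depends on the other vectors and any value of \<open>s\<close> works, in particular the quotient
    by zero.\<close>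
  have re: "(\<Sum>i\<in>I. (r i - s * e i) * e i) = 0"
  proof (cases "(\<Sum>i\<in>I. e i * e i) = 0")
    case True
    then have "\<forall>i\<in>I. e i = 0" using assms(2) by (subst (asm) sum_nonneg_eq_0_iff) auto
    then show ?thesis by simp
  next
    case False
    then show ?thesis by (simp add: left_diff_distrib sum_subtractf mult.assoc s_def flip: sum_distrib_left sum_divide_distrib)
  qed
  have J: "(\<Sum>i\<in>I. (r i - s * e i) * a j i) = 0" if "j \<in> J" for j
    using u[OF that] v[OF that]
    by (simp add: left_diff_distrib sum_subtractf mult.assoc flip: sum_distrib_left r_def e_def)
  have "(\<Sum>i\<in>I. (r i - s * e i) * a j0 i)
      = (\<Sum>i\<in>I. (r i - s * e i) * e i) + (\<Sum>i\<in>I. \<Sum>l\<in>J. v l * ((r i - s * e i) * a l i))"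
  proof -
    have "(\<Sum>l\<in>J. v l * ((r i - s * e i) * a l i)) = (r i - s * e i) * (\<Sum>l\<in>J. v l * a l i)" for i
      by (simp add: sum_distrib_left mult.left_commute)
    then show ?thesis
      unfolding sum.distrib[symmetric] by (simp add: e_def flip: distrib_left)
  qed
  also have "(\<Sum>i\<in>I. \<Sum>l\<in>J. v l * ((r i - s * e i) * a l i)) = 0"
    by (subst sum.swap) (auto simp: J simp flip: sum_distrib_left intro!: sum.neutral)
  finally have "(\<Sum>i\<in>I. (r i - s * e i) * a j0 i) = 0" using re by simp
  then show ?case using J by (intro exI[of _ z]) (auto simp: z)
qed simp

text \<open>On the next layer, \<open>g\<close> is approximated by extensions from
  \<open>k\<close>-sets in the sense of least squares. The normal equations say exactly that the
  residual is harmonic of degree \<open>Suc k\<close>, and the approximating function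
  \<open>u\<close> on \<open>k\<close>-sets is decomposed by induction.\<close>

lemma harmonic_decomposition:
  assumes "finite N"
  shows "\<exists>p. (\<forall>i\<le>k. harmonic N i (p i)) \<and> (\<forall>S\<in>layer N k. g S = (\<Sum>i\<le>k. extend i (p i) S))"
proof (induction k arbitrary: g)
  case 0
  have "extend 0 g S = g S" if "S \<in> layer N 0" for S
  proof -
    have "S = {}" using that assms finite_in_layer by (force simp: layer_def)
    then have "layer S 0 = {S}" by (auto simp: layer_def)
    then show ?thesis by (simp add: extend_def)
  qed
  then show ?case by (intro exI[of _ "\<lambda>_. g"]) (auto simp: harmonic_def)
next
  case (Suc k)
  define a :: "'a set \<Rightarrow> 'a set \<Rightarrow> real" where "a R S = (if R \<subseteq> S then 1 else 0)" for R S
  have incl: "(\<Sum>R\<in>layer N k. u R * a R S) = extend k u S" if "S \<in> layer N (Suc k)" for u S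
  proof -
    have "(\<Sum>R\<in>layer N k. u R * a R S) = (\<Sum>R | R \<in> layer N k \<and> R \<subseteq> S. u R)"
      using assms by (subst sum.inter_filter) (auto simp: a_def intro: sum.cong)
    also have "{R. R \<in> layer N k \<and> R \<subseteq> S} = layer S k" using that by (auto simp: layer_def)
    finally show ?thesis by (simp add: extend_def)
  qed
  obtain u where u: "\<forall>R\<in>layer N k.
      (\<Sum>S\<in>layer N (Suc k). (g S - (\<Sum>R\<in>layer N k. u R * a R S)) * a R S) = 0"
    using orthogonal_residual_exists[OF finite_layer[OF assms] finite_layer[OF assms]] by blast
  define h where "h S = g S - extend k u S" for S
  obtain p where p: "\<And>i. i \<le> k \<Longrightarrow> harmonic N i (p i)"
    "\<And>S. S \<in> layer N k \<Longrightarrow> u S = (\<Sum>i\<le>k. extend i (p i) S)"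
    using Suc[of u] by blast
  \<comment> \<open>The factor is \<open>(Suc k - i) choose (k - i)\<close>, the multiplicity with
    which extending via \<open>k\<close>-sets counts each \<open>i\<close>-set.\<close>
  define q where "q i = (if i = Suc k then h else (\<lambda>R. real (Suc k - i) * p i R))" for i
  have "harmonic N (Suc k) h"
    unfolding harmonic_def
  proof (intro allI impI)
    fix R assume "R \<subseteq> N" "Suc (card R) = Suc k"
    then have "(\<Sum>S\<in>layer N (Suc k). (g S - (\<Sum>R\<in>layer N k. u R * a R S)) * a R S) = 0"
      using u by (simp add: layer_def[of N k])
    moreover have "(\<Sum>S\<in>layer N (Suc k). (g S - (\<Sum>R\<in>layer N k. u R * a R S)) * a R S)
        = (\<Sum>S\<in>layer N (Suc k). if R \<subseteq> S then h S else 0)"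
      by (intro sum.cong refl) (simp only: incl h_def, simp add: a_def)
    ultimately show "(\<Sum>S | S \<in> layer N (Suc k) \<and> R \<subseteq> S. h S) = 0"
      using assms by (subst sum.inter_filter) auto
  qed
  moreover have "harmonic N i (\<lambda>R. real (Suc k - i) * p i R)" if "i \<le> k" for i
    using p(1)[OF that] by (auto simp: harmonic_def simp flip: sum_distrib_left)
  ultimately have "\<forall>i\<le>Suc k. harmonic N i (q i)" by (auto simp: q_def le_Suc_eq)
  moreover have "g S = (\<Sum>i\<le>Suc k. extend i (q i) S)" if S: "S \<in> layer N (Suc k)" for S
  proof -
    have fS: "finite S" "card S = Suc k" "S \<subseteq> N" using S assms finite_subset by (auto simp: layer_def)
    have "extend k u S = (\<Sum>R\<in>layer S k. \<Sum>i\<le>k. extend i (p i) R)"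
      unfolding extend_def[of k u] using fS by (intro sum.cong refl p(2)) (auto simp: layer_def)
    also have "\<dots> = (\<Sum>i\<le>k. \<Sum>R\<in>layer S k. extend i (p i) R)" by (rule sum.swap)
    also have "\<dots> = (\<Sum>i\<le>k. extend i (q i) S)"
    proof (intro sum.cong refl)
      fix i assume i: "i \<in> {..k}"
      have "Suc k - i choose (k - i) = Suc k - i" using i by (auto simp: Suc_diff_le)
      then show "(\<Sum>R\<in>layer S k. extend i (p i) R) = extend i (q i) S"
        using i fS extend_extend[of S i k "p i"] by (simp add: q_def extend_def flip: sum_distrib_left)
    qed
    finally have "g S = (\<Sum>i\<le>k. extend i (q i) S) + h S" by (simp add: h_def)
    moreover have "extend (Suc k) (q (Suc k)) S = h S"
    proof -
      have "layer S (Suc k) = {S}"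
        using fS by (auto simp: layer_def dest: card_subset_eq)
      then show ?thesis by (simp add: extend_def q_def)
    qed
    ultimately show ?thesis by simp
  qed
  ultimately show ?case by blast
qed

text \<open>The eigenvalue on the \<open>i\<close>-th harmonic space of the kernel \<open>\<Sum>\<^sub>j \<beta> j * (card (S - T) choose j)\<close>.\<close>

definition eigenvalue :: "nat \<Rightarrow> nat \<Rightarrow> (nat \<Rightarrow> real) \<Rightarrow> nat \<Rightarrow> real" where
  "eigenvalue n w \<beta> i =
     (-1) ^ i * (\<Sum>j=i..w. \<beta> j * real ((w - i) choose (j - i)) * real ((n - j - i) choose (w - i)))"

text \<open>The sums \<open>c S * extend i (p i) S\<close> are the squared norms of the harmonic
  components of \<open>c\<close>, by orthogonality; every kernel acts on these components by
  scalars. The quantifier over \<open>\<beta>\<close> sits inside, so that several kernels can be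
  compared on the same components.\<close>

lemma spectral_decomposition:
  fixes c :: "'a set \<Rightarrow> real"
  assumes N: "finite N" "card N = n"
  obtains p where "\<And>i. i \<le> w \<Longrightarrow> harmonic N i (p i)"
    "\<And>i. i \<le> w \<Longrightarrow> (\<Sum>S\<in>layer N w. c S * extend i (p i) S) \<ge> 0"
    "(\<Sum>S\<in>layer N w. c S ^ 2) = (\<Sum>i\<le>w. \<Sum>S\<in>layer N w. c S * extend i (p i) S)"
    "\<And>\<beta>. (\<Sum>S\<in>layer N w. \<Sum>T\<in>layer N w. c S * c T * (\<Sum>j\<le>w. \<beta> j * real (card (S - T) choose j)))
        = (\<Sum>i\<le>w. eigenvalue n w \<beta> i * (\<Sum>S\<in>layer N w. c S * extend i (p i) S))"
proof -
  obtain p where p: "\<And>i. i \<le> w \<Longrightarrow> harmonic N i (p i)"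
    "\<And>S. S \<in> layer N w \<Longrightarrow> c S = (\<Sum>i\<le>w. extend i (p i) S)"
    using harmonic_decomposition[OF N(1), of w c] by blast
  let ?L = "layer N w"
  have "(\<Sum>S\<in>?L. c S * extend i (p i) S) = (\<Sum>S\<in>?L. (extend i (p i) S)\<^sup>2)" if i: "i \<le> w" for i
  proof -
    have "(\<Sum>S\<in>?L. c S * extend i (p i) S) = (\<Sum>S\<in>?L. \<Sum>j\<le>w. extend j (p j) S * extend i (p i) S)"
      by (intro sum.cong) (auto simp: p(2) sum_distrib_right)
    also have "\<dots> = (\<Sum>j\<le>w. \<Sum>S\<in>?L. extend j (p j) S * extend i (p i) S)" by (rule sum.swap)
    also have "\<dots> = (\<Sum>j\<le>w. if j = i then \<Sum>S\<in>?L. (extend i (p i) S)\<^sup>2 else 0)"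
      using i N p(1) by (intro sum.cong) (auto simp: harmonic_orthogonal power2_eq_square)
    finally show ?thesis using i by simp
  qed
  then have nonneg: "(\<Sum>S\<in>?L. c S * extend i (p i) S) \<ge> 0" if "i \<le> w" for i
    using that by (simp add: sum_nonneg)
  have act: "(\<Sum>T\<in>?L. c T * (\<Sum>j\<le>w. \<beta> j * real (card (S - T) choose j)))
      = (\<Sum>i\<le>w. eigenvalue n w \<beta> i * extend i (p i) S)" if S: "S \<in> ?L" for \<beta> S
  proof -
    have "(\<Sum>T\<in>?L. c T * (\<Sum>j\<le>w. \<beta> j * real (card (S - T) choose j)))
        = (\<Sum>T\<in>?L. \<Sum>i\<le>w. \<Sum>j\<le>w. \<beta> j * (real (card (S - T) choose j) * extend i (p i) T))"
    proof (intro sum.cong refl)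
      fix T assume "T \<in> ?L"
      then show "c T * (\<Sum>j\<le>w. \<beta> j * real (card (S - T) choose j))
          = (\<Sum>i\<le>w. \<Sum>j\<le>w. \<beta> j * (real (card (S - T) choose j) * extend i (p i) T))"
        by (simp add: p(2) sum_product mult_ac)
    qed
    also have "\<dots> = (\<Sum>i\<le>w. \<Sum>j\<le>w. \<Sum>T\<in>?L. \<beta> j * (real (card (S - T) choose j) * extend i (p i) T))"
      by (subst sum.swap, intro sum.cong refl, subst sum.swap, rule refl)
    also have "\<dots> = (\<Sum>i\<le>w. eigenvalue n w \<beta> i * extend i (p i) S)"
    proof (intro sum.cong refl)
      fix i assume "i \<in> {..w}"
      then have i: "i \<le> w" by simp
      have "(\<Sum>j\<le>w. \<Sum>T\<in>?L. \<beta> j * (real (card (S - T) choose j) * extend i (p i) T))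
          = (\<Sum>j\<le>w. if i \<le> j then (-1) ^ i * (\<beta> j * real ((w - i) choose (j - i))
              * real ((n - j - i) choose (w - i))) * extend i (p i) S else 0)"
        using harmonic_eigenvector[OF N(1) p(1)[OF i] S i] N(2)
        by (intro sum.cong refl) (auto simp flip: sum_distrib_left)
      also have "\<dots> = (\<Sum>j=i..w. (-1) ^ i * (\<beta> j * real ((w - i) choose (j - i))
              * real ((n - j - i) choose (w - i))) * extend i (p i) S)"
        by (subst sum.inter_filter[symmetric]) (auto intro: sum.cong)
      finally show "(\<Sum>j\<le>w. \<Sum>T\<in>?L. \<beta> j * (real (card (S - T) choose j) * extend i (p i) T))
          = eigenvalue n w \<beta> i * extend i (p i) S"
        by (simp add: eigenvalue_def sum_distrib_left sum_distrib_right mult_ac)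
    qed
    finally show ?thesis .
  qed
  have "(\<Sum>S\<in>?L. \<Sum>T\<in>?L. c S * c T * (\<Sum>j\<le>w. \<beta> j * real (card (S - T) choose j)))
      = (\<Sum>S\<in>?L. \<Sum>i\<le>w. eigenvalue n w \<beta> i * (c S * extend i (p i) S))" for \<beta>
  proof (intro sum.cong refl)
    fix S assume S: "S \<in> ?L"
    have "(\<Sum>T\<in>?L. c S * c T * (\<Sum>j\<le>w. \<beta> j * real (card (S - T) choose j)))
        = c S * (\<Sum>i\<le>w. eigenvalue n w \<beta> i * extend i (p i) S)"
      unfolding act[OF S, symmetric] by (simp only: sum_distrib_left[of "c S"] mult.assoc)
    then show "(\<Sum>T\<in>?L. c S * c T * (\<Sum>j\<le>w. \<beta> j * real (card (S - T) choose j)))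
        = (\<Sum>i\<le>w. eigenvalue n w \<beta> i * (c S * extend i (p i) S))"
      by (simp only: sum_distrib_left[of "c S"] mult.left_commute)
  qed
  then have "(\<Sum>S\<in>?L. \<Sum>T\<in>?L. c S * c T * (\<Sum>j\<le>w. \<beta> j * real (card (S - T) choose j)))
      = (\<Sum>i\<le>w. eigenvalue n w \<beta> i * (\<Sum>S\<in>?L. c S * extend i (p i) S))" for \<beta>
    by (subst sum_distrib_left, subst sum.swap) simp
  moreover have "(\<Sum>S\<in>?L. c S ^ 2) = (\<Sum>i\<le>w. \<Sum>S\<in>?L. c S * extend i (p i) S)"
    by (subst sum.swap, intro sum.cong refl)
      (simp add: power2_eq_square p(2) flip: sum_distrib_left)
  ultimately show thesis using p(1) nonneg that by blast
qed

section \<open>Integrality of the numbers K\<close>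

lemma card_diff_layer:
  assumes "finite N" "S \<in> layer N w" "T \<in> layer N w"
  shows "card (T - S) = w - card (S \<inter> T)" "card (S \<inter> T) \<le> w" "card (T - S) = card (S - T)"
proof -
  have "finite S" "finite T" "card S = w" "card T = w"
    using assms finite_in_layer by (auto simp: layer_def)
  then show "card (T - S) = w - card (S \<inter> T)" "card (S \<inter> T) \<le> w" "card (T - S) = card (S - T)"
    using card_Diff_subset_Int[of T S] card_Diff_subset_Int[of S T] card_mono[of S "S \<inter> T"]
    by (auto simp: Int_commute)
qed

lemma card_diff_triangle:
  assumes "finite S" "finite T"
  shows "card (S - U) \<le> card (S - T) + card (T - U)"
proof -
  have "card (S - U) \<le> card ((S - T) \<union> (T - U))" using assms by (intro card_mono) auto
  then show ?thesis using card_Un_le[of "S - T" "T - U"] by linarith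
qed

lemma card_diff_eq_0_iff:
  assumes "finite N" "S \<in> layer N w" "T \<in> layer N w"
  shows "card (S - T) = 0 \<longleftrightarrow> S = T"
proof -
  have "finite S" "finite T" "card S = card T" using assms finite_in_layer by (auto simp: layer_def)
  then show ?thesis using card_subset_eq[of T S] by auto
qed

text \<open>\<open>card (S \<inter> T) choose l\<close> counts the \<open>l\<close>-subsets of
  \<open>T\<close> contained in \<open>S\<close>, so the sum decomposes into superset sums, which
  all vanish.\<close>

lemma sum_choose_inter_eq_0:
  fixes c :: "'a set \<Rightarrow> int"
  assumes N: "finite N" and X: "X \<subseteq> layer N w" and le: "m \<le> w" "l \<le> m" and T: "T \<subseteq> N"
    and c: "\<And>R. R \<in> layer N m \<Longrightarrow> (\<Sum>S | S \<in> X \<and> R \<subseteq> S. c S) = 0"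
  shows "(\<Sum>S\<in>X. c S * int (card (S \<inter> T) choose l)) = 0"
proof -
  have fin: "finite X" "finite T" using N X T finite_layer finite_subset by metis+
  have "(\<Sum>S\<in>X. c S * int (card (S \<inter> T) choose l)) = (\<Sum>S\<in>X. \<Sum>R | R \<in> layer T l \<and> R \<subseteq> S. c S)"
  proof (intro sum.cong refl)
    fix S
    have "{R. R \<in> layer T l \<and> R \<subseteq> S} = layer (S \<inter> T) l" by (auto simp: layer_def)
    then show "c S * int (card (S \<inter> T) choose l) = (\<Sum>R | R \<in> layer T l \<and> R \<subseteq> S. c S)"
      using fin by (simp add: card_layer)
  qed
  also have "\<dots> = (\<Sum>R\<in>layer T l. \<Sum>S | S \<in> X \<and> R \<subseteq> S. c S)"
    using fin by (intro sum.swap_restrict) auto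
  also have "\<dots> = (\<Sum>R\<in>layer T l. 0)"
  proof (intro sum.cong refl)
    fix R assume "R \<in> layer T l"
    then show "(\<Sum>S | S \<in> X \<and> R \<subseteq> S. c S) = 0"
      using sum_supersets_eq_0_mono[OF N X le(1) c, of R] T le(2) by (auto simp: layer_def)
  qed
  finally show ?thesis by simp
qed

lemma square_eq_choose: "int m ^ 2 = 2 * int (m choose 2) + int m"
  by (induction m) (auto simp: numeral_eq_Suc algebra_simps)

lemma cube_eq_choose: "int m ^ 3 = 6 * int (m choose 3) + 6 * int (m choose 2) + int m"
proof (induction m)
  case (Suc m)
  have "int (Suc m) ^ 3 = int m ^ 3 + 3 * int m ^ 2 + 3 * int m + 1"
    by (simp add: power3_eq_cube power2_eq_square algebra_simps)
  then show ?case using Suc square_eq_choose[of m] by (simp add: numeral_eq_Suc)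
qed (simp add: numeral_eq_Suc)

text \<open>There is one equation per 3-set and more unknowns than 3-sets. A cubic in
  \<open>card (T - S) = w - card (S \<inter> T)\<close> is a combination of the binomials of order
  at most 3 in \<open>card (S \<inter> T)\<close>.\<close>

lemma cubic_relation_exists:
  assumes N: "finite N" "card N = n" and X: "X \<subseteq> layer N w" and "3 \<le> w" and big: "n choose 3 < card X"
  obtains c :: "'a set \<Rightarrow> int" where "\<exists>S\<in>X. c S \<noteq> 0"
    "\<forall>T\<in>layer N w. \<forall>x y z.
       (\<Sum>S\<in>X. c S * ((x - int (card (T - S))) * (y - int (card (T - S))) * (z - int (card (T - S))))) = 0"
proof -
  have fin: "finite X" using N X finite_layer finite_subset by metis
  have "card (layer N 3) < card X" using big N by (simp add: card_layer)
  from nontrivial_solution_exists[OF finite_layer[OF N(1)] fin this,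
      of "\<lambda>S R. if R \<subseteq> S then 1 else 0 :: int"]
  obtain c :: "'a set \<Rightarrow> int" where c: "\<exists>S\<in>X. c S \<noteq> 0"
    "\<And>R. R \<in> layer N 3 \<Longrightarrow> (\<Sum>S\<in>X. c S * (if R \<subseteq> S then 1 else 0)) = 0" by blast
  have c3: "(\<Sum>S | S \<in> X \<and> R \<subseteq> S. c S) = 0" if "R \<in> layer N 3" for R
  proof -
    have "(\<Sum>S | S \<in> X \<and> R \<subseteq> S. c S) = (\<Sum>S\<in>X. if R \<subseteq> S then c S else 0)"
      using fin by (subst sum.inter_filter) auto
    also have "\<dots> = (\<Sum>S\<in>X. c S * (if R \<subseteq> S then 1 else 0))" by (intro sum.cong) auto
    finally show ?thesis using c(2)[OF that] by simp
  qed
  have "(\<Sum>S\<in>X. c S * ((x - int (card (T - S))) * (y - int (card (T - S))) * (z - int (card (T - S))))) = 0"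
    if T: "T \<in> layer N w" for T x y z
  proof -
    have TN: "T \<subseteq> N" using T by (auto simp: layer_def)
    have 0: "(\<Sum>S\<in>X. c S * int (card (S \<inter> T) choose l)) = 0" if "l \<le> 3" for l
      by (rule sum_choose_inter_eq_0[OF N(1) X \<open>3 \<le> w\<close> that TN c3])
    define m where "m S = card (S \<inter> T)" for S
    define u v s where "u = x - int w" and "v = y - int w" and "s = z - int w"
    have "(\<Sum>S\<in>X. c S * ((x - int (card (T - S))) * (y - int (card (T - S))) * (z - int (card (T - S)))))
        = (\<Sum>S\<in>X. c S * ((u + int (m S)) * (v + int (m S)) * (s + int (m S))))"
    proof (intro sum.cong refl)
      fix S assume "S \<in> X"
      then have "int (card (T - S)) = int w - int (m S)"
        using card_diff_layer[OF N(1) _ T, of S] X by (auto simp: m_def of_nat_diff)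
      then show "c S * ((x - int (card (T - S))) * (y - int (card (T - S))) * (z - int (card (T - S))))
          = c S * ((u + int (m S)) * (v + int (m S)) * (s + int (m S)))"
        by (simp add: u_def v_def s_def diff_diff_eq2 diff_add_eq)
    qed
    also have "\<dots> = (\<Sum>S\<in>X. 6 * (c S * int (m S choose 3)) + (6 + 2 * (u + v + s)) * (c S * int (m S choose 2))
        + (1 + (u + v + s) + (u * v + u * s + v * s)) * (c S * int (m S choose 1))
        + u * v * s * (c S * int (m S choose 0)))"
    proof (intro sum.cong refl)
      fix S
      have "(u + int (m S)) * (v + int (m S)) * (s + int (m S))
          = int (m S) ^ 3 + (u + v + s) * int (m S) ^ 2 + (u * v + u * s + v * s) * int (m S) + u * v * s"
        by (simp add: power3_eq_cube power2_eq_square algebra_simps)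
      then show "c S * ((u + int (m S)) * (v + int (m S)) * (s + int (m S)))
          = 6 * (c S * int (m S choose 3)) + (6 + 2 * (u + v + s)) * (c S * int (m S choose 2))
          + (1 + (u + v + s) + (u * v + u * s + v * s)) * (c S * int (m S choose 1))
          + u * v * s * (c S * int (m S choose 0))"
        by (simp add: cube_eq_choose square_eq_choose algebra_simps)
    qed
    also have "\<dots> = 0"
      using 0[of 3] 0[of 2] 0[of 1] 0[of 0]
      by (simp add: m_def sum.distrib flip: sum_distrib_left)
    finally show ?thesis .
  qed
  with c(1) show thesis by (intro that) auto
qed

text \<open>The cubic with roots \<open>x, y, z\<close> leaves only the term \<open>S = T\<close>
  and the terms at distance \<open>a\<close>. With \<open>p = x y z\<close> and
  \<open>r = (x - a) (y - a) (z - a)\<close> this is \<open>p c + r A c = 0\<close>, so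
  \<open>K = p / r\<close>.\<close>

lemma four_distance_relation_exists:
  assumes N: "finite N" "card N = n" and X: "X \<subseteq> layer N w" and "3 \<le> w" and big: "n choose 3 < card X"
    and dist: "\<And>S T. S \<in> X \<Longrightarrow> T \<in> X \<Longrightarrow> S \<noteq> T \<Longrightarrow> int (card (T - S)) \<in> {a, x, y, z}"
    and "a \<noteq> 0"
  obtains c :: "'a set \<Rightarrow> int" where "\<exists>S\<in>X. c S \<noteq> 0"
    "\<forall>T\<in>X. c T * (x * y * z)
       + ((x - a) * (y - a) * (z - a)) * (\<Sum>S | S \<in> X \<and> int (card (T - S)) = a. c S) = 0"
proof -
  have fin: "finite X" using N X finite_layer finite_subset by metis
  obtain c where c: "\<exists>S\<in>X. c S \<noteq> 0"
    "\<forall>T\<in>layer N w. \<forall>x y z.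
       (\<Sum>S\<in>X. c S * ((x - int (card (T - S))) * (y - int (card (T - S))) * (z - int (card (T - S))))) = 0"
    using cubic_relation_exists[OF N X \<open>3 \<le> w\<close> big] .
  have "c T * (x * y * z) + ((x - a) * (y - a) * (z - a)) * (\<Sum>S | S \<in> X \<and> int (card (T - S)) = a. c S) = 0"
    if T: "T \<in> X" for T
  proof -
    have "0 = (\<Sum>S\<in>X. c S * ((x - int (card (T - S))) * (y - int (card (T - S))) * (z - int (card (T - S)))))"
      using c(2) T X by (simp add: subset_iff)
    also have "\<dots> = (\<Sum>S\<in>X. (if S = T then c S * (x * y * z) else 0)
        + (if int (card (T - S)) = a then ((x - a) * (y - a) * (z - a)) * c S else 0))"
    proof (intro sum.cong refl)
      fix S assume S: "S \<in> X"
      show "c S * ((x - int (card (T - S))) * (y - int (card (T - S))) * (z - int (card (T - S))))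
          = (if S = T then c S * (x * y * z) else 0)
        + (if int (card (T - S)) = a then ((x - a) * (y - a) * (z - a)) * c S else 0)"
        using dist[OF S T] \<open>a \<noteq> 0\<close> by (cases "S = T") auto
    qed
    also have "\<dots> = c T * (x * y * z) + (\<Sum>S | S \<in> X \<and> int (card (T - S)) = a. ((x - a) * (y - a) * (z - a)) * c S)"
      using fin T by (simp add: sum.distrib sum.inter_filter)
    finally show ?thesis by (simp add: sum_distrib_left)
  qed
  with c(1) show thesis by (intro that) auto
qed

text \<open>An integral relation among the rows of \<open>K I + A\<close>, where \<open>A\<close> is the graph of the distance
  \<open>a\<close>, forces the denominator of \<open>K\<close> to divide the gcd of the coefficients.\<close>

lemma distance_product_dvd:
  assumes N: "finite N" "card N = n" and X: "X \<subseteq> layer N w" and "3 \<le> w" and big: "n choose 3 < card X"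
    and dist: "\<And>S T. S \<in> X \<Longrightarrow> T \<in> X \<Longrightarrow> S \<noteq> T \<Longrightarrow> int (card (T - S)) \<in> {a, x, y, z}"
    and "a \<noteq> 0"
  shows "(x - a) * (y - a) * (z - a) dvd x * y * z"
proof -
  obtain c where c: "\<exists>S\<in>X. c S \<noteq> 0"
    "\<forall>T\<in>X. c T * (x * y * z)
       + ((x - a) * (y - a) * (z - a)) * (\<Sum>S | S \<in> X \<and> int (card (T - S)) = a. c S) = 0"
    using four_distance_relation_exists[OF assms] .
  define G where "G = Gcd (c ` X)"
  define p where "p = x * y * z"
  define r where "r = (x - a) * (y - a) * (z - a)"
  have "G \<noteq> 0" using c(1) by (auto simp: G_def)
  have "r * G dvd p * c T" if T: "T \<in> X" for T
  proof -
    have "p * c T = r * - (\<Sum>S | S \<in> X \<and> int (card (T - S)) = a. c S)"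
      using c(2)[rule_format, OF T] by (simp add: p_def r_def algebra_simps)
    moreover have "G dvd - (\<Sum>S | S \<in> X \<and> int (card (T - S)) = a. c S)"
      unfolding dvd_minus_iff G_def by (rule dvd_sum, rule Gcd_dvd) auto
    ultimately show ?thesis by (simp add: mult_dvd_mono)
  qed
  \<comment> \<open>The gcd of the numbers \<open>p * c T\<close> is that of \<open>c\<close> times
    \<open>p\<close>, up to sign; cancelling \<open>G\<close> leaves \<open>r dvd p\<close>.\<close>
  then have "r * G dvd Gcd ((*) p ` c ` X)" by (auto intro!: Gcd_greatest)
  then have "r * G dvd p * G" by (simp add: Gcd_mult G_def)
  then show ?thesis using \<open>G \<noteq> 0\<close> by (simp add: p_def r_def)
qed

text \<open>If all other distances exceed \<open>2 a\<close>, then the graph of the distance \<open>a\<close> is a disjoint union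
  of cliques, so it has no eigenvalue below \<open>-1\<close>.\<close>

lemma card_le_choose_3_if_clusters:
  assumes N: "finite N" "card N = n" and X: "X \<subseteq> layer N w" and "3 \<le> w"
    and dist: "\<And>S T. S \<in> X \<Longrightarrow> T \<in> X \<Longrightarrow> S \<noteq> T \<Longrightarrow> int (card (T - S)) \<in> {a, x, y, z}"
    and a: "0 < a" "2 * a < x" "2 * a < y" "2 * a < z"
  shows "card X \<le> n choose 3"
proof (rule ccontr)
  assume "\<not> card X \<le> n choose 3"
  then have big: "n choose 3 < card X" by simp
  have fin: "finite X" using N X finite_layer finite_subset by metis
  have "a \<noteq> 0" using a by simp
  obtain c where c: "\<exists>S\<in>X. c S \<noteq> 0"
    "\<forall>T\<in>X. c T * (x * y * z)
       + ((x - a) * (y - a) * (z - a)) * (\<Sum>S | S \<in> X \<and> int (card (T - S)) = a. c S) = 0"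
    using four_distance_relation_exists[OF N X \<open>3 \<le> w\<close> big dist \<open>a \<noteq> 0\<close>] .
  define p where "p = x * y * z"
  define r where "r = (x - a) * (y - a) * (z - a)"
  define E where "E = {(S, T). S \<in> X \<and> T \<in> X \<and> int (card (T - S)) \<le> a}"
  have E_iff: "(S, T) \<in> E \<longleftrightarrow> S \<in> X \<and> T \<in> X \<and> (S = T \<or> int (card (T - S)) = a)" for S T
    using dist[of S T] a by (cases "S = T") (auto simp: E_def)
  have diff_sym: "card (T - S) = card (S - T)" if "S \<in> X" "T \<in> X" for S T
    using that X by (intro card_diff_layer(3)[OF N(1)]) auto
  have "equiv X E"
  proof (rule equivI)
    show "refl_on X E" by (auto simp: refl_on_def E_iff)
    show "E \<subseteq> X \<times> X" by (auto simp: E_def)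
    show "sym E"
    proof (rule symI)
      fix S T assume "(S, T) \<in> E"
      then show "(T, S) \<in> E" using diff_sym[of S T] by (auto simp: E_def)
    qed
    show "trans E"
    proof (rule transI)
      fix S T U assume "(S, T) \<in> E" "(T, U) \<in> E"
      then have *: "S \<in> X" "T \<in> X" "U \<in> X" "int (card (T - S)) \<le> a" "int (card (U - T)) \<le> a"
        by (auto simp: E_def)
      have "finite T" "finite U" using * X N finite_in_layer by (auto simp: subset_iff)
      then have "int (card (U - S)) \<le> 2 * a" using card_diff_triangle[of U T S] * by linarith
      then show "(S, U) \<in> E" using dist[of S U] * a by (cases "S = U") (auto simp: E_iff)
    qed
  qed
  have nonneg: "(\<Sum>T\<in>X. c T * (\<Sum>S\<in>E``{T}. c S)) \<ge> 0"
  proof -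
    have "(\<Sum>T\<in>X. c T * (\<Sum>S\<in>E``{T}. c S)) = (\<Sum>Y\<in>X//E. \<Sum>T\<in>Y. c T * (\<Sum>S\<in>E``{T}. c S))"
    proof -
      have "\<Union>(X//E) = X" using \<open>equiv X E\<close> by (rule Union_quotient)
      moreover have "(\<Sum>T\<in>\<Union>(X//E). c T * (\<Sum>S\<in>E``{T}. c S)) = (\<Sum>Y\<in>X//E. \<Sum>T\<in>Y. c T * (\<Sum>S\<in>E``{T}. c S))"
      proof -
        have "\<forall>A\<in>X//E. finite A"
          using in_quotient_imp_subset[OF \<open>equiv X E\<close>] fin by (auto intro: finite_subset)
        moreover have "\<forall>A\<in>X//E. \<forall>B\<in>X//E. A \<noteq> B \<longrightarrow> A \<inter> B = {}"
          using quotient_disj[OF \<open>equiv X E\<close>] by blast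
        ultimately show ?thesis by (subst sum.Union_disjoint) (simp_all add: o_def)
      qed
      ultimately show ?thesis by simp
    qed
    also have "\<dots> = (\<Sum>Y\<in>X//E. (\<Sum>T\<in>Y. c T)\<^sup>2)"
    proof (intro sum.cong refl)
      fix Y assume "Y \<in> X//E"
      then have "E``{T} = Y" if "T \<in> Y" for T
        using that \<open>equiv X E\<close> by (metis equiv_class_eq_iff quotientE Image_singleton_iff)
      then show "(\<Sum>T\<in>Y. c T * (\<Sum>S\<in>E``{T}. c S)) = (\<Sum>T\<in>Y. c T)\<^sup>2"
        by (simp add: power2_eq_square sum_distrib_right)
    qed
    finally show ?thesis by (simp add: sum_nonneg)
  qed
  have class_sum: "(\<Sum>S\<in>E``{T}. c S) = c T + (\<Sum>S | S \<in> X \<and> int (card (T - S)) = a. c S)" if T: "T \<in> X" for T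
  proof -
    have "E``{T} = insert T {S. S \<in> X \<and> int (card (T - S)) = a}"
      using T diff_sym[of T] by (auto simp: E_iff)
    then show ?thesis using fin a by simp
  qed
  \<comment> \<open>The relation at \<open>T\<close> is multiplied by \<open>c T\<close>. Completing
    the neighbours of \<open>T\<close> to its whole clique costs \<open>r * c T ^ 2\<close>. After
    summation the clique part is nonnegative, being a sum of squares, while \<open>r < p\<close>,
    that is \<open>K > 1\<close>, makes the other part positive.\<close>
  have "(p - r) * c T ^ 2 + r * (c T * (\<Sum>S\<in>E``{T}. c S)) = 0" if T: "T \<in> X" for T
  proof -
    have "c T * (c T * p + r * (\<Sum>S | S \<in> X \<and> int (card (T - S)) = a. c S)) = 0"
      using c(2)[rule_format, OF T] by (simp add: p_def r_def)
    then show ?thesis by (simp add: class_sum[OF T] algebra_simps power2_eq_square)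
  qed
  then have "(p - r) * (\<Sum>T\<in>X. c T ^ 2) + r * (\<Sum>T\<in>X. c T * (\<Sum>S\<in>E``{T}. c S)) = 0"
    by (simp add: sum_distrib_left flip: sum.distrib)
  moreover have "0 < r" using a by (simp add: r_def)
  moreover have "r < p"
  proof -
    have "(x - a) * (y - a) * (z - a) < x * (y - a) * (z - a)" using a by (intro mult_strict_right_mono) auto
    also have "\<dots> \<le> x * y * z" using a by (intro mult_mono) auto
    finally show ?thesis by (simp add: p_def r_def)
  qed
  moreover have "0 < (\<Sum>T\<in>X. c T ^ 2)"
  proof -
    obtain S where "S \<in> X" "c S \<noteq> 0" using c(1) by blast
    then show ?thesis using fin by (intro sum_pos2[of X S]) auto
  qed
  ultimately have "0 < (p - r) * (\<Sum>T\<in>X. c T ^ 2)" "0 \<le> r * (\<Sum>T\<in>X. c T * (\<Sum>S\<in>E``{T}. c S))"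
    "(p - r) * (\<Sum>T\<in>X. c T ^ 2) + r * (\<Sum>T\<in>X. c T * (\<Sum>S\<in>E``{T}. c S)) = 0"
    using nonneg by simp_all
  then show False by linarith
qed

section \<open>Delsarte's linear programming bound\<close>

lemma alternating_binomial_sum_Suc:
  fixes f :: "nat \<Rightarrow> real"
  shows "(\<Sum>l\<le>Suc m. (-1) ^ l * real (Suc m choose l) * f l)
       = (\<Sum>l\<le>m. (-1) ^ l * real (m choose l) * (f l - f (Suc l)))"
proof -
  have "(\<Sum>l\<le>Suc m. (-1) ^ l * real (Suc m choose l) * f l)
      = f 0 + (\<Sum>l\<le>m. (-1) ^ Suc l * real (Suc m choose Suc l) * f (Suc l))"
    by (subst sum.atMost_Suc_shift) simp
  also have "\<dots> = f 0 + (\<Sum>l\<le>m. (-1) ^ Suc l * real (m choose Suc l) * f (Suc l))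
      - (\<Sum>l\<le>m. (-1) ^ l * real (m choose l) * f (Suc l))"
    by (simp add: sum_subtractf algebra_simps sum_negf sum.distrib)
  also have "f 0 + (\<Sum>l\<le>m. (-1) ^ Suc l * real (m choose Suc l) * f (Suc l))
      = (\<Sum>l\<le>Suc m. (-1) ^ l * real (m choose l) * f l)"
    by (subst sum.atMost_Suc_shift) simp
  also have "\<dots> = (\<Sum>l\<le>m. (-1) ^ l * real (m choose l) * f l)"
    by (simp add: binomial_eq_0)
  finally show ?thesis by (simp only: sum_subtractf right_diff_distrib)
qed

text \<open>An \<open>m\<close>-th difference of a polynomial of degree \<open>r < m\<close>; each
  difference lowers \<open>r\<close> by Pascal's rule. \<open>m \<le> M\<close> keeps
  \<open>M - l\<close> from being truncated.\<close>

lemma alternating_binomial_sum_choose: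
  assumes "r < m" "m \<le> M"
  shows "(\<Sum>l\<le>m. (-1) ^ l * real (m choose l) * real ((M - l) choose r)) = 0"
  using assms
proof (induction m arbitrary: r M)
  case (Suc m)
  have "(\<Sum>l\<le>Suc m. (-1) ^ l * real (Suc m choose l) * real ((M - l) choose r))
      = (\<Sum>l\<le>m. (-1) ^ l * real (m choose l) * (real ((M - l) choose r) - real ((M - Suc l) choose r)))"
    by (rule alternating_binomial_sum_Suc)
  also have "\<dots> = 0"
  proof (cases r)
    case (Suc r')
    have "real ((M - l) choose r) - real ((M - Suc l) choose r) = real ((M - 1 - l) choose r')" if "l \<le> m" for l
    proof -
      have "M - l = Suc (M - 1 - l)" using that Suc.prems by simp
      then show ?thesis by (simp add: Suc)
    qed
    then have "(\<Sum>l\<le>m. (-1) ^ l * real (m choose l) * (real ((M - l) choose r) - real ((M - Suc l) choose r)))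
        = (\<Sum>l\<le>m. (-1) ^ l * real (m choose l) * real ((M - 1 - l) choose r'))"
      by (intro sum.cong) auto
    also have "\<dots> = 0" using Suc.prems Suc by (intro Suc.IH) auto
    finally show ?thesis .
  qed simp
  finally show ?case .
qed simp

lemma coeff_pcompose_shift:
  fixes p :: "real poly"
  assumes "degree p \<le> n"
  shows "coeff (p \<circ>\<^sub>p [:1, 1:]) n = coeff p n"
proof (cases "degree p = n")
  case True
  then have "coeff (p \<circ>\<^sub>p [:1, 1:]) n = lead_coeff (p \<circ>\<^sub>p [:1, 1:])" by (simp add: degree_pcompose)
  then show ?thesis using True by (subst (asm) lead_coeff_comp) auto
next
  case False
  then show ?thesis using assms by (simp add: coeff_eq_0 degree_pcompose)
qed

text \<open>Splitting off the constant term, \<open>p = a + x q\<close>, gives the difference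
  \<open>x (q(x) - q(x + 1)) - q(x + 1)\<close>, so the induction needs the claim for
  \<open>q\<close> only.\<close>

lemma difference_poly:
  fixes p :: "real poly"
  assumes "degree p \<le> Suc n"
  shows "degree (p - p \<circ>\<^sub>p [:1, 1:]) \<le> n \<and> coeff (p - p \<circ>\<^sub>p [:1, 1:]) n = - real (Suc n) * coeff p (Suc n)"
  using assms
proof (induction n arbitrary: p)
  case (0 p)
  obtain a q where q: "p = pCons a q" by (cases p)
  have "degree q = 0" using 0 by (auto simp: q split: if_splits)
  then obtain b where "q = [:b:]" by (auto dest: degree_eq_zeroE)
  then show ?case by (simp add: q pcompose_pCons)
next
  case (Suc n p)
  obtain a q where q: "p = pCons a q" by (cases p)
  have dq: "degree q \<le> Suc n" using Suc.prems by (auto simp: q split: if_splits)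
  have *: "p - p \<circ>\<^sub>p [:1, 1:] = pCons 0 (q - q \<circ>\<^sub>p [:1, 1:]) - q \<circ>\<^sub>p [:1, 1:]"
    by (simp add: q pcompose_pCons algebra_simps)
  have "degree (pCons 0 (q - q \<circ>\<^sub>p [:1, 1:])) \<le> Suc n"
    using Suc.IH[OF dq] by (simp add: degree_pCons_eq_if)
  then have "degree (p - p \<circ>\<^sub>p [:1, 1:]) \<le> Suc n"
    unfolding * using dq by (intro degree_diff_le) (auto simp: degree_pcompose)
  moreover have "coeff (p - p \<circ>\<^sub>p [:1, 1:]) (Suc n) = - real (Suc (Suc n)) * coeff p (Suc (Suc n))"
    unfolding * using Suc.IH[OF dq] coeff_pcompose_shift[OF dq] by (simp add: q algebra_simps)
  ultimately show ?case by blast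
qed

lemma alternating_binomial_sum_poly:
  fixes p :: "real poly"
  assumes "degree p \<le> m"
  shows "(\<Sum>l\<le>m. (-1) ^ l * real (m choose l) * poly p (real l)) = (-1) ^ m * fact m * coeff p m"
  using assms
proof (induction m arbitrary: p)
  case 0
  then obtain a where "p = [:a:]" by (auto dest: degree_eq_zeroE)
  then show ?case by simp
next
  case (Suc m)
  have "(\<Sum>l\<le>Suc m. (-1) ^ l * real (Suc m choose l) * poly p (real l))
      = (\<Sum>l\<le>m. (-1) ^ l * real (m choose l) * poly (p - p \<circ>\<^sub>p [:1, 1:]) (real l))"
    by (subst alternating_binomial_sum_Suc) (simp add: poly_pcompose add.commute)
  also have "\<dots> = (-1) ^ m * fact m * (- real (Suc m) * coeff p (Suc m))"
    using difference_poly[OF Suc.prems] by (subst Suc.IH) auto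
  finally show ?case by (simp add: algebra_simps)
qed

section \<open>Zonal polynomials and the linear programming bound\<close>

lemma sum_indicator_family:
  assumes "finite N" "X \<subseteq> layer N w"
  shows "(\<Sum>S\<in>layer N w. \<Sum>T\<in>layer N w. of_bool (S \<in> X) * of_bool (T \<in> X) * (F S T :: real))
       = (\<Sum>S\<in>X. \<Sum>T\<in>X. F S T)"
proof -
  have "(\<Sum>S\<in>X. \<Sum>T\<in>X. F S T)
      = (\<Sum>S\<in>X. \<Sum>T\<in>layer N w. of_bool (S \<in> X) * of_bool (T \<in> X) * F S T)"
    using assms by (intro sum.cong refl sum.mono_neutral_cong_left) auto
  also have "\<dots> = (\<Sum>S\<in>layer N w. \<Sum>T\<in>layer N w. of_bool (S \<in> X) * of_bool (T \<in> X) * F S T)"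
    using assms by (intro sum.mono_neutral_cong_left) auto
  finally show ?thesis by simp
qed

text \<open>At the indicator of \<open>X\<close>, the quadratic form of the kernel is a combination
  of squared norms whose coefficients are the eigenvalues.\<close>

lemma delsarte_inequality:
  assumes N: "finite N" "card N = n" and X: "X \<subseteq> layer N w"
    and nonneg: "\<And>i. i \<le> w \<Longrightarrow> eigenvalue n w \<beta> i \<ge> 0"
  shows "(\<Sum>S\<in>X. \<Sum>T\<in>X. \<Sum>j\<le>w. \<beta> j * real (card (S - T) choose j)) \<ge> 0"
proof -
  obtain p where p: "\<And>i. i \<le> w \<Longrightarrow> harmonic N i (p i)"
    "\<And>i. i \<le> w \<Longrightarrow> (\<Sum>S\<in>layer N w. of_bool (S \<in> X) * extend i (p i) S) \<ge> 0"
    "(\<Sum>S\<in>layer N w. of_bool (S \<in> X) ^ 2)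
        = (\<Sum>i\<le>w. \<Sum>S\<in>layer N w. of_bool (S \<in> X) * extend i (p i) S)"
    "\<And>\<beta>. (\<Sum>S\<in>layer N w. \<Sum>T\<in>layer N w. of_bool (S \<in> X) * of_bool (T \<in> X)
          * (\<Sum>j\<le>w. \<beta> j * real (card (S - T) choose j)))
        = (\<Sum>i\<le>w. eigenvalue n w \<beta> i * (\<Sum>S\<in>layer N w. of_bool (S \<in> X) * extend i (p i) S))"
    using spectral_decomposition[OF N, of w "\<lambda>S. of_bool (S \<in> X)"] by blast
  have "0 \<le> (\<Sum>i\<le>w. eigenvalue n w \<beta> i * (\<Sum>S\<in>layer N w. of_bool (S \<in> X) * extend i (p i) S))"
    using nonneg p(2) by (intro sum_nonneg ballI) (metis atMost_iff mult_nonneg_nonneg)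
  then show ?thesis using p(4)[of \<beta>] by (simp add: sum_indicator_family[OF N(1) X])
qed

text \<open>The zonal polynomial (dual Hahn polynomial) of the \<open>k\<close>-th eigenspace, as a function of the
  distance and normalized to \<open>1\<close> at \<open>0\<close>.\<close>

definition hahn_coeff :: "nat \<Rightarrow> nat \<Rightarrow> nat \<Rightarrow> nat \<Rightarrow> real" where
  "hahn_coeff n w k j = (-1) ^ j * real (k choose j) * real ((n + 1 - k) choose j)
     / (real (w choose j) * real ((n - w) choose j))"

definition hahn :: "nat \<Rightarrow> nat \<Rightarrow> nat \<Rightarrow> nat \<Rightarrow> real" where
  "hahn n w k d = (\<Sum>j\<le>w. hahn_coeff n w k j * real (d choose j))"

text \<open>The zonal kernel acts as zero off the \<open>k\<close>-th eigenspace. For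
  \<open>i > k\<close> this holds by degree; for \<open>i < k\<close> the eigenvalue is a difference
  of order \<open>k - i\<close> of a polynomial of degree \<open>k - i - 1\<close>; for
  \<open>i = k\<close> one term survives and its two signs cancel.\<close>

lemma eigenvalue_hahn_coeff_nonneg:
  assumes "k \<le> w" "2 * w \<le> n" "i \<le> w"
  shows "eigenvalue n w (hahn_coeff n w k) i \<ge> 0"
proof -
  have zero: "hahn_coeff n w k j = 0" if "k < j" for j using that by (simp add: hahn_coeff_def)
  consider "k < i" | "i = k" | "i < k" by linarith
  then show ?thesis
  proof cases
    case 1
    then show ?thesis by (simp add: eigenvalue_def zero)
  next
    case 2
    have "eigenvalue n w (hahn_coeff n w k) i = (-1) ^ k * (\<Sum>j\<in>{k}. hahn_coeff n w k j
        * real ((w - k) choose (j - k)) * real ((n - j - k) choose (w - k)))"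
      unfolding eigenvalue_def 2 using assms zero
      by (intro arg_cong2[where f = "(*)"] refl sum.mono_neutral_right) auto
    also have "\<dots> \<ge> 0" by (simp add: hahn_coeff_def flip: power_add mult.assoc)
    finally show ?thesis .
  next
    case 3
    \<comment> \<open>The factors of the summand that do not depend on \<open>j\<close>; the rest is
      a signed binomial times a polynomial in \<open>j\<close>, itself written as a binomial
      coefficient.\<close>
    define K :: real where "K = fact k * fact (n + 1 - k) * fact (k - i - 1) / (fact (k - i) * fact w * fact (n - w))"
    have summand: "hahn_coeff n w k j * real ((w - i) choose (j - i)) * real ((n - j - i) choose (w - i))
        = (-1) ^ j * K * real ((k - i) choose (j - i)) * real ((n - 2 * i - (j - i)) choose (k - i - 1))"
      if j: "i \<le> j" "j \<le> k" for j
    proof -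
      have b1: "real (k choose j) = fact k / (fact j * fact (k - j))"
        using j by (simp add: binomial_fact)
      have b2: "real ((n + 1 - k) choose j) = fact (n + 1 - k) / (fact j * fact (n + 1 - k - j))"
        using j assms by (simp add: binomial_fact)
      have b3: "real (w choose j) = fact w / (fact j * fact (w - j))"
        using j assms by (simp add: binomial_fact)
      have b4: "real ((n - w) choose j) = fact (n - w) / (fact j * fact (n - w - j))"
        using j assms by (simp add: binomial_fact)
      have b5: "real ((w - i) choose (j - i)) = fact (w - i) / (fact (j - i) * fact (w - j))"
        using j assms by (simp add: binomial_fact)
      have b6: "real ((n - j - i) choose (w - i)) = fact (n - j - i) / (fact (w - i) * fact (n - w - j))"
      proof -
        have "n - j - i - (w - i) = n - w - j" using j assms by simp
        then show ?thesis using j assms by (simp add: binomial_fact)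
      qed
      have b7: "real ((k - i) choose (j - i)) = fact (k - i) / (fact (j - i) * fact (k - j))"
        using j assms by (simp add: binomial_fact)
      have b8: "real ((n - 2 * i - (j - i)) choose (k - i - 1)) = fact (n - j - i) / (fact (k - i - 1) * fact (n + 1 - k - j))"
      proof -
        have "n - 2 * i - (j - i) = n - j - i" "n - j - i - (k - i - 1) = n + 1 - k - j"
          using j assms 3 by auto
        then show ?thesis using j assms 3 by (simp add: binomial_fact)
      qed
      show ?thesis unfolding hahn_coeff_def b1 b2 b3 b4 b5 b6 b7 b8 K_def by (simp add: field_simps)
    qed
    have "(\<Sum>j=i..w. hahn_coeff n w k j * real ((w - i) choose (j - i)) * real ((n - j - i) choose (w - i)))
        = (\<Sum>j=i..k. hahn_coeff n w k j * real ((w - i) choose (j - i)) * real ((n - j - i) choose (w - i)))"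
      using assms zero by (intro sum.mono_neutral_right) auto
    also have "\<dots> = (\<Sum>j=i..k. (-1) ^ j * K * real ((k - i) choose (j - i)) * real ((n - 2 * i - (j - i)) choose (k - i - 1)))"
      by (intro sum.cong refl summand) auto
    also have "\<dots> = (\<Sum>l\<le>k - i. (-1) ^ i * K * ((-1) ^ l * real ((k - i) choose l) * real ((n - 2 * i - l) choose (k - i - 1))))"
      using 3 by (intro sum.reindex_bij_witness[where i = "\<lambda>l. l + i" and j = "\<lambda>j. j - i"])
        (auto simp: power_add[symmetric] mult_ac)
    also have "\<dots> = 0"
      using alternating_binomial_sum_choose[of "k - i - 1" "k - i" "n - 2 * i"] 3 assms
      by (simp flip: sum_distrib_left)
    finally show ?thesis by (simp add: eigenvalue_def)
  qed
qed

text \<open>Sum the kernel over all pairs from \<open>X\<close>: the total is nonnegative, a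
  diagonal pair contributes the sum of the \<open>g k\<close> because zonal polynomials are 1 at
  distance 0, and any other pair at most \<open>- 1\<close>. The constant term of the dual
  polynomial is normalized to 1, hence the indices start at 1.\<close>

lemma linear_programming_bound:
  assumes N: "finite N" "card N = n" and X: "X \<subseteq> layer N w" and "2 * w \<le> n" and "J \<le> w"
    and g: "\<And>k. k \<in> {1..J} \<Longrightarrow> g k \<ge> 0"
    and D: "\<And>S T. S \<in> X \<Longrightarrow> T \<in> X \<Longrightarrow> S \<noteq> T \<Longrightarrow> (\<Sum>k=1..J. g k * hahn n w k (card (S - T))) \<le> - 1"
  shows "real (card X) \<le> 1 + (\<Sum>k=1..J. g k)"
proof (cases "X = {}")
  case False
  have fin: "finite X" using N X finite_layer finite_subset by metis
  have hahn_0: "hahn n w k 0 = 1" for k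
    by (simp add: hahn_def hahn_coeff_def sum.atMost_shift)
  have "0 \<le> (\<Sum>S\<in>X. \<Sum>T\<in>X. hahn n w k (card (S - T)))" if "k \<in> {1..J}" for k
    unfolding hahn_def using that assms
    by (intro delsarte_inequality[OF N X] eigenvalue_hahn_coeff_nonneg) auto
  then have "0 \<le> g k * (\<Sum>S\<in>X. \<Sum>T\<in>X. hahn n w k (card (S - T)))" if "k \<in> {1..J}" for k
    using g that by (intro mult_nonneg_nonneg) auto
  then have "0 \<le> (\<Sum>k=1..J. g k * (\<Sum>S\<in>X. \<Sum>T\<in>X. hahn n w k (card (S - T))))"
    by (rule sum_nonneg)
  also have "\<dots> = (\<Sum>S\<in>X. \<Sum>T\<in>X. \<Sum>k=1..J. g k * hahn n w k (card (S - T)))"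
    unfolding sum_distrib_left by (subst sum.swap, intro sum.cong refl, subst sum.swap, rule refl)
  also have "\<dots> \<le> (\<Sum>S\<in>X. \<Sum>T\<in>X. if T = S then (\<Sum>k=1..J. g k) else - 1)"
    using D by (intro sum_mono) (auto simp: hahn_0)
  also have "\<dots> = (\<Sum>S\<in>X. (\<Sum>k=1..J. g k) - (real (card X) - 1))"
  proof (intro sum.cong refl)
    fix S assume S: "S \<in> X"
    have "(\<Sum>T\<in>X. if T = S then (\<Sum>k=1..J. g k) else - 1) = (\<Sum>T\<in>X. (if T = S then (\<Sum>k=1..J. g k) + 1 else 0) - 1)"
      by (intro sum.cong) auto
    then show "(\<Sum>T\<in>X. if T = S then (\<Sum>k=1..J. g k) else - 1) = (\<Sum>k=1..J. g k) - (real (card X) - 1)"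
      using S fin by (simp add: sum_subtractf)
  qed
  finally have "0 \<le> real (card X) * ((\<Sum>k=1..J. g k) - (real (card X) - 1))" by simp
  moreover have "0 < card X" using False fin by auto
  ultimately show ?thesis by (simp add: zero_le_mult_iff)
qed (use g in \<open>auto intro!: add_nonneg_nonneg sum_nonneg\<close>)

text \<open>Only the sets \<open>Y \<union> B\<close> with \<open>B \<subseteq> R\<close>, for a fixed \<open>j\<close>-set \<open>Y\<close> disjoint from \<open>R\<close>, are needed
  to recover \<open>u R\<close> by inclusion-exclusion.\<close>

lemma extend_inj:
  assumes N: "finite N" "j + k \<le> card N" and "k \<le> j"
    and zero: "\<And>Q. Q \<in> layer N j \<Longrightarrow> extend k u Q = 0" and R: "R \<in> layer N k"
  shows "u R = 0"
proof -
  have fR: "finite R" "R \<subseteq> N" "card R = k" using R N finite_in_layer by (auto simp: layer_def)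
  have "card (N - R) \<ge> j" using N fR by (simp add: card_Diff_subset)
  then obtain Y where Y: "Y \<subseteq> N - R" "card Y = j" "finite Y" using N
    by (metis finite_Diff obtain_subset_with_card_n)
  have big: "extend k u Z = 0" if Z: "Z \<subseteq> N" "j \<le> card Z" for Z
  proof -
    have fZ: "finite Z" using Z N finite_subset by auto
    have "(\<Sum>Q\<in>layer Z j. extend k u Q) = (\<Sum>Q\<in>layer Z j. 0)"
      using Z zero by (intro sum.cong refl) (auto simp: layer_def)
    then have "real ((card Z - k) choose (j - k)) * extend k u Z = 0"
      using extend_extend[OF fZ \<open>k \<le> j\<close>, of u] by simp
    moreover have "(card Z - k) choose (j - k) > 0" using Z \<open>k \<le> j\<close> by (intro zero_less_binomial) auto
    ultimately show ?thesis by simp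
  qed
  let ?Z = "Y \<union> R"
  have fZ: "finite ?Z" using fR Y by auto
  have "0 = (\<Sum>A\<in>Pow R. (-1) ^ card A * extend k u (?Z - A))"
  proof (intro sum.neutral[symmetric] ballI)
    fix A assume "A \<in> Pow R"
    then have "Y \<subseteq> ?Z - A" "?Z - A \<subseteq> N" using Y fR by auto
    then have "extend k u (?Z - A) = 0" using card_mono[of "?Z - A" Y] fZ Y by (intro big) auto
    then show "(-1) ^ card A * extend k u (?Z - A) = 0" by simp
  qed
  also have "\<dots> = (\<Sum>A\<in>Pow R. \<Sum>Q | Q \<in> layer ?Z k \<and> Q \<inter> A = {}. (-1) ^ card A * u Q)"
    unfolding extend_def sum_distrib_left by (intro sum.cong) (auto simp: layer_def)
  also have "\<dots> = (\<Sum>Q\<in>layer ?Z k. \<Sum>A | A \<in> Pow R \<and> Q \<inter> A = {}. (-1) ^ card A * u Q)"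
    using fR fZ by (intro sum.swap_restrict) auto
  also have "\<dots> = (\<Sum>Q\<in>layer ?Z k. \<Sum>A\<in>Pow (R - Q). (-1) ^ card A * u Q)"
    by (intro sum.cong) auto
  also have "\<dots> = (\<Sum>Q\<in>layer ?Z k. if R \<subseteq> Q then u Q else 0)"
    using fR by (intro sum.cong refl) (subst sum_alternating_Pow_mult, auto)
  also have "\<dots> = (\<Sum>Q\<in>layer ?Z k. if Q = R then u Q else 0)"
  proof (intro sum.cong refl)
    fix Q assume "Q \<in> layer ?Z k"
    then have "finite Q" "card Q = k" using finite_in_layer[OF fZ, of Q k] by (simp_all add: layer_def)
    then show "(if R \<subseteq> Q then u Q else 0) = (if Q = R then u Q else 0)"
      using fR card_subset_eq[of Q R] by auto
  qed
  also have "\<dots> = u R" using fZ fR by (simp add: layer_def)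
  finally show ?thesis by simp
qed

section \<open>The harmonic bound\<close>

text \<open>The annihilator polynomial in the binomial basis. The \<open>i\<close>-th eigenvalue
  involves only the coefficients with \<open>j \<ge> i\<close>, so the third one is determined by
  \<open>\<beta> 3\<close> and \<open>\<beta> 4\<close>, which are therefore given
  explicitly.\<close>

lemma quartic_newton_coeffs:
  fixes a b c d :: int
  obtains \<beta> :: "nat \<Rightarrow> real" where "\<beta> 4 = 24" "\<beta> 3 = 36 - 6 * real_of_int (a + b + c + d)"
    "\<And>j. 4 < j \<Longrightarrow> \<beta> j = 0"
    "\<And>m w. 4 \<le> w \<Longrightarrow> real_of_int ((a - int m) * (b - int m) * (c - int m) * (d - int m))
        = (\<Sum>j\<le>w. \<beta> j * real (m choose j))"
proof
  define e1 e2 e3 e4 where "e1 = a + b + c + d"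
    and "e2 = a * b + a * c + a * d + b * c + b * d + c * d"
    and "e3 = a * b * c + a * b * d + a * c * d + b * c * d" and "e4 = a * b * c * d"
  define \<beta> :: "nat \<Rightarrow> real" where "\<beta> = (\<lambda>_. 0)(0 := of_int e4, 1 := of_int (1 - e1 + e2 - e3),
      2 := of_int (14 - 6 * e1 + 2 * e2), 3 := of_int (36 - 6 * e1), 4 := 24)"
  show "\<beta> 4 = 24" "\<beta> 3 = 36 - 6 * real_of_int (a + b + c + d)" "\<And>j. 4 < j \<Longrightarrow> \<beta> j = 0"
    by (auto simp: \<beta>_def e1_def)
  fix m w :: nat assume w: "4 \<le> w"
  have four: "int m ^ 4 = 24 * int (m choose 4) + 36 * int (m choose 3) + 14 * int (m choose 2) + int m"
  proof (induction m)
    case (Suc m)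
    have "int (Suc m) ^ 4 = int m ^ 4 + 4 * int m ^ 3 + 6 * int m ^ 2 + 4 * int m + 1"
      by (simp add: power4_eq_xxxx power3_eq_cube power2_eq_square algebra_simps)
    then show ?case using Suc square_eq_choose[of m] cube_eq_choose[of m] by (simp add: numeral_eq_Suc)
  qed (simp add: numeral_eq_Suc)
  have "(\<Sum>j\<le>w. \<beta> j * real (m choose j)) = (\<Sum>j\<in>{0, 1, 2, 3, 4}. \<beta> j * real (m choose j))"
    using w by (intro sum.mono_neutral_right) (auto simp: \<beta>_def)
  also have "\<dots> = of_int (e4 + (1 - e1 + e2 - e3) * int m + (14 - 6 * e1 + 2 * e2) * int (m choose 2)
      + (36 - 6 * e1) * int (m choose 3) + 24 * int (m choose 4))"
    by (simp add: \<beta>_def)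
  also have "e4 + (1 - e1 + e2 - e3) * int m + (14 - 6 * e1 + 2 * e2) * int (m choose 2)
      + (36 - 6 * e1) * int (m choose 3) + 24 * int (m choose 4)
      = int m ^ 4 - e1 * int m ^ 3 + e2 * int m ^ 2 - e3 * int m + e4"
    unfolding four cube_eq_choose square_eq_choose by (simp add: algebra_simps)
  also have "\<dots> = (a - int m) * (b - int m) * (c - int m) * (d - int m)"
    by (simp add: e1_def e2_def e3_def e4_def power4_eq_xxxx power3_eq_cube power2_eq_square algebra_simps)
  finally show "real_of_int ((a - int m) * (b - int m) * (c - int m) * (d - int m))
      = (\<Sum>j\<le>w. \<beta> j * real (m choose j))" by simp
qed

text \<open>The hypothesis on the sum of the distances says that the annihilator polynomial has a
  nonpositive component on the third eigenspace. That eigenspace is then free: only the conditions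
  killing the eigenspaces \<open>0, 1, 2, 4\<close> count. Orthogonality to the fourth one is encoded by
  \<open>W\<^sub>4 c\<close> being in the image of the inclusion map from \<open>3\<close>-sets to \<open>4\<close>-sets.\<close>

lemma harmonic_bound:
  assumes N: "finite N" "card N = n" and X: "X \<subseteq> layer N w" and w: "4 \<le> w" "2 * w \<le> n"
    and dist: "\<And>S T. S \<in> X \<Longrightarrow> T \<in> X \<Longrightarrow> S \<noteq> T \<Longrightarrow> int (card (S - T)) \<in> {x, y, z, t}"
    and pos: "0 < x" "0 < y" "0 < z" "0 < t"
    and sum_le: "(x + y + z + t - 6) * (int n - 6) \<le> 4 * (int w - 3) * (int n - int w - 3)"
  shows "card X + (n choose 3) \<le> (n choose 4) + (n choose 2)"
proof (rule ccontr)
  assume "\<not> card X + (n choose 3) \<le> (n choose 4) + (n choose 2)"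
  then have big: "(n choose 4) + (n choose 2) < card X + (n choose 3)" by simp
  have fin: "finite X" using N X finite_layer finite_subset by metis
  \<comment> \<open>The unknowns are \<open>c\<close> on \<open>X\<close> and \<open>u\<close> on
    3-sets. The equation of a 4-set \<open>Q\<close> equates the sum of \<open>c\<close> over the
    supersets of \<open>Q\<close> with the sum of \<open>u\<close> over its 3-subsets; that of a
    2-set says that \<open>c\<close> sums to 0 over its supersets.\<close>
  define v :: "'a set + 'a set \<Rightarrow> 'a set + 'a set \<Rightarrow> real" where
    "v x i = (case x of
        Inl S \<Rightarrow> (case i of Inl Q \<Rightarrow> of_bool (Q \<subseteq> S) | Inr P \<Rightarrow> of_bool (P \<subseteq> S))
      | Inr R \<Rightarrow> (case i of Inl Q \<Rightarrow> - of_bool (R \<subseteq> Q) | Inr P \<Rightarrow> 0))" for x i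
  have "card (layer N 4 <+> layer N 2) < card (X <+> layer N 3)"
    using big N fin by (simp add: card_Plus card_layer)
  moreover have "finite (layer N 4 <+> layer N 2)" "finite (X <+> layer N 3)" using N fin by auto
  ultimately obtain f where f: "\<exists>i\<in>X <+> layer N 3. f i \<noteq> 0"
    "\<And>i. i \<in> layer N 4 <+> layer N 2 \<Longrightarrow> (\<Sum>x\<in>X <+> layer N 3. f x * v x i) = 0"
    using nontrivial_solution_exists[of "layer N 4 <+> layer N 2" "X <+> layer N 3" v] by blast
  define u where "u R = f (Inr R)" for R
  define c where "c S = (if S \<in> X then f (Inl S) else 0)" for S
  have csum: "(\<Sum>S | S \<in> layer N w \<and> R \<subseteq> S. c S) = (\<Sum>S\<in>X. f (Inl S) * of_bool (R \<subseteq> S))" for R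
  proof -
    have "(\<Sum>S | S \<in> layer N w \<and> R \<subseteq> S. c S) = (\<Sum>S | S \<in> X \<and> R \<subseteq> S. c S)"
      using X N by (intro sum.mono_neutral_right) (auto simp: c_def)
    also have "\<dots> = (\<Sum>S\<in>X. if R \<subseteq> S then c S else 0)" using fin by (subst sum.inter_filter) auto
    also have "\<dots> = (\<Sum>S\<in>X. f (Inl S) * of_bool (R \<subseteq> S))" by (intro sum.cong) (auto simp: c_def)
    finally show ?thesis .
  qed
  have c4: "(\<Sum>S | S \<in> layer N w \<and> Q \<subseteq> S. c S) = extend 3 u Q" if Q: "Q \<in> layer N 4" for Q
  proof -
    have "extend 3 u Q = (\<Sum>R | R \<in> layer N 3 \<and> R \<subseteq> Q. u R)"
      unfolding extend_def using Q by (intro sum.cong) (auto simp: layer_def)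
    also have "\<dots> = (\<Sum>R\<in>layer N 3. if R \<subseteq> Q then u R else 0)" using N by (subst sum.inter_filter) auto
    also have "\<dots> = (\<Sum>R\<in>layer N 3. f (Inr R) * of_bool (R \<subseteq> Q))" by (intro sum.cong) (auto simp: u_def)
    finally have "extend 3 u Q = (\<Sum>R\<in>layer N 3. f (Inr R) * of_bool (R \<subseteq> Q))" .
    then show ?thesis using f(2)[of "Inl Q"] Q fin N
      by (simp add: sum.Plus v_def o_def csum sum_negf InlI)
  qed
  have c2: "(\<Sum>S | S \<in> layer N w \<and> P \<subseteq> S. c S) = 0" if P: "P \<in> layer N 2" for P
    using f(2)[of "Inr P"] P fin N by (simp add: sum.Plus v_def o_def csum InrI)
  obtain p where p: "\<And>i. i \<le> w \<Longrightarrow> harmonic N i (p i)"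
    "\<And>i. i \<le> w \<Longrightarrow> (\<Sum>S\<in>layer N w. c S * extend i (p i) S) \<ge> 0"
    "(\<Sum>S\<in>layer N w. c S ^ 2) = (\<Sum>i\<le>w. \<Sum>S\<in>layer N w. c S * extend i (p i) S)"
    "\<And>\<beta>. (\<Sum>S\<in>layer N w. \<Sum>T\<in>layer N w. c S * c T * (\<Sum>j\<le>w. \<beta> j * real (card (S - T) choose j)))
        = (\<Sum>i\<le>w. eigenvalue n w \<beta> i * (\<Sum>S\<in>layer N w. c S * extend i (p i) S))"
    using spectral_decomposition[OF N, of w c] by blast
  define m where "m i = (\<Sum>S\<in>layer N w. c S * extend i (p i) S)" for i
  have m_eq: "m i = (\<Sum>R\<in>layer N i. p i R * (\<Sum>S | S \<in> layer N w \<and> R \<subseteq> S. c S))" for i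
    unfolding m_def by (rule sum_mult_extend[OF N(1)])
  have m_low: "m i = 0" if "i \<le> 2" for i
    unfolding m_eq
  proof (intro sum.neutral ballI)
    fix R assume "R \<in> layer N i"
    then have R: "R \<subseteq> N" "card R \<le> 2" using that by (auto simp: layer_def)
    have "2 \<le> w" using w by simp
    then have "(\<Sum>S | S \<in> layer N w \<and> R \<subseteq> S. c S) = 0"
      by (rule sum_supersets_eq_0_mono[OF N(1) subset_refl _ c2 R])
    then show "p i R * (\<Sum>S | S \<in> layer N w \<and> R \<subseteq> S. c S) = 0" by simp
  qed
  have m_4: "m 4 = 0"
  proof -
    have "m 4 = (\<Sum>Q\<in>layer N 4. p 4 Q * extend 3 u Q)" unfolding m_eq using c4 by (intro sum.cong) auto
    also have "\<dots> = (\<Sum>R\<in>layer N 3. u R * (\<Sum>Q | Q \<in> layer N 4 \<and> R \<subseteq> Q. p 4 Q))"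
      by (rule sum_mult_extend[OF N(1)])
    also have "\<dots> = 0"
      using harmonic_sum_supersets[OF N(1) p(1)[of 4]] w by (intro sum.neutral) (auto simp: layer_def[of N 3])
    finally show ?thesis .
  qed
  obtain \<beta> :: "nat \<Rightarrow> real" where \<beta>: "\<beta> 4 = 24" "\<beta> 3 = 36 - 6 * real_of_int (x + y + z + t)"
    "\<And>j. 4 < j \<Longrightarrow> \<beta> j = 0"
    "\<And>m w. 4 \<le> w \<Longrightarrow> real_of_int ((x - int m) * (y - int m) * (z - int m) * (t - int m))
        = (\<Sum>j\<le>w. \<beta> j * real (m choose j))"
    using quartic_newton_coeffs[of x y z t] by blast
  have ev_high: "eigenvalue n w \<beta> i = 0" if "4 < i" for i
    using that \<beta>(3) by (simp add: eigenvalue_def)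
  have ev_3: "eigenvalue n w \<beta> 3 \<le> 0"
  proof -
    \<comment> \<open>The slack in \<open>sum_le\<close>. Expressing one binomial through the other
      yields \<open>(n - 6) * - eigenvalue = 6 * \<delta> * ((n - 6) choose (w -
      3))\<close>.\<close>
    define \<delta> where "\<delta> = 4 * (int w - 3) * (int n - int w - 3) - (x + y + z + t - 6) * (int n - 6)"
    have "eigenvalue n w \<beta> 3 = - (\<Sum>j\<in>{3, 4}. \<beta> j * real ((w - 3) choose (j - 3)) * real ((n - j - 3) choose (w - 3)))"
    proof -
      have "(\<Sum>j=3..w. \<beta> j * real ((w - 3) choose (j - 3)) * real ((n - j - 3) choose (w - 3)))
          = (\<Sum>j\<in>{3, 4}. \<beta> j * real ((w - 3) choose (j - 3)) * real ((n - j - 3) choose (w - 3)))"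
        using w by (intro sum.mono_neutral_right) (auto intro!: \<beta>(3))
      then show ?thesis by (simp add: eigenvalue_def)
    qed
    also have "\<dots> = - (\<beta> 3 * real ((n - 6) choose (w - 3)) + 24 * real (w - 3) * real ((n - 7) choose (w - 3)))"
      using \<beta>(1) by (simp add: numeral_eq_Suc)
    finally have ev: "eigenvalue n w \<beta> 3
        = - (\<beta> 3 * real ((n - 6) choose (w - 3)) + 24 * real (w - 3) * real ((n - 7) choose (w - 3)))" .
    have "(n - 6) * ((n - 7) choose (w - 3)) = (n - w - 3) * ((n - 6) choose (w - 3))"
    proof -
      have "n - 6 - (w - 3) = n - w - 3" "n - 6 - 1 = n - 7" using w by simp_all
      then show ?thesis using binomial_absorb_comp[of "n - 6" "w - 3"] by metis
    qed
    then have absorb: "real (n - 6) * real ((n - 7) choose (w - 3)) = real (n - w - 3) * real ((n - 6) choose (w - 3))"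
      by (metis of_nat_mult)
    have "real (n - 6) * - eigenvalue n w \<beta> 3 = real (n - 6) * \<beta> 3 * real ((n - 6) choose (w - 3))
        + 24 * real (w - 3) * (real (n - 6) * real ((n - 7) choose (w - 3)))"
      unfolding ev by (simp add: algebra_simps)
    also have "\<dots> = (real (n - 6) * \<beta> 3 + 24 * real (w - 3) * real (n - w - 3)) * real ((n - 6) choose (w - 3))"
      unfolding absorb by (simp add: algebra_simps)
    also have "real (n - 6) * \<beta> 3 + 24 * real (w - 3) * real (n - w - 3)
        = of_int (6 * \<delta>)"
      using w by (simp add: \<beta>(2) \<delta>_def of_nat_diff algebra_simps)
    finally have "real (n - 6) * - eigenvalue n w \<beta> 3 = of_int (6 * \<delta>) * real ((n - 6) choose (w - 3))" .
    also have "\<dots> \<ge> 0"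
    proof -
      have "0 \<le> \<delta>" using sum_le by (simp add: \<delta>_def)
      then show ?thesis by simp
    qed
    finally have "real (n - 6) * - eigenvalue n w \<beta> 3 \<ge> 0" .
    moreover have "real (n - 6) > 0" using w by simp
    ultimately show ?thesis by (simp add: zero_le_mult_iff mult_le_0_iff)
  qed
  \<comment> \<open>The form is evaluated twice. Spectrally only the third eigenspace contributes,
    with a nonpositive value. Directly, the annihilator is 0 at all distances in \<open>X\<close>,
    which leaves the diagonal with the positive factor \<open>x * y * z * t\<close>. Hence
    \<open>c = 0\<close>.\<close>
  have "(\<Sum>S\<in>layer N w. \<Sum>T\<in>layer N w. c S * c T * (\<Sum>j\<le>w. \<beta> j * real (card (S - T) choose j)))
      = eigenvalue n w \<beta> 3 * m 3"
  proof -
    have "(\<Sum>i\<le>w. eigenvalue n w \<beta> i * m i) = (\<Sum>i\<in>{3}. eigenvalue n w \<beta> i * m i)"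
    proof (intro sum.mono_neutral_right ballI)
      fix i assume "i \<in> {..w} - {3}"
      then have "i \<le> 2 \<or> i = 4 \<or> 4 < i" by auto
      then show "eigenvalue n w \<beta> i * m i = 0" using m_low m_4 ev_high by auto
    qed (use w in auto)
    then show ?thesis unfolding p(4) m_def[symmetric] by simp
  qed
  moreover have "(\<Sum>S\<in>layer N w. \<Sum>T\<in>layer N w. c S * c T * (\<Sum>j\<le>w. \<beta> j * real (card (S - T) choose j)))
      = (\<Sum>S\<in>layer N w. c S ^ 2 * of_int (x * y * z * t))"
  proof (intro sum.cong refl)
    fix S assume S: "S \<in> layer N w"
    have "(\<Sum>T\<in>layer N w. c S * c T * (\<Sum>j\<le>w. \<beta> j * real (card (S - T) choose j)))
        = (\<Sum>T\<in>layer N w. if T = S then c S ^ 2 * of_int (x * y * z * t) else 0)"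
    proof (intro sum.cong refl)
      fix T
      have "(\<Sum>j\<le>w. \<beta> j * real (card (S - T) choose j)) = 0" if "S \<in> X" "T \<in> X" "S \<noteq> T"
        using dist[OF that] \<beta>(4)[OF w(1), symmetric] by auto
      moreover have "(\<Sum>j\<le>w. \<beta> j * real (card (S - S) choose j)) = of_int (x * y * z * t)"
        using \<beta>(4)[OF w(1), of 0] by simp
      ultimately show "c S * c T * (\<Sum>j\<le>w. \<beta> j * real (card (S - T) choose j))
          = (if T = S then c S ^ 2 * of_int (x * y * z * t) else 0)"
        by (cases "T = S") (auto simp: c_def power2_eq_square)
    qed
    then show "(\<Sum>T\<in>layer N w. c S * c T * (\<Sum>j\<le>w. \<beta> j * real (card (S - T) choose j)))
        = c S ^ 2 * of_int (x * y * z * t)" using S N by simp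
  qed
  moreover have "eigenvalue n w \<beta> 3 * m 3 \<le> 0"
    using ev_3 p(2)[of 3] w by (auto simp: m_def mult_nonpos_nonneg)
  ultimately have le0: "(\<Sum>S\<in>layer N w. c S ^ 2 * of_int (x * y * z * t)) \<le> 0" by simp
  have prod_pos: "0 < real_of_int (x * y * z * t)" using pos by (metis mult_pos_pos of_int_0_less_iff)
  have "0 \<le> (\<Sum>S\<in>layer N w. c S ^ 2 * of_int (x * y * z * t))"
    using prod_pos by (intro sum_nonneg mult_nonneg_nonneg) auto
  with le0 have "(\<Sum>S\<in>layer N w. c S ^ 2 * of_int (x * y * z * t)) = 0" by simp
  then have "\<forall>S\<in>layer N w. c S ^ 2 * of_int (x * y * z * t) = 0"
    using prod_pos N by (subst (asm) sum_nonneg_eq_0_iff) (auto intro!: mult_nonneg_nonneg)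
  then have c0: "c S = 0" if "S \<in> layer N w" for S using that prod_pos by auto
  then have "f (Inl S) = 0" if "S \<in> X" for S using c0[of S] that X by (auto simp: c_def)
  \<comment> \<open>Once \<open>c = 0\<close>, the extension of \<open>u\<close> to 4-sets vanishes,
    and extension from 3-sets to 4-sets is injective for \<open>n \<ge> 7\<close>.\<close>
  moreover have "f (Inr R) = 0" if R: "R \<in> layer N 3" for R
  proof -
    have ext0: "extend 3 u Q = 0" if "Q \<in> layer N 4" for Q
      using c4[OF that] c0 by simp
    have "4 + 3 \<le> card N" "(3 :: nat) \<le> 4" using w N by simp_all
    then have "u R = 0" by (rule extend_inj[OF N(1) _ _ ext0 R])
    then show ?thesis by (simp add: u_def)
  qed
  ultimately have "f i = 0" if "i \<in> X <+> layer N 3" for i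
    using that by (elim PlusE) simp_all
  then show False using f(1) by blast
qed

section \<open>Families with distances at most four\<close>

text \<open>Wilson's matrix for families with pairwise distances at most \<open>4\<close>, written as a function of the
  distance in the Newton basis. It vanishes at distances \<open>0, 1, 2, 3, 4\<close>.\<close>

definition wilson_coeff :: "nat \<Rightarrow> nat \<Rightarrow> nat \<Rightarrow> real" where
  "wilson_coeff n w j = (-1) ^ Suc j * real ((j - 1) choose 4) / real ((n - w + 4 - j) choose 4)"

lemma real_choose_4:
  "real (m choose 4) = real m * (real m - 1) * (real m - 2) * (real m - 3) / 24"
proof (induction m)
  case (Suc m)
  have "real (m choose 3) = real m * (real m - 1) * (real m - 2) / 6"
  proof (induction m)
    case (Suc m)
    have "real (m choose 2) = real m * (real m - 1) / 2"
      by (induction m) (auto simp: numeral_eq_Suc field_simps)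
    then show ?case using Suc by (simp add: numeral_eq_Suc field_simps)
  qed simp
  then show ?case using Suc by (simp add: numeral_eq_Suc field_simps)
qed simp

lemma fact_ratio_eq_prod: "r \<le> m \<Longrightarrow> (fact m :: real) / fact (m - r) = (\<Prod>s<r. real m - real s)"
proof (induction r)
  case (Suc r)
  have "m - r = Suc (m - Suc r)" using Suc.prems by simp
  then have f: "fact (m - r) = (real m - real r) * (fact (m - Suc r) :: real)"
    using Suc.prems by (simp add: of_nat_diff)
  have "fact m / fact (m - Suc r) = fact m / fact (m - r) * (real m - real r)"
    using Suc.prems by (simp add: f)
  then show ?case using Suc by simp
qed simp

text \<open>With \<open>j = i + l\<close>, the sign in front and that of \<open>wilson_coeff\<close>
  combine to \<open>- ((-1) ^ l)\<close>, so the eigenvalue is a finite difference of order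
  \<open>w - i\<close>.\<close>

lemma eigenvalue_wilson_shift:
  assumes "i \<le> w"
  shows "eigenvalue n w (wilson_coeff n w) i
    = - (\<Sum>l\<le>w - i. (-1) ^ l * real ((w - i) choose l)
        * (real ((i + l - 1) choose 4) * real ((n - 2 * i - l) choose (w - i)) / real ((n - w + 4 - i - l) choose 4)))"
proof -
  have "eigenvalue n w (wilson_coeff n w) i = (\<Sum>j=i..w. (-1) ^ i * (wilson_coeff n w j
      * real ((w - i) choose (j - i)) * real ((n - j - i) choose (w - i))))"
    by (simp add: eigenvalue_def sum_distrib_left)
  also have "\<dots> = (\<Sum>l\<le>w - i. (-1) ^ i * (wilson_coeff n w (i + l)
      * real ((w - i) choose l) * real ((n - (i + l) - i) choose (w - i))))"
    using assms by (intro sum.reindex_bij_witness[where i = "\<lambda>l. i + l" and j = "\<lambda>j. j - i"]) auto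
  also have "\<dots> = (\<Sum>l\<le>w - i. - ((-1) ^ l * real ((w - i) choose l)
        * (real ((i + l - 1) choose 4) * real ((n - 2 * i - l) choose (w - i)) / real ((n - w + 4 - i - l) choose 4))))"
  proof (intro sum.cong refl)
    fix l
    have "n - (i + l) - i = n - 2 * i - l" "n - w + 4 - (i + l) = n - w + 4 - i - l" by auto
    moreover have "(-1) ^ i * (-1) ^ Suc (i + l) = - ((-1) ^ l :: real)"
      by (simp add: power_add flip: mult.assoc)
    ultimately show "(-1) ^ i * (wilson_coeff n w (i + l)
        * real ((w - i) choose l) * real ((n - (i + l) - i) choose (w - i)))
        = - ((-1) ^ l * real ((w - i) choose l)
        * (real ((i + l - 1) choose 4) * real ((n - 2 * i - l) choose (w - i)) / real ((n - w + 4 - i - l) choose 4)))"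
      unfolding wilson_coeff_def by (simp add: mult.assoc[symmetric])
  qed
  finally show ?thesis by (simp add: sum_negf)
qed

text \<open>In the range \<open>i \<le> w - 4\<close> the summand is the value at \<open>l\<close> of a polynomial of degree \<open>w - i\<close>.\<close>

lemma wilson_alternating_sum:
  assumes "i + 4 \<le> w" "2 * w \<le> n"
  shows "(\<Sum>l\<le>w - i. (-1) ^ l * real ((w - i) choose l)
      * ((real i + real l - 1) * (real i + real l - 2) * (real i + real l - 3) * (real i + real l - 4) / 24
        * real ((n - 2 * i - l) choose (w - i)) / real ((n - w + 4 - i - l) choose 4))) = 1"
proof -
  define m r M where "m = w - i" and "r = w - 4 - i" and "M = n - 2 * i"
  have mr: "m = r + 4" "2 * m \<le> M" using assms by (auto simp: m_def r_def M_def)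
  define lin where "lin a = [:real i - a, 1:]" for a :: real
  \<comment> \<open>\<open>q\<close> holds the four linear factors, \<open>R\<close> the
    \<open>m - 4\<close> factors left when the factorials of the two binomials cancel. The degree
    equals the order of the difference, so only the leading coefficient \<open>(-1) ^ r\<close>
    survives.\<close>
  define q where "q = lin 1 * lin 2 * lin 3 * lin 4"
  define R where "R = (\<Prod>s<r. [:real M - real s, - 1:])"
  have q: "degree q = 4" "lead_coeff q = 1"
    unfolding q_def by (simp_all add: lin_def degree_mult_eq lead_coeff_mult)
  have "lead_coeff R = (\<Prod>s<r. lead_coeff [:real M - real s, - 1:])"
    by (simp only: R_def lead_coeff_prod)
  then have R: "degree R = r" "lead_coeff R = (-1) ^ r"
    by (simp_all add: R_def degree_prod_eq_sum_degree)
  have deg: "degree (q * R) = m" using q R mr by (subst degree_mult_eq) auto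
  have summand: "(real i + real l - 1) * (real i + real l - 2) * (real i + real l - 3) * (real i + real l - 4) / 24
        * real ((M - l) choose m) / real ((M - m + 4 - l) choose 4) = poly (q * R) (real l) / fact m"
    if l: "l \<le> m" for l
  proof -
    have b1: "real ((M - l) choose m) = fact (M - l) / (fact m * fact (M - l - m))"
      using l mr by (intro binomial_fact) auto
    have b2: "real ((M - m + 4 - l) choose 4) = fact (M - m + 4 - l) / (24 * fact (M - l - m))"
    proof -
      have "M - m + 4 - l - 4 = M - l - m" by simp
      moreover have "4 \<le> M - m + 4 - l" using l mr by simp
      ultimately show ?thesis by (simp add: binomial_fact fact_numeral)
    qed
    have b3: "fact (M - l) / fact (M - m + 4 - l) = poly R (real l)"
    proof -
      have "r \<le> M - l" "M - m + 4 - l = M - l - r" using l mr by auto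
      then show ?thesis using l mr fact_ratio_eq_prod[of r "M - l"]
        by (simp add: R_def poly_prod of_nat_diff algebra_simps)
    qed
    have b4: "(real i + real l - 1) * (real i + real l - 2) * (real i + real l - 3) * (real i + real l - 4)
        = poly q (real l)"
      by (simp add: q_def lin_def algebra_simps)
    show ?thesis unfolding b4 b1 b2 poly_mult b3[symmetric] by simp
  qed
  have "(\<Sum>l\<le>m. (-1) ^ l * real (m choose l)
      * ((real i + real l - 1) * (real i + real l - 2) * (real i + real l - 3) * (real i + real l - 4) / 24
        * real ((M - l) choose m) / real ((M - m + 4 - l) choose 4)))
      = (\<Sum>l\<le>m. (-1) ^ l * real (m choose l) * poly (q * R) (real l)) / fact m"
    unfolding sum_divide_distrib by (intro sum.cong refl) (simp only: summand atMost_iff times_divide_eq_right)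
  also have "\<dots> = (-1) ^ m * coeff (q * R) m"
    using deg by (subst alternating_binomial_sum_poly) auto
  also have "coeff (q * R) m = (-1) ^ r"
    using lead_coeff_mult[of q R] q R deg by simp
  also have "(-1) ^ m * (-1) ^ r = (1 :: real)"
    by (simp add: mr(1) power_add flip: power_mult_distrib)
  finally have *: "(\<Sum>l\<le>m. (-1) ^ l * real (m choose l)
      * ((real i + real l - 1) * (real i + real l - 2) * (real i + real l - 3) * (real i + real l - 4) / 24
        * real ((M - l) choose m) / real ((M - m + 4 - l) choose 4))) = 1" .
  have "M - m + 4 - l = n - w + 4 - i - l" for l using assms by (simp add: M_def m_def)
  then show ?thesis using * by (simp add: m_def M_def)
qed

text \<open>Since \<open>i \<ge> 1\<close>, the subtraction in \<open>(i + l - 1) choose 4\<close>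
  is never truncated and the binomial agrees with its polynomial at every \<open>l\<close>.\<close>

lemma eigenvalue_wilson_low:
  assumes "1 \<le> i" "i + 4 \<le> w" "2 * w \<le> n"
  shows "eigenvalue n w (wilson_coeff n w) i = - 1"
proof -
  have choose: "real ((i + l - 1) choose 4)
      = (real i + real l - 1) * (real i + real l - 2) * (real i + real l - 3) * (real i + real l - 4) / 24" for l
    using assms by (simp add: real_choose_4 of_nat_diff algebra_simps)
  have "i \<le> w" using assms by simp
  then show ?thesis
    by (simp only: eigenvalue_wilson_shift choose wilson_alternating_sum[OF assms(2,3)])
qed

text \<open>At \<open>l = 0\<close> the truncated \<open>(l - 1) choose 4\<close> is 0, whereas the
  polynomial takes the value 1. The sum with the polynomial equals 1, so the eigenvalue is
  \<open>F 0 - 1\<close>.\<close>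

lemma eigenvalue_wilson_0:
  assumes "4 \<le> w" "2 * w \<le> n"
  shows "eigenvalue n w (wilson_coeff n w) 0 = real (n choose w) / real ((n - w + 4) choose 4) - 1"
proof -
  define F where "F l = (-1) ^ l * real (w choose l) * ((real l - 1) * (real l - 2) * (real l - 3) * (real l - 4) / 24
      * real ((n - l) choose w) / real ((n - w + 4 - l) choose 4))" for l
  have "(\<Sum>l\<le>w. F l) = 1"
    using wilson_alternating_sum[of 0 w n] assms by (simp add: F_def)
  moreover have "(\<Sum>l\<le>w. F l) = F 0 + (\<Sum>l=1..w. F l)"
    by (simp add: atMost_atLeast0 sum.atLeast_Suc_atMost)
  moreover have "eigenvalue n w (wilson_coeff n w) 0 = - (\<Sum>l=1..w. F l)"
  proof -
    have choose: "real ((l - 1) choose 4) = (real l - 1) * (real l - 2) * (real l - 3) * (real l - 4) / 24" if "1 \<le> l" for l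
      using that by (simp add: real_choose_4 of_nat_diff algebra_simps)
    have "(\<Sum>l=1..w. F l) = (\<Sum>l=1..w. (-1) ^ l * real (w choose l)
        * (real ((l - 1) choose 4) * real ((n - l) choose w) / real ((n - w + 4 - l) choose 4)))"
    proof (intro sum.cong refl)
      fix l assume "l \<in> {1..w}"
      then have "1 \<le> l" by simp
      then show "F l = (-1) ^ l * real (w choose l)
          * (real ((l - 1) choose 4) * real ((n - l) choose w) / real ((n - w + 4 - l) choose 4))"
        by (simp only: F_def choose)
    qed
    moreover have "eigenvalue n w (wilson_coeff n w) 0 = - (\<Sum>l=1..w. (-1) ^ l * real (w choose l)
        * (real ((l - 1) choose 4) * real ((n - l) choose w) / real ((n - w + 4 - l) choose 4)))"
      by (simp add: eigenvalue_wilson_shift atMost_atLeast0 sum.atLeast_Suc_atMost)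
    ultimately show ?thesis by simp
  qed
  moreover have "F 0 = real (n choose w) / real ((n - w + 4) choose 4)" by (simp add: F_def)
  ultimately show ?thesis by simp
qed

text \<open>The form of Wilson's matrix is 0 on \<open>X\<close>. As the squared norms
  \<open>m i\<close> add up to \<open>card X\<close>, \<open>m 0\<close> is
  \<open>(card X)\<^sup>2 / (n choose w)\<close>, and all eigenvalues but the zeroth are at least
  \<open>- 1\<close>, this gives \<open>(card X)\<^sup>2 / M \<le> card X\<close>.\<close>

lemma intersecting_family_bound:
  assumes N: "finite N" "card N = n" and X: "X \<subseteq> layer N w" and w: "4 \<le> w" "2 * w \<le> n"
    and dist: "\<And>S T. S \<in> X \<Longrightarrow> T \<in> X \<Longrightarrow> card (S - T) \<le> 4"
    and high: "\<And>i. i \<le> w \<Longrightarrow> w < i + 4 \<Longrightarrow> eigenvalue n w (wilson_coeff n w) i \<ge> - 1"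
  shows "card X \<le> (n - w + 4) choose 4"
proof -
  have fin: "finite X" using N X finite_layer finite_subset by metis
  obtain p where p: "\<And>i. i \<le> w \<Longrightarrow> harmonic N i (p i)"
    "\<And>i. i \<le> w \<Longrightarrow> (\<Sum>S\<in>layer N w. of_bool (S \<in> X) * extend i (p i) S) \<ge> 0"
    "(\<Sum>S\<in>layer N w. of_bool (S \<in> X) ^ 2)
        = (\<Sum>i\<le>w. \<Sum>S\<in>layer N w. of_bool (S \<in> X) * extend i (p i) S)"
    "\<And>\<beta>. (\<Sum>S\<in>layer N w. \<Sum>T\<in>layer N w. of_bool (S \<in> X) * of_bool (T \<in> X)
          * (\<Sum>j\<le>w. \<beta> j * real (card (S - T) choose j)))
        = (\<Sum>i\<le>w. eigenvalue n w \<beta> i * (\<Sum>S\<in>layer N w. of_bool (S \<in> X) * extend i (p i) S))"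
    using spectral_decomposition[OF N, of w "\<lambda>S. of_bool (S \<in> X)"] by blast
  define m where "m i = (\<Sum>S\<in>layer N w. of_bool (S \<in> X) * extend i (p i) S)" for i
  define M where "M = real ((n - w + 4) choose 4)"
  have "M > 0" using w by (simp add: M_def)
  have form: "(\<Sum>S\<in>X. \<Sum>T\<in>X. \<Sum>j\<le>w. \<beta> j * real (card (S - T) choose j)) = (\<Sum>i\<le>w. eigenvalue n w \<beta> i * m i)" for \<beta>
    using p(4)[of \<beta>] by (simp add: sum_indicator_family[OF N(1) X] m_def)
  have "(\<Sum>i\<le>w. m i) = real (card X)"
  proof -
    have "(\<Sum>i\<le>w. m i) = (\<Sum>S\<in>layer N w. of_bool (S \<in> X))"
      unfolding m_def p(3)[symmetric] by (intro sum.cong) auto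
    also have "\<dots> = real (card X)"
      using X N by (simp add: of_bool_def sum.inter_filter[symmetric] Int_absorb1 Int_def[symmetric] Collect_conj_eq)
    finally show ?thesis .
  qed
  moreover have "real (n choose w) * m 0 = real (card X) ^ 2"
  proof -
    \<comment> \<open>The all-ones kernel, whose only nonzero eigenvalue is the zeroth; it computes
      \<open>m 0\<close>.\<close>
    define \<beta> :: "nat \<Rightarrow> real" where "\<beta> j = of_bool (j = 0)" for j
    have ev: "eigenvalue n w \<beta> i = (if i = 0 then real (n choose w) else 0)" for i
    proof (cases "i = 0")
      case True
      then show ?thesis by (simp add: eigenvalue_def \<beta>_def sum.atLeast_Suc_atMost)
    qed (auto simp: eigenvalue_def \<beta>_def)
    have "(\<Sum>j\<le>w. \<beta> j * real (card (S - T) choose j)) = 1" for S T :: "'a set"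
      by (simp add: \<beta>_def sum.atMost_shift)
    then have "real (card X) ^ 2 = (\<Sum>S\<in>X. \<Sum>T\<in>X. \<Sum>j\<le>w. \<beta> j * real (card (S - T) choose j))"
      by (simp add: power2_eq_square)
    also have "\<dots> = (\<Sum>i\<le>w. if i = 0 then real (n choose w) * m i else 0)"
      unfolding form by (intro sum.cong) (auto simp: ev)
    finally show ?thesis by simp
  qed
  moreover have "0 = (\<Sum>i\<le>w. eigenvalue n w (wilson_coeff n w) i * m i)"
  proof -
    have "wilson_coeff n w j * real (card (S - T) choose j) = 0" if "S \<in> X" "T \<in> X" for S T j
      using dist[OF that] by (cases "j \<le> 4") (auto simp: wilson_coeff_def binomial_eq_0)
    then have "(\<Sum>j\<le>w. wilson_coeff n w j * real (card (S - T) choose j)) = 0" if "S \<in> X" "T \<in> X" for S T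
      using that by (intro sum.neutral) blast
    then show ?thesis unfolding form[symmetric] by (simp cong: sum.cong)
  qed
  moreover have "(\<Sum>i\<le>w. eigenvalue n w (wilson_coeff n w) i * m i)
      \<ge> (\<Sum>i\<le>w. (if i = 0 then real (n choose w) / M * m i else 0) - m i)"
  proof (intro sum_mono)
    fix i assume "i \<in> {..w}"
    then have i: "i \<le> w" by simp
    have "m i \<ge> 0" using p(2)[OF i] by (simp add: m_def)
    show "(if i = 0 then real (n choose w) / M * m i else 0) - m i \<le> eigenvalue n w (wilson_coeff n w) i * m i"
    proof (cases "i = 0")
      case True
      then show ?thesis using w by (simp add: eigenvalue_wilson_0 M_def algebra_simps)
    next
      case False
      have "eigenvalue n w (wilson_coeff n w) i \<ge> - 1"
        using eigenvalue_wilson_low[of i w n] high[of i] False i w by (cases "i + 4 \<le> w") auto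
      then show ?thesis using False mult_right_mono[OF _ \<open>m i \<ge> 0\<close>] by fastforce
    qed
  qed
  ultimately have "real (card X) ^ 2 / M - real (card X) \<le> 0"
    by (simp add: sum_subtractf)
  then have "real (card X) * real (card X) \<le> M * real (card X)"
    using \<open>M > 0\<close> by (simp add: field_simps power2_eq_square)
  then have "real (card X) \<le> M"
    using \<open>M > 0\<close> by (cases "card X = 0") (auto simp: mult_le_cancel_right)
  then show ?thesis by (simp add: M_def)
qed

section \<open>The last four eigenvalues of Wilson's matrix\<close>

lemma int_choose_2: "2 * int (m choose 2) = int m * (int m - 1)"
  by (induction m) (auto simp: numeral_eq_Suc algebra_simps)

lemma int_choose_3: "6 * int (m choose 3) = int m * (int m - 1) * (int m - 2)"
proof (induction m)
  case (Suc m)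
  have "6 * int (Suc m choose 3) = 6 * int (m choose 3) + 3 * (2 * int (m choose 2))"
    by (simp add: numeral_eq_Suc)
  then show ?case unfolding Suc int_choose_2 by (simp add: algebra_simps)
qed simp

lemma int_choose_4: "24 * int (m choose 4) = int m * (int m - 1) * (int m - 2) * (int m - 3)"
proof (induction m)
  case (Suc m)
  have "24 * int (Suc m choose 4) = 24 * int (m choose 4) + 4 * (6 * int (m choose 3))"
    by (simp add: numeral_eq_Suc)
  then show ?case unfolding Suc int_choose_3 by (simp add: algebra_simps)
qed simp

lemma choose_ratio_2: "2 \<le> z \<Longrightarrow> real (z choose 2) / real ((z + 2) choose 4) = 12 / ((real z + 2) * (real z + 1))"
proof -
  assume "2 \<le> z"
  have c2: "real (z choose 2) = real z * (real z - 1) / 2"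
    by (induction z) (auto simp: numeral_eq_Suc field_simps)
  have c4: "real ((z + 2) choose 4) = (real z + 2) * (real z + 1) * (real z * (real z - 1)) / 24"
    by (simp add: real_choose_4 algebra_simps)
  have "real z * (real z - 1) \<noteq> 0" using \<open>2 \<le> z\<close> by auto
  then show ?thesis unfolding c2 c4 by simp
qed

lemma choose_ratio_3: "3 \<le> z \<Longrightarrow> real (z choose 3) / real ((z + 1) choose 4) = 4 / (real z + 1)"
proof -
  assume "3 \<le> z"
  have "4 * (Suc z choose 4) = Suc z * (z choose 3)"
    using binomial_absorption[of 3 "Suc z"] by (simp add: numeral_eq_Suc)
  then have "4 * real ((z + 1) choose 4) = (real z + 1) * real (z choose 3)"
    by (metis Suc_eq_plus1 of_nat_Suc of_nat_mult of_nat_numeral add.commute)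
  moreover have "0 < z choose 3" using \<open>3 \<le> z\<close> by (rule zero_less_binomial)
  ultimately show ?thesis by (simp add: field_simps)
qed

lemma sum_atMost_small:
  fixes f :: "nat \<Rightarrow> real"
  shows "sum f {..1} = f 0 + f 1" "sum f {..2} = f 0 + f 1 + f 2" "sum f {..3} = f 0 + f 1 + f 2 + f 3"
  by (simp_all add: numeral_eq_Suc)

definition falling_4 :: "int \<Rightarrow> int" where
  "falling_4 m = m * (m - 1) * (m - 2) * (m - 3)"

text \<open>The inequalities \<open>\<lambda>\<^sub>i \<ge> - 1\<close> for the eigenvalues \<open>i = w, w - 2, w - 3\<close> of Wilson's matrix,
  with denominators cleared and \<open>y = n - 2 w\<close>; the one for \<open>i = w - 1\<close> always holds.\<close>

definition wilson_inequalities :: "int \<Rightarrow> int \<Rightarrow> bool" where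
  "wilson_inequalities w y \<longleftrightarrow>
     falling_4 (w - 1) \<le> falling_4 (y + 4) \<and>
     falling_4 (w - 3) * ((y + 4) * (y + 3)) - 2 * falling_4 (w - 2) * ((y + 6) * (y + 3))
       + falling_4 (w - 1) * ((y + 6) * (y + 5)) \<le> 2 * ((y + 3) * (y + 4) * (y + 5) * (y + 6)) \<and>
     falling_4 (w - 4) * ((y + 6) * (y + 5) * (y + 4)) - 3 * falling_4 (w - 3) * ((y + 7) * (y + 5) * (y + 4))
       + 3 * falling_4 (w - 2) * ((y + 7) * (y + 6) * (y + 4)) - falling_4 (w - 1) * ((y + 7) * (y + 6) * (y + 5))
       \<le> 6 * ((y + 4) * (y + 5) * (y + 6) * (y + 7))"

lemma eigenvalue_wilson_high:
  assumes "4 \<le> w" "wilson_inequalities (int w) (int y)" "i \<le> w" "w < i + 4"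
  shows "- 1 \<le> eigenvalue (2 * w + y) w (wilson_coeff (2 * w + y) w) i"
proof -
  define n where "n = 2 * w + y"
  define A where "A m = real_of_int (falling_4 (int w - m))" for m
  have A: "real ((w - k) choose 4) = A (int k) / 24" if "k \<le> w" for k
    using that by (simp add: A_def falling_4_def real_choose_4 of_nat_diff)
  have A': "real ((w - 1) choose 4) = A 1 / 24" "real ((w - 2) choose 4) = A 2 / 24"
    "real ((w - 3) choose 4) = A 3 / 24" "real ((w - 4) choose 4) = A 4 / 24"
    using A[of 1] A[of 2] A[of 3] A[of 4] assms(1) by simp_all
  consider "i = w" | "i = w - 1" | "i = w - 2" | "i = w - 3" using assms by linarith
  then show ?thesis
  proof cases
    case 1
    have "eigenvalue n w (wilson_coeff n w) i = - (real ((w - 1) choose 4) / real ((y + 4) choose 4))"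
      using 1 by (simp add: eigenvalue_wilson_shift n_def add.commute)
    moreover have "real ((w - 1) choose 4) \<le> real ((y + 4) choose 4)"
    proof -
      have "24 * int ((w - 1) choose 4) \<le> 24 * int ((y + 4) choose 4)"
        using assms(1,2) unfolding int_choose_4
        by (simp add: wilson_inequalities_def falling_4_def of_nat_diff)
      then show ?thesis by simp
    qed
    moreover have "0 < (y + 4) choose 4" by (simp add: zero_less_binomial)
    ultimately show ?thesis by (simp add: n_def)
  next
    case 2
    \<comment> \<open>This eigenvalue is even nonnegative: passing from
      \<open>(y + 5) choose 4\<close> to \<open>(y + 4) choose 4\<close> brings in the factor
      \<open>(y + 1) / (y + 5)\<close>, and \<open>(y + 2) / (y + 5) \<le> 1\<close>.\<close>
    have "real ((w - 2) choose 4) * real (y + 2) / real ((y + 5) choose 4)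
        \<le> real ((w - 1) choose 4) * real (y + 1) / real ((y + 4) choose 4)"
    proof -
      have "real ((y + 5) choose 4) = real ((y + 4) choose 4) * (real y + 5) / (real y + 1)"
        by (simp add: real_choose_4 field_simps)
      moreover have "real ((w - 2) choose 4) * real (y + 2) / (real ((y + 4) choose 4) * (real y + 5) / (real y + 1))
          \<le> real ((w - 1) choose 4) * real (y + 1) / real ((y + 4) choose 4)"
      proof -
        have "(w - 2) choose 4 \<le> (w - 1) choose 4" by (rule binomial_right_mono) auto
        then have "real ((w - 2) choose 4) * (real (y + 2) / (real y + 5)) \<le> real ((w - 1) choose 4) * 1"
          by (intro mult_mono) auto
        then have "real ((w - 2) choose 4) * (real (y + 2) / (real y + 5)) * (real (y + 1) / real ((y + 4) choose 4))
            \<le> real ((w - 1) choose 4) * 1 * (real (y + 1) / real ((y + 4) choose 4))"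
          by (rule mult_right_mono) auto
        then show ?thesis by (simp add: mult_ac add_ac)
      qed
      ultimately show ?thesis by simp
    qed
    moreover have "eigenvalue n w (wilson_coeff n w) i
        = - (real ((w - 2) choose 4) * real (y + 2) / real ((y + 5) choose 4)
          - real ((w - 1) choose 4) * real (y + 1) / real ((y + 4) choose 4))"
    proof -
      have idx: "w - i = 1" "i + 0 - 1 = w - 2" "i + 1 - 1 = w - 1" "n - 2 * i - 0 = y + 2" "n - 2 * i - 1 = y + 1"
        "n - w + 4 - i - 0 = y + 5" "n - w + 4 - i - 1 = y + 4" "i \<le> w"
        using 2 assms(1) by (auto simp: n_def)
      show ?thesis unfolding eigenvalue_wilson_shift[OF idx(8)] idx(1) sum_atMost_small
        by (simp only: idx(2-7)) simp
    qed
    ultimately show ?thesis by (simp add: n_def)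
  next
    case 3
    have idx: "w - i = 2" "i + 0 - 1 = w - 3" "i + 1 - 1 = w - 2" "i + 2 - 1 = w - 1"
      "n - 2 * i - 0 = y + 4" "n - 2 * i - 1 = y + 3" "n - 2 * i - 2 = y + 2"
      "n - w + 4 - i - 0 = (y + 4) + 2" "n - w + 4 - i - 1 = (y + 3) + 2" "n - w + 4 - i - 2 = (y + 2) + 2" "i \<le> w"
      using 3 assms(1) by (auto simp: n_def)
    have "eigenvalue n w (wilson_coeff n w) i = - (A 3 / 24 * (12 / ((real y + 6) * (real y + 5)))
        - 2 * (A 2 / 24 * (12 / ((real y + 5) * (real y + 4)))) + A 1 / 24 * (12 / ((real y + 4) * (real y + 3))))"
    proof -
      have "eigenvalue n w (wilson_coeff n w) i = - (real ((w - 3) choose 4) * (real ((y + 4) choose 2) / real (((y + 4) + 2) choose 4))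
        - 2 * (real ((w - 2) choose 4) * (real ((y + 3) choose 2) / real (((y + 3) + 2) choose 4)))
        + real ((w - 1) choose 4) * (real ((y + 2) choose 2) / real (((y + 2) + 2) choose 4)))"
        unfolding eigenvalue_wilson_shift[OF idx(11)] idx(1) sum_atMost_small
        by (simp only: idx(2-10)) simp
      also have "\<dots> = - (A 3 / 24 * (12 / ((real (y + 4) + 2) * (real (y + 4) + 1)))
        - 2 * (A 2 / 24 * (12 / ((real (y + 3) + 2) * (real (y + 3) + 1))))
        + A 1 / 24 * (12 / ((real (y + 2) + 2) * (real (y + 2) + 1))))"
        unfolding A' by (subst choose_ratio_2, simp)+ (rule refl)
      finally show ?thesis by (simp add: add.commute)
    qed
    moreover have "A 3 / 24 * (12 / ((real y + 6) * (real y + 5)))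
        - 2 * (A 2 / 24 * (12 / ((real y + 5) * (real y + 4)))) + A 1 / 24 * (12 / ((real y + 4) * (real y + 3))) \<le> 1"
    proof -
      have "real_of_int (falling_4 (int w - 3) * ((int y + 4) * (int y + 3)) - 2 * falling_4 (int w - 2) * ((int y + 6) * (int y + 3))
        + falling_4 (int w - 1) * ((int y + 6) * (int y + 5))) \<le> real_of_int (2 * ((int y + 3) * (int y + 4) * (int y + 5) * (int y + 6)))"
        using assms(2) unfolding wilson_inequalities_def of_int_le_iff by blast
      then have le: "A 3 * ((real y + 4) * (real y + 3)) - 2 * A 2 * ((real y + 6) * (real y + 3)) + A 1 * ((real y + 6) * (real y + 5))
          \<le> 2 * ((real y + 3) * (real y + 4) * (real y + 5) * (real y + 6))" (is "?L \<le> 2 * ?P")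
        by (simp add: A_def)
      have "A 3 / 24 * (12 / ((real y + 6) * (real y + 5)))
        - 2 * (A 2 / 24 * (12 / ((real y + 5) * (real y + 4)))) + A 1 / 24 * (12 / ((real y + 4) * (real y + 3))) = ?L / (2 * ?P)"
        by (simp add: divide_simps) (simp add: algebra_simps)
      also have "\<dots> \<le> 1" using le by (subst divide_le_eq_1_pos) simp_all
      finally show ?thesis .
    qed
    ultimately show ?thesis by (simp add: n_def)
  next
    case 4
    have idx: "w - i = 3" "i + 0 - 1 = w - 4" "i + 1 - 1 = w - 3" "i + 2 - 1 = w - 2" "i + 3 - 1 = w - 1"
      "n - 2 * i - 0 = y + 6" "n - 2 * i - 1 = y + 5" "n - 2 * i - 2 = y + 4" "n - 2 * i - 3 = y + 3"
      "n - w + 4 - i - 0 = (y + 6) + 1" "n - w + 4 - i - 1 = (y + 5) + 1" "n - w + 4 - i - 2 = (y + 4) + 1"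
      "n - w + 4 - i - 3 = (y + 3) + 1" "i \<le> w"
      using 4 assms(1) by (auto simp: n_def)
    have choose: "real (3 choose 2) = 3" "real (3 choose 1) = 3" by (simp_all add: numeral_eq_Suc)
    let ?E = "A 4 / 24 * (4 / (real y + 7)) - 3 * (A 3 / 24 * (4 / (real y + 6)))
        + 3 * (A 2 / 24 * (4 / (real y + 5))) - A 1 / 24 * (4 / (real y + 4))"
    have "eigenvalue n w (wilson_coeff n w) i = - ?E"
    proof -
      have "eigenvalue n w (wilson_coeff n w) i = - (real ((w - 4) choose 4) * (real ((y + 6) choose 3) / real (((y + 6) + 1) choose 4))
        - 3 * (real ((w - 3) choose 4) * (real ((y + 5) choose 3) / real (((y + 5) + 1) choose 4)))
        + 3 * (real ((w - 2) choose 4) * (real ((y + 4) choose 3) / real (((y + 4) + 1) choose 4)))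
        - real ((w - 1) choose 4) * (real ((y + 3) choose 3) / real (((y + 3) + 1) choose 4)))"
        unfolding eigenvalue_wilson_shift[OF idx(14)] idx(1) sum_atMost_small
        by (simp only: idx(2-13)) (simp add: choose[simplified])
      also have "\<dots> = - (A 4 / 24 * (4 / (real (y + 6) + 1)) - 3 * (A 3 / 24 * (4 / (real (y + 5) + 1)))
        + 3 * (A 2 / 24 * (4 / (real (y + 4) + 1))) - A 1 / 24 * (4 / (real (y + 3) + 1)))"
        unfolding A' by (subst choose_ratio_3, simp)+ (rule refl)
      finally show ?thesis by (simp add: add.commute)
    qed
    moreover have "?E \<le> 1"
    proof -
      have "real_of_int (falling_4 (int w - 4) * ((int y + 6) * (int y + 5) * (int y + 4)) - 3 * falling_4 (int w - 3) * ((int y + 7) * (int y + 5) * (int y + 4))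
       + 3 * falling_4 (int w - 2) * ((int y + 7) * (int y + 6) * (int y + 4)) - falling_4 (int w - 1) * ((int y + 7) * (int y + 6) * (int y + 5)))
       \<le> real_of_int (6 * ((int y + 4) * (int y + 5) * (int y + 6) * (int y + 7)))"
        using assms(2) unfolding wilson_inequalities_def of_int_le_iff by blast
      then have le: "A 4 * ((real y + 6) * (real y + 5) * (real y + 4)) - 3 * A 3 * ((real y + 7) * (real y + 5) * (real y + 4))
       + 3 * A 2 * ((real y + 7) * (real y + 6) * (real y + 4)) - A 1 * ((real y + 7) * (real y + 6) * (real y + 5))
       \<le> 6 * ((real y + 4) * (real y + 5) * (real y + 6) * (real y + 7))" (is "?L \<le> 6 * ?P")
        by (simp add: A_def)
      have "?E = ?L / (6 * ?P)"
        by (simp add: divide_simps) (simp add: algebra_simps)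
      also have "\<dots> \<le> 1" using le by (subst divide_le_eq_1_pos) simp_all
      finally show ?thesis .
    qed
    ultimately show ?thesis by (simp add: n_def)
  qed
qed

section \<open>Certificates for the linear programming bound\<close>

lemma real_choose_Suc: "real (m choose Suc j) = real (m choose j) * (real m - real j) / real (Suc j)"
proof (cases "j \<le> m")
  case True
  have "Suc j * (m choose Suc j) = (m - j) * (m choose j)"
    using binomial_absorption[of j "m"] binomial_absorb_comp[of m j] by simp
  then have "real (Suc j) * real (m choose Suc j) = real (m - j) * real (m choose j)"
    by (metis of_nat_mult)
  then show ?thesis using True by (simp add: of_nat_diff field_simps)
qed (simp add: binomial_eq_0)

text \<open>Up to sign, the ratio of consecutive terms of the terminating hypergeometric series 3F2
  with upper parameters \<open>- k\<close>, \<open>k - n - 1\<close>, \<open>- d\<close> and lower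
  parameters \<open>- w\<close>, \<open>w - n\<close> at 1, which is
  \<open>hahn n w k d\<close>.\<close>

definition hahn_ratio :: "nat \<Rightarrow> nat \<Rightarrow> nat \<Rightarrow> nat \<Rightarrow> nat \<Rightarrow> real" where
  "hahn_ratio n w k d i = (real d - real i) * (real k - real i) * (real n + 1 - real k - real i)
     / ((real i + 1) * (real w - real i) * (real n - real w - real i))"

lemma hahn_term_eq_prod:
  assumes "k \<le> n + 1" "w \<le> n"
  shows "hahn_coeff n w k j * real (d choose j) = (-1) ^ j * (\<Prod>i<j. hahn_ratio n w k d i)"
proof (induction j)
  case (Suc j)
  have "hahn_coeff n w k (Suc j) * real (d choose Suc j)
      = hahn_coeff n w k j * real (d choose j) * - hahn_ratio n w k d j"
    using assms
    by (simp add: hahn_coeff_def hahn_ratio_def real_choose_Suc of_nat_diff divide_simps) (auto simp: mult_ac add_ac)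
  then show ?case using Suc by simp
qed (simp add: hahn_coeff_def)

fun hahn_horner :: "nat \<Rightarrow> nat \<Rightarrow> nat \<Rightarrow> nat \<Rightarrow> nat \<Rightarrow> nat \<Rightarrow> real" where
  "hahn_horner n w k d j 0 = 1"
| "hahn_horner n w k d j (Suc l) = 1 - hahn_ratio n w k d j * hahn_horner n w k d (Suc j) l"

lemma hahn_horner_eq_sum:
  "hahn_horner n w k d j l = (\<Sum>s\<le>l. (-1) ^ s * (\<Prod>i<s. hahn_ratio n w k d (j + i)))"
proof (induction l arbitrary: j)
  case (Suc l)
  have "(\<Sum>s\<le>Suc l. (-1) ^ s * (\<Prod>i<s. hahn_ratio n w k d (j + i)))
      = 1 + (\<Sum>s\<le>l. - hahn_ratio n w k d j * ((-1) ^ s * (\<Prod>i<s. hahn_ratio n w k d (Suc j + i))))"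
    by (subst sum.atMost_Suc_shift) (simp add: prod.lessThan_Suc_shift mult_ac del: prod.lessThan_Suc)
  then show ?case using Suc[of "Suc j"] by (simp add: sum_negf flip: sum_distrib_left)
qed simp

lemma hahn_eq_horner:
  assumes "k \<le> J" "J \<le> w" "w \<le> n"
  shows "hahn n w k d = hahn_horner n w k d 0 J"
proof -
  have "hahn n w k d = (\<Sum>s\<le>J. hahn_coeff n w k s * real (d choose s))"
    unfolding hahn_def using assms
    by (intro sum.mono_neutral_right) (auto simp: hahn_coeff_def)
  then show ?thesis using assms by (simp add: hahn_term_eq_prod hahn_horner_eq_sum)
qed

text \<open>Fraction-free evaluation of \<open>\<Sum>\<^sub>k g k * hahn n w k d\<close> over the integers: \<open>newton_form\<close> lists the
  coefficients \<open>\<Sum>\<^sub>k g k * (\<Prod>i<j. (k - i) * (n + 1 - k - i))\<close>, and \<open>clear_denoms\<close> multiplies the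
  \<open>j\<close>-th one by the denominators \<open>(i + 1) * (w - i) * (n - w - i)\<close> with \<open>i \<ge> j\<close>.\<close>

fun newton_form :: "int \<Rightarrow> int \<Rightarrow> (int \<times> int) list \<Rightarrow> int list \<Rightarrow> int list" where
  "newton_form m j ts [] = [sum_list (map snd ts)]"
| "newton_form m j ts (g # gs) = sum_list (map snd ts)
     # newton_form m (j + 1) (map (\<lambda>(k, t). (k, t * ((k - j) * (m - k - j)))) ts) gs"

fun clear_denoms :: "int \<Rightarrow> int \<Rightarrow> int \<Rightarrow> int list \<Rightarrow> int list \<times> int" where
  "clear_denoms w v j [] = ([], 1)"
| "clear_denoms w v j (x # xs) = (case clear_denoms w v (j + 1) xs of
     (ys, p) \<Rightarrow> let q = (j + 1) * (w - j) * (v - j) * p in (x * q # ys, q))"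

fun horner_eval :: "int \<Rightarrow> int \<Rightarrow> int list \<Rightarrow> int" where
  "horner_eval a j [] = 0"
| "horner_eval a j (y # ys) = y - (a - j) * horner_eval a (j + 1) ys"

fun enumerate_from :: "int \<Rightarrow> int list \<Rightarrow> (int \<times> int) list" where
  "enumerate_from k [] = []"
| "enumerate_from k (g # gs) = (k, g) # enumerate_from (k + 1) gs"

text \<open>\<open>ts\<close> pairs each \<open>k\<close> with its multiplier times the factors
  \<open>(k - i) * (n + 1 - k - i)\<close> for the \<open>i < j\<close> already passed; the factors
  \<open>d - i\<close> enter in \<open>horner_eval\<close>, and \<open>p\<close> is the product of
  all denominators from \<open>j\<close> on. The length of \<open>gs\<close> sets the number of
  Horner steps.\<close>

lemma horner_eval_correct:
  fixes ts :: "(nat \<times> int) list"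
  assumes "j + length gs < w" "2 * w \<le> n"
    and "clear_denoms (int w) (int n - int w) (int j)
           (newton_form (int n + 1) (int j) (map (\<lambda>(k, t). (int k, t)) ts) gs) = (ys, p)"
  shows "0 < p \<and> real_of_int (horner_eval (int d) (int j) ys)
    = real_of_int p * (\<Sum>(k, t)\<leftarrow>ts. real_of_int t * hahn_horner n w k d j (length gs))"
  using assms
proof (induction gs arbitrary: j ts ys p)
  case Nil
  \<comment> \<open>\<open>newton_form\<close> returns one entry more than \<open>gs\<close>, so the
    denominators at the final index enter too. Their positivity is the reason for the strict
    inequality \<open>j + length gs < w\<close>.\<close>
  define q where "q = (int j + 1) * (int w - int j) * (int n - int w - int j)"
  have "0 < q" using Nil by (simp add: q_def)
  moreover have "sum_list (map snd (map (\<lambda>(k, t). (int k, t)) ts)) = (\<Sum>(k, t)\<leftarrow>ts. t)"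
    by (simp add: case_prod_unfold o_def)
  moreover have "real_of_int (\<Sum>(k, t)\<leftarrow>ts. t) = (\<Sum>(k, t)\<leftarrow>ts. real_of_int t)"
    by (induction ts) auto
  ultimately show ?case using Nil by (auto simp: q_def mult_ac)
next
  case (Cons g gs)
  define q where "q = (int j + 1) * (int w - int j) * (int n - int w - int j)"
  have q: "0 < q" using Cons.prems by (simp add: q_def)
  define ts' where "ts' = map (\<lambda>(k, t). (k, t * ((int k - int j) * (int n + 1 - int k - int j)))) ts"
  obtain ys' p' where ys': "clear_denoms (int w) (int n - int w) (int (Suc j))
           (newton_form (int n + 1) (int (Suc j)) (map (\<lambda>(k, t). (int k, t)) ts') gs) = (ys', p')"
    by fastforce
  have IH: "0 < p'" "real_of_int (horner_eval (int d) (int (Suc j)) ys')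
    = real_of_int p' * (\<Sum>(k, t)\<leftarrow>ts'. real_of_int t * hahn_horner n w k d (Suc j) (length gs))"
    using Cons.IH[OF _ _ ys'] Cons.prems by auto
  have ts'_eq: "map (\<lambda>(k, t). (int k, t)) ts'
      = map (\<lambda>(k, t). (k, t * ((k - int j) * (int n + 1 - k - int j)))) (map (\<lambda>(k, t). (int k, t)) ts)"
    by (simp add: ts'_def case_prod_unfold o_def)
  have s: "sum_list (map snd (map (\<lambda>(k, t). (int k, t)) ts)) = (\<Sum>(k, t)\<leftarrow>ts. t)"
    by (simp add: case_prod_unfold o_def)
  have s': "real_of_int (\<Sum>(k, t)\<leftarrow>ts. t) = (\<Sum>(k, t)\<leftarrow>ts. real_of_int t)"
    by (induction ts) auto
  have out: "p = q * p'" "ys = (\<Sum>(k, t)\<leftarrow>ts. t) * p # ys'"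
    using Cons.prems(3) ys' unfolding newton_form.simps clear_denoms.simps s ts'_eq
    by (auto simp: q_def add.commute Let_def)
  have "real_of_int (horner_eval (int d) (int j) ys)
      = real_of_int p * (\<Sum>(k, t)\<leftarrow>ts. real_of_int t) - (real d - real j) * real_of_int (horner_eval (int d) (int (Suc j)) ys')"
    by (simp add: out(2) s' add.commute)
  also have "(real d - real j) * real_of_int (horner_eval (int d) (int (Suc j)) ys')
      = real_of_int p * (\<Sum>(k, t)\<leftarrow>ts. real_of_int t * (hahn_ratio n w k d j * hahn_horner n w k d (Suc j) (length gs)))"
  proof -
    have "(real d - real j) * (real_of_int p' * (\<Sum>(k, t)\<leftarrow>ts'. real_of_int t * hahn_horner n w k d (Suc j) (length gs)))
      = real_of_int p * (\<Sum>(k, t)\<leftarrow>ts. real_of_int t * (hahn_ratio n w k d j * hahn_horner n w k d (Suc j) (length gs)))"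
      unfolding ts'_def
    proof (induction ts)
      case (Cons a ts)
      obtain k t where a: "a = (k, t)" by (cases a)
      have "(real d - real j) * (real_of_int p' * (real_of_int (t * ((int k - int j) * (int n + 1 - int k - int j)))
          * hahn_horner n w k d (Suc j) (length gs)))
        = real_of_int p * (real_of_int t * (hahn_ratio n w k d j * hahn_horner n w k d (Suc j) (length gs)))"
      proof -
        have "real_of_int q = (real j + 1) * (real w - real j) * (real n - real w - real j)"
          by (simp add: q_def)
        moreover have "real_of_int q \<noteq> 0" using q by simp
        ultimately show ?thesis by (simp add: out(1) hahn_ratio_def)
      qed
      then show ?case using Cons by (simp add: a distrib_left del: hahn_horner.simps)
    qed simp
    then show ?thesis by (simp only: IH(2))
  qed
  finally have "real_of_int (horner_eval (int d) (int j) ys)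
      = real_of_int p * ((\<Sum>(k, t)\<leftarrow>ts. real_of_int t)
        - (\<Sum>(k, t)\<leftarrow>ts. real_of_int t * (hahn_ratio n w k d j * hahn_horner n w k d (Suc j) (length gs))))"
    by (simp add: right_diff_distrib)
  also have "(\<Sum>(k, t)\<leftarrow>ts. real_of_int t)
        - (\<Sum>(k, t)\<leftarrow>ts. real_of_int t * (hahn_ratio n w k d j * hahn_horner n w k d (Suc j) (length gs)))
      = (\<Sum>(k, t)\<leftarrow>ts. real_of_int t * hahn_horner n w k d j (length (g # gs)))"
    by (induction ts) (auto simp: algebra_simps)
  finally show ?case using q IH(1) by (simp add: out(1))
qed

text \<open>A certificate \<open>(n, w, V, D, s, gs)\<close> asserts the bound \<open>V\<close> for families of \<open>w\<close>-subsets of an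
  \<open>n\<close>-set with distances in \<open>D\<close>; its multipliers are \<open>gs ! (k - 1) / s\<close>.\<close>

type_synonym certificate = "int \<times> int \<times> int \<times> int list \<times> int \<times> int list"

definition valid_certificate :: "certificate \<Rightarrow> bool" where
  "valid_certificate = (\<lambda>(n, w, V, D, s, gs).
     0 < s \<and> int (length gs) < w \<and> 2 * w \<le> n \<and> list_all (\<lambda>g. 0 \<le> g) gs \<and> sum_list gs \<le> (V - 1) * s \<and>
     (case clear_denoms w (n - w) 0 (newton_form (n + 1) 0 (enumerate_from 1 gs) gs) of
       (ys, p) \<Rightarrow> list_all (\<lambda>a. 0 \<le> a \<and> horner_eval a 0 ys \<le> - (s * p)) D))"

lemma enumerate_from_eq: "enumerate_from (int k) gs = map (\<lambda>(k, t). (int k, t)) (zip [k..<k + length gs] gs)"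
proof (induction gs arbitrary: k)
  case (Cons g gs)
  have "[k..<k + length (g # gs)] = k # [Suc k..<Suc k + length gs]" by (simp add: upt_conv_Cons del: upt_Suc)
  then show ?case using Cons[of "Suc k"] by (simp add: add.commute)
qed simp

lemma sum_list_zip_upt:
  "(\<Sum>(k, t)\<leftarrow>zip [Suc 0..<Suc (length gs)] gs. F k t) = (\<Sum>k=1..length gs. F k (gs ! (k - 1)) :: real)"
proof -
  have "(\<Sum>(k, t)\<leftarrow>zip [Suc 0..<Suc (length gs)] gs. F k t) = (\<Sum>i<length gs. F (Suc i) (gs ! i))"
    by (simp add: sum_list_sum_nth atLeast0LessThan del: upt_Suc)
  also have "\<dots> = (\<Sum>k=1..length gs. F k (gs ! (k - 1)))"
    by (rule sum.reindex_bij_witness[where i = "\<lambda>k. k - 1" and j = Suc]) auto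
  finally show ?thesis .
qed

text \<open>The integer condition \<open>horner_eval a 0 ys \<le> - (s * p)\<close> is the dual
  inequality of the linear program after clearing the common denominator \<open>s\<close> of the
  multipliers and the denominators \<open>p\<close> of the zonal polynomials.\<close>

lemma valid_certificate_bound:
  assumes cert: "valid_certificate (int n, int w, V, D, s, gs)"
    and N: "finite N" "card N = n" and X: "X \<subseteq> layer N w"
    and dist: "\<And>S T. S \<in> X \<Longrightarrow> T \<in> X \<Longrightarrow> S \<noteq> T \<Longrightarrow> int (card (S - T)) \<in> set D"
  shows "int (card X) \<le> V"
proof -
  let ?J = "length gs"
  obtain ys p where ys: "clear_denoms (int w) (int n - int w) 0
      (newton_form (int n + 1) 0 (enumerate_from 1 gs) gs) = (ys, p)" by fastforce
  have c: "0 < s" "?J < w" "2 * w \<le> n" "\<And>g. g \<in> set gs \<Longrightarrow> 0 \<le> g" "sum_list gs \<le> (V - 1) * s"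
    "\<And>a. a \<in> set D \<Longrightarrow> 0 \<le> a \<and> horner_eval a 0 ys \<le> - (s * p)"
    using cert ys by (auto simp: valid_certificate_def list_all_iff)
  let ?ts = "zip [Suc 0..<Suc ?J] gs"
  have enum: "enumerate_from 1 gs = map (\<lambda>(k, t). (int k, t)) ?ts"
    using enumerate_from_eq[of 1 gs] by simp
  have h: "0 < p" "real_of_int (horner_eval (int d) 0 ys)
      = real_of_int p * (\<Sum>(k, t)\<leftarrow>?ts. real_of_int t * hahn_horner n w k d 0 ?J)" for d
    using horner_eval_correct[of 0 gs w n ?ts ys p d] ys c unfolding enum by auto
  define g where "g k = real_of_int (gs ! (k - 1)) / real_of_int s" for k
  have eval: "(\<Sum>k=1..?J. g k * hahn n w k d) = real_of_int (horner_eval (int d) 0 ys) / (real_of_int s * real_of_int p)" for d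
  proof -
    have "(\<Sum>k=1..?J. g k * hahn n w k d) = (\<Sum>k=1..?J. real_of_int (gs ! (k - 1)) * hahn_horner n w k d 0 ?J) / real_of_int s"
      unfolding sum_divide_distrib using c by (intro sum.cong refl) (simp add: g_def hahn_eq_horner)
    also have "(\<Sum>k=1..?J. real_of_int (gs ! (k - 1)) * hahn_horner n w k d 0 ?J)
        = (\<Sum>(k, t)\<leftarrow>?ts. real_of_int t * hahn_horner n w k d 0 ?J)"
      by (rule sum_list_zip_upt[symmetric])
    finally show ?thesis using h(1) c(1) by (simp add: h(2))
  qed
  have "real (card X) \<le> 1 + (\<Sum>k=1..?J. g k)"
  proof (rule linear_programming_bound[OF N X])
    show "2 * w \<le> n" "?J \<le> w" using c by auto
    show "0 \<le> g k" if "k \<in> {1..?J}" for k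
      using that c(1) c(4)[of "gs ! (k - 1)"] by (auto simp: g_def)
    fix S T assume "S \<in> X" "T \<in> X" "S \<noteq> T"
    then have "horner_eval (int (card (S - T))) 0 ys \<le> - (s * p)" using c(6) dist by blast
    then have "real_of_int (horner_eval (int (card (S - T))) 0 ys) \<le> - (real_of_int s * real_of_int p)"
      by (metis of_int_le_iff of_int_minus of_int_mult)
    then show "(\<Sum>k=1..?J. g k * hahn n w k (card (S - T))) \<le> - 1"
      unfolding eval using h(1) c(1) by (simp add: divide_le_eq)
  qed
  also have "(\<Sum>k=1..?J. g k) = real_of_int (sum_list gs) / real_of_int s"
  proof -
    have "(\<Sum>k=1..?J. g k) = (\<Sum>k=1..?J. real_of_int (gs ! (k - 1))) / real_of_int s"
      by (simp add: g_def sum_divide_distrib)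
    also have "(\<Sum>k=1..?J. real_of_int (gs ! (k - 1))) = (\<Sum>i<?J. real_of_int (gs ! i))"
      by (rule sum.reindex_bij_witness[where i = Suc and j = "\<lambda>k. k - 1"]) auto
    finally show ?thesis by (simp add: sum_list_sum_nth atLeast0LessThan)
  qed
  also have "\<dots> \<le> real_of_int (V - 1)"
    using c(1,5) by (metis of_int_le_iff of_int_mult of_int_0_less_iff pos_divide_le_eq)
  finally show ?thesis by simp
qed

section \<open>Transfer of bounds between parameters and between sets of distances\<close>

lemma family_embedding:
  assumes X: "X \<subseteq> layer {..<n} w" and "w \<le> w'" "w' - w \<le> n' - n" "n \<le> n'"
  obtains Y where "Y \<subseteq> layer {..<n'} w'" "card Y = card X"
    "\<And>S T. S \<in> Y \<Longrightarrow> T \<in> Y \<Longrightarrow> S \<noteq> T \<Longrightarrow> \<exists>S'\<in>X. \<exists>T'\<in>X. S' \<noteq> T' \<and> S - T = S' - T'"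
proof -
  define Z where "Z = {n..<n + (w' - w)}"
  have disj: "S \<inter> Z = {}" "finite S" "card S = w" if "S \<in> X" for S
  proof -
    have "S \<subseteq> {..<n}" "card S = w" using that X by (auto simp: layer_def)
    then show "S \<inter> Z = {}" "finite S" "card S = w" by (auto simp: Z_def intro: finite_subset)
  qed
  have "inj_on (\<lambda>S. S \<union> Z) X"
  proof (rule inj_onI)
    fix S T assume "S \<in> X" "T \<in> X" "S \<union> Z = T \<union> Z"
    then show "S = T" using disj(1)[of S] disj(1)[of T] by blast
  qed
  show thesis
  proof (rule that[of "(\<lambda>S. S \<union> Z) ` X"])
    show "(\<lambda>S. S \<union> Z) ` X \<subseteq> layer {..<n'} w'"
    proof safe
      fix S assume S: "S \<in> X"
      then have "card (S \<union> Z) = w'" using disj[OF S] assms by (simp add: card_Un_disjoint Z_def)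
      moreover have "S \<subseteq> {..<n}" using S X by (auto simp: layer_def)
      ultimately show "S \<union> Z \<in> layer {..<n'} w'" using assms by (auto simp: layer_def Z_def)
    qed
    show "card ((\<lambda>S. S \<union> Z) ` X) = card X" using \<open>inj_on _ X\<close> by (rule card_image)
    fix S T assume "S \<in> (\<lambda>S. S \<union> Z) ` X" "T \<in> (\<lambda>S. S \<union> Z) ` X" "S \<noteq> T"
    then obtain S' T' where "S' \<in> X" "T' \<in> X" "S = S' \<union> Z" "T = T' \<union> Z" by blast
    then show "\<exists>S'\<in>X. \<exists>T'\<in>X. S' \<noteq> T' \<and> S - T = S' - T'"
      using disj(1)[of S'] \<open>S \<noteq> T\<close> by (intro bexI[of _ S'] bexI[of _ T']) auto
  qed
qed

text \<open>The four distances are separate arguments, while a certificate allows a possibly larger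
  set \<open>D\<close>: one certificate thus serves several quadruples. Integer parameters match the
  form of the certificates.\<close>

definition family_bound :: "int \<Rightarrow> int \<Rightarrow> int \<Rightarrow> int \<Rightarrow> int \<Rightarrow> int \<Rightarrow> int \<Rightarrow> bool" where
  "family_bound n w V a b c d \<longleftrightarrow> (\<forall>X. X \<subseteq> layer {..<nat n} (nat w) \<longrightarrow>
     (\<forall>S\<in>X. \<forall>T\<in>X. S \<noteq> T \<longrightarrow> int (card (S - T)) \<in> {a, b, c, d}) \<longrightarrow> int (card X) \<le> V)"

lemma valid_certificates_bound:
  "list_all valid_certificate cs \<Longrightarrow> list_all (\<lambda>(n, w, V, D, s, gs).
     \<forall>a b c d. a \<in> set D \<and> b \<in> set D \<and> c \<in> set D \<and> d \<in> set D \<longrightarrow> family_bound n w V a b c d) cs"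
proof (erule list.pred_mono_strong, safe)
  fix n w V D s gs a b c d
  assume cert: "valid_certificate (n, w, V, D, s, gs)" and D: "a \<in> set D" "b \<in> set D" "c \<in> set D" "d \<in> set D"
  have nn: "0 \<le> n" "0 \<le> w" using cert by (auto simp: valid_certificate_def)
  show "family_bound n w V a b c d" unfolding family_bound_def
  proof (intro allI impI)
    fix X :: "nat set set"
    assume X: "X \<subseteq> layer {..<nat n} (nat w)"
      and dist: "\<forall>S\<in>X. \<forall>T\<in>X. S \<noteq> T \<longrightarrow> int (card (S - T)) \<in> {a, b, c, d}"
    show "int (card X) \<le> V"
    proof (rule valid_certificate_bound[where n = "nat n" and w = "nat w" and N = "{..<nat n}"])
      show "valid_certificate (int (nat n), int (nat w), V, D, s, gs)" using cert nn by simp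
    qed (use X dist D in auto)
  qed
qed

text \<open>Integrality of the numbers \<open>K\<^sub>i = (\<Prod>j\<noteq>i. a\<^sub>j / (a\<^sub>j - a\<^sub>i))\<close>. Here and below, conditionals replace
  conjunctions and implications because rewriting evaluates them lazily.\<close>

definition admissible :: "int \<Rightarrow> int \<Rightarrow> int \<Rightarrow> int \<Rightarrow> bool" where
  "admissible a b c d =
    (if (b - a) * (c - a) * (d - a) dvd b * c * d then
     if (a - d) * (b - d) * (c - d) dvd a * b * c then
     if (a - b) * (c - b) * (d - b) dvd a * c * d then
     (a - c) * (b - c) * (d - c) dvd a * b * d else False else False else False)"

text \<open>In the first part \<open>2 * w \<le> n \<le> 58\<close>, in the second
  \<open>w \<le> 11\<close>; in both, distances are at most \<open>w \<le> 29\<close>.\<close>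

definition distance_range :: "int list" where
  "distance_range = [1,2,3,4,5,6,7,8,9,10,11,12,13,14,15,16,17,18,19,20,21,22,23,24,25,26,27,28,29]"

text \<open>The filter \<open>b \<le> 2 * a\<close> is the condition from the clique argument.
  Quadruples come in lexicographic order, so that a table can be compared with the enumeration as a
  list.\<close>

definition admissible_quads :: "int list \<Rightarrow> (int \<times> int \<times> int \<times> int) list" where
  "admissible_quads as = concat (map (\<lambda>a. concat (map (\<lambda>b. concat (map (\<lambda>c.
     map (\<lambda>d. (a, b, c, d)) (filter (\<lambda>d. if c < d then admissible a b c d else False) distance_range))
     (filter (\<lambda>c. b < c) distance_range)))
     (filter (\<lambda>b. if a < b then b \<le> 2 * a else False) distance_range))) as)"

text \<open>A certificate for \<open>(n', w')\<close> covers \<open>(n, w)\<close> if \<open>0 \<le> w' - w \<le> n' - n\<close>. For fixed \<open>w\<close>,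
  \<open>chain t w lo bs\<close> is the end of the interval of \<open>n\<close> starting at \<open>lo\<close> on which the bounds \<open>bs\<close> give
  \<open>24 * card X \<le> t n\<close>.\<close>

fun chain :: "(int \<Rightarrow> int) \<Rightarrow> int \<Rightarrow> int \<Rightarrow> (int \<times> int \<times> int) list \<Rightarrow> int" where
  "chain t w lo [] = lo"
| "chain t w lo ((n', w', V) # bs) = chain t w
     (if w \<le> w' \<and> lo \<le> n' - w' + w \<and> 24 * V \<le> t lo then n' - w' + w + 1 else lo) bs"

text \<open>An accepted bound meets the target at the current \<open>lo\<close>, hence at every
  larger point by monotonicity of \<open>t\<close>, and it applies up to \<open>n' - w' + w\<close>;
  the search resumes just after.\<close>

lemma chain_covers:
  assumes "\<And>x y. lo \<le> x \<Longrightarrow> x \<le> y \<Longrightarrow> t x \<le> t y" "lo \<le> n" "n < chain t w lo bs"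
  shows "\<exists>(n', w', V)\<in>set bs. w \<le> w' \<and> n \<le> n' - w' + w \<and> 24 * V \<le> t n"
  using assms
proof (induction bs arbitrary: lo)
  case (Cons b bs)
  obtain n' w' V where b: "b = (n', w', V)" by (cases b)
  show ?case
  proof (cases "w \<le> w' \<and> lo \<le> n' - w' + w \<and> 24 * V \<le> t lo")
    case True
    show ?thesis
    proof (cases "n \<le> n' - w' + w")
      case le: True
      then show ?thesis using True Cons.prems(1)[of lo n] Cons.prems(2) by (auto simp: b)
    next
      case False
      have "\<exists>(n', w', V)\<in>set bs. w \<le> w' \<and> n \<le> n' - w' + w \<and> 24 * V \<le> t n"
        using True False Cons.prems by (intro Cons.IH[of "n' - w' + w + 1"]) (auto simp: b)
      then show ?thesis by auto
    qed
  next
    case False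
    then have "\<exists>(n', w', V)\<in>set bs. w \<le> w' \<and> n \<le> n' - w' + w \<and> 24 * V \<le> t n"
      using Cons.prems by (intro Cons.IH[of lo]) (auto simp: b)
    then show ?thesis by auto
  qed
qed simp

lemma chain_ge: "lo \<le> chain t w lo bs"
proof (induction bs arbitrary: lo)
  case (Cons b bs)
  obtain n' w' V where b: "b = (n', w', V)" by (cases b)
  let ?lo = "if w \<le> w' \<and> lo \<le> n' - w' + w \<and> 24 * V \<le> t lo then n' - w' + w + 1 else lo"
  have "lo \<le> ?lo" by simp
  also have "\<dots> \<le> chain t w ?lo bs" by (rule Cons.IH)
  finally show ?case by (simp add: b)
qed simp

section \<open>Finite checks for the two parts of the theorem\<close>

definition small_sum :: "int \<Rightarrow> int \<Rightarrow> int \<Rightarrow> bool" where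
  "small_sum e n w \<longleftrightarrow> (e - 6) * (n - 6) \<le> 4 * (w - 3) * (n - w - 3)"

text \<open>If \<open>e - 6 \<le> 4 * (w - 3)\<close>, the right side grows at least as fast in
  \<open>n\<close> as the left. Otherwise the inequality already fails at \<open>m\<close>, because
  \<open>m - w - 3 \<le> m - 6\<close>. So certificates are needed only up to the first
  \<open>n\<close> that satisfies it.\<close>

lemma small_sum_mono:
  assumes "small_sum e m w" "m \<le> n" "3 \<le> w" "6 < m"
  shows "small_sum e n w"
proof (cases "e - 6 \<le> 4 * (w - 3)")
  case True
  then have "(e - 6) * (n - m) \<le> 4 * (w - 3) * (n - m)" using assms by (intro mult_right_mono) auto
  then show ?thesis using assms(1) by (simp add: small_sum_def algebra_simps)
next
  case False
  have "4 * (w - 3) * (m - w - 3) \<le> 4 * (w - 3) * (m - 6)" using assms by (intro mult_left_mono) auto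
  also have "\<dots> < (e - 6) * (m - 6)" using False assms by (intro mult_strict_right_mono) auto
  finally show ?thesis using assms(1) by (simp add: small_sum_def)
qed

text \<open>Twenty-four times the bound of the first part, and below likewise for
  \<open>(n - w + 4) choose 4\<close>; without fractions both are integer polynomials that rewriting
  evaluates directly.\<close>

definition quartic_1 :: "int \<Rightarrow> int" where
  "quartic_1 n = n * (n - 1) * ((n - 2) * (n - 7) + 12)"

definition quartic_2 :: "int \<Rightarrow> int \<Rightarrow> int" where
  "quartic_2 w n = (n - w + 4) * (n - w + 3) * (n - w + 2) * (n - w + 1)"

type_synonym quad_entry = "(int \<times> int \<times> int \<times> int) \<times> (int \<times> int \<times> int) list"

definition entry_bounds :: "quad_entry \<Rightarrow> bool" where
  "entry_bounds = (\<lambda>((a, b, c, d), bs). list_all (\<lambda>(n, w, V). family_bound n w V a b c d) bs)"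

text \<open>\<open>m\<close> is the first \<open>n\<close> not covered by certificates. Beyond 58
  nothing is left to show; otherwise the harmonic bound must apply from \<open>m\<close> on.\<close>

definition reaches :: "int \<Rightarrow> int \<Rightarrow> int \<Rightarrow> bool" where
  "reaches e w m = (if 58 < m then True else small_sum e m w)"

definition quad_check_1 :: "quad_entry \<Rightarrow> bool" where
  "quad_check_1 = (\<lambda>((a, b, c, d), bs). list_all (\<lambda>w. if d \<le> w then
     reaches (a + b + c + d) w (chain quartic_1 w (max 14 (2 * w)) bs) else True)
     [5,6,7,8,9,10,11,12,13,14,15,16,17,18,19,20,21,22,23,24,25,26,27,28,29])"

text \<open>The cases of the second part sorted by \<open>w\<close>. The lower ends for
  \<open>w = 7, 8, 9, 10\<close> are the Erdos-Ko-Rado thresholds \<open>5 * (w - 3)\<close> for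
  sets sharing at least \<open>w - 4\<close> points.\<close>

definition regions :: "(int \<times> int \<times> int) list" where
  "regions = [(5,15,70), (6,17,70), (7,20,70), (8,25,70), (9,30,70), (10,35,40), (10,48,70), (11,60,70)]"

fun region_check :: "int \<Rightarrow> (int \<times> int \<times> int) list \<Rightarrow> int \<times> int \<times> int \<Rightarrow> bool" where
  "region_check d bs (w, lo, hi) = (if d \<le> w then hi < chain (quartic_2 w) w lo bs else True)"

text \<open>\<open>d \<le> 4\<close> leaves only \<open>1, 2, 3, 4\<close>, which is left to
  Wilson's matrix, and \<open>11 < d\<close> contradicts \<open>d \<le> w\<close>. That quadruple
  carries no bounds at all: in the first part, \<open>small_sum\<close> holds for it from the start
  of the chain.\<close>

definition quad_check_2 :: "quad_entry \<Rightarrow> bool" where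
  "quad_check_2 = (\<lambda>((a, b, c, d), bs). if d \<le> 4 then True else if 11 < d then True else
     list_all (region_check d bs) regions)"

text \<open>The certificates are rounded optimal solutions of Delsarte's linear programs, chosen greedily so
  that few pairs \<open>(n, w)\<close> and few sets of distances cover all cases.\<close>

lemma certificates_1: "list_all valid_certificate [
   (17,6,728,[2,3,4,5],1,[0,47,47,205,124]),
   (19,8,728,[2,4,5,6,7,8],30,[205,464,242,0,2789,8692,9236]),
   (20,9,728,[2,3,4,6,7],10,[6,0,0,1641,900,0,4610]),
   (20,9,728,[3,4,5,6,8],1,[0,37,89,77,373,0,0,151]),
   (21,10,1836,[3,5,6,8,9],1,[13,0,64,159,237,1065]), (22,7,728,[2,4,5,6],3,[19,79,0,0,357,1706]),
   (22,7,1380,[2,3,4,5],1,[0,0,172,21,716,378]), (22,11,1380,[3,5,7,8],1,[0,0,0,125,0,293,712]),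
   (22,11,6006,[4,6,7,8],3,[55,352,734,1151]), (25,9,1820,[2,4,6,8],1,[0,0,0,43,195,373,0,968]),
   (25,9,1836,[4,5,6,7,8,9],3,[55,234,1082,1428,2617]),
   (25,10,3060,[4,5,6,7,8,9,10],3,[44,235,889,1474,2211,0,0,0,2635]),
   (27,8,1380,[3,4,5,6,8],10,[0,79,2382,0,11234]),
   (27,13,6006,[3,5,7,8],1,[0,0,0,0,1784,182,0,2944]),
   (27,13,8878,[3,4,5,6,8,9,10],1,[0,0,23,407,0,1589,627,3663,0,0,2349])]"
  by code_simp

lemma certificates_2: "list_all valid_certificate [
   (28,8,1380,[2,3,4,6,8],30,[0,0,11,1194,12150,0,27829]),
   (28,13,7337,[4,6,7,8,12],1,[0,48,0,143,1374,0,5301]),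
   (28,13,17577,[4,6,8,10],3,[4,82,352,11950]), (29,8,4845,[2,3,4,5],1,[0,0,0,502,19,2367,1855]),
   (29,11,4845,[3,4,5,6,8,9],1,[0,0,0,463,186,538,3168]),
   (29,12,3895,[5,6,7,8,9,10,12],3,[70,453,1841,3104,4286]),
   (29,12,5985,[4,5,6,8,10],3,[5,22,231,1103,1183,0,0,0,0,0,14099]),
   (30,8,3876,[2,4,5,6,8],1,[0,33,130,0,73,0,3459]),
   (30,9,12650,[2,3,4,5],1,[0,0,0,128,851,0,4031,1973]),
   (30,9,12650,[2,4,5,6],1,[0,9,124,0,0,0,322,3373]),
   (30,14,6006,[3,4,6,7,9,10,12],3,[8,0,67,0,34,0,10926,6275]),
   (31,8,1365,[3,4,6,7,8],3,[16,0,0,895,2747]),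
   (32,9,4865,[4,5,6,7,8],1,[0,101,168,1176,1342,2047]),
   (32,10,6006,[3,4,5,6,8],1,[0,0,2,560,0,1858,2945]),
   (34,9,3895,[3,5,7,8],3,[17,0,0,278,355,0,10912])]"
  by code_simp

lemma certificates_3: "list_all valid_certificate [
   (34,13,4865,[6,7,8,9,10,11,12,13],3,[65,428,1830,3301,4873]),
   (34,14,4845,[4,5,8,9,10,11,12],1,[12,9,0,0,805,2312,1631]),
   (34,14,17577,[4,6,8,12],1,[0,0,0,0,6479,5930,1518]),
   (34,15,40953,[5,7,10,12],3,[1,0,795,1926,6912]),
   (34,16,17577,[5,7,8,10,12],1,[8,0,21,780,0,1689,11907]),
   (35,14,10650,[5,6,7,8,9,12],1,[0,0,795,11,5371,2378]),
   (35,15,14976,[6,7,8,9,10,11,12,13,14,15],1,[30,238,1101,2903,4822,3450]),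
   (35,16,14976,[4,5,8,9,10,11,12],10,[117,257,0,0,7653,12641,73582]),
   (35,17,12675,[5,6,8,9,10,14,15],1,[0,116,289,0,4280,7039]),
   (36,9,14950,[2,3,4,5],1,[0,0,0,1,1116,0,5722,5541]),
   (36,10,12650,[3,5,7,8,9],10,[85,107,0,0,3835,0,9120,112565]),
   (37,10,12650,[3,4,6,7,8],1,[0,41,0,0,857,3103,6714]),
   (37,10,23751,[2,3,4,5],1,[0,0,0,0,227,1859,0,9522,6756]),
   (37,14,3895,[5,6,7,10,12],1,[1,0,0,1079,464,2347]),
   (38,9,8855,[2,3,4,6,8],1,[3,0,0,0,0,2116,180,5699])]"
  by code_simp

lemma certificates_4: "list_all valid_certificate [
   (38,10,10650,[3,4,5,6,8,10],1,[0,0,0,249,1265,0,7885,612]),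
   (38,11,14976,[5,6,7,8,9,10],1,[0,142,188,2268,2064,6655]),
   (38,11,20503,[2,3,4,6,8,10],1,[0,3,0,0,0,608,0,7275,0,12600]),
   (38,13,14976,[3,4,6,7,9,10,12],3,[0,11,0,64,1573,0,0,40581]),
   (39,15,27435,[4,5,8,9,10,11,12],10,[143,736,0,0,0,31004,116127,115983]),
   (40,10,14950,[2,4,5,6],1,[0,0,0,378,0,161,507,0,12793]),
   (40,10,14976,[3,4,6,7,8],1,[0,49,0,0,560,3758,9210]),
   (40,13,58941,[4,5,7,8,9,10,12],3,[0,121,707,0,11475,18304,54876,87450]),
   (40,19,27435,[6,7,8,9,12,13,14,15,16],3,[8,0,832,2323,7737,8021,39561]),
   (41,11,6006,[4,5,8,9,10],1,[10,0,0,0,1541,2035]),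
   (41,18,17550,[5,6,9,10,12,14,15,16],1,[14,0,127,0,216,3137,13678]),
   (41,19,31496,[6,7,8,10,11,12,15,16,18],1,[0,95,761,0,21636,6477]),
   (42,10,10650,[5,6,7,8,9],1,[0,128,302,2055,3105,4742]),
   (42,10,31465,[3,5,7,8,9],3,[19,145,0,576,463,0,0,75507]),
   (42,10,35960,[2,3,4,6,8,9,10],3,[23,0,0,98,0,52,25504,0,64954])]"
  by code_simp

lemma certificates_5: "list_all valid_certificate [
   (42,14,31496,[6,7,8,9,10,11,12],1,[0,250,463,5362,5020,18314]),
   (42,16,31496,[7,8,9,10,11,12,13,14,15,16],3,[118,1021,5699,17199,35447,33917]),
   (42,18,17577,[7,8,9,10,11,12,15],1,[0,244,950,2102,11251]),
   (43,10,12650,[4,5,6,7,9,10],3,[0,0,602,2345,5053,20112,9591]),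
   (43,16,12650,[6,9,10,12],10,[62,255,0,0,0,27644,97384]),
   (43,16,40953,[4,8,12,16],1,[0,0,0,0,0,0,7558,16623]),
   (43,17,31496,[4,8,9,12,14,15,16],10,[18,0,871,0,0,0,0,235808,54008]),
   (44,10,31496,[2,3,4,5],3,[0,0,0,0,0,6893,561,39448,47514]),
   (44,22,52395,[4,8,9,12,15,16,18],1,[0,0,29,0,154,0,0,0,45100,909]),
   (45,16,23751,[6,7,8,10,11],1,[0,0,515,0,10976,7943]),
   (45,19,135795,[7,10,12,15],3,[2,202,0,0,1071,25545]),
   (45,20,40953,[6,7,10,11,12,14,15,16,18],10,[133,700,1356,0,20573,136369,224245]),
   (45,22,73853,[6,9,12,15,18],10,[68,0,0,2847,9557,0,62090,158593,504799]),
   (46,19,27405,[6,7,8,12,14,15,16,18],10,[55,0,0,3798,30684,105088,128442]),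
   (46,19,66082,[5,6,9,12,14,18],3,[21,0,0,1028,2644,0,17175,80011,97254])]"
  by code_simp

lemma certificates_6: "list_all valid_certificate [
   (46,22,66082,[5,9,10,12,15,20],1,[2,34,247,0,0,0,0,0,62731]),
   (47,17,40953,[6,7,8,10,16],1,[0,0,336,473,5944,29604]),
   (47,18,20475,[8,9,10,11,12,13,14],1,[0,207,70,4088,868,14355]),
   (47,21,91430,[6,9,12,15,18],1,[5,0,48,0,1311,0,6888,0,77826]),
   (47,23,101311,[6,7,10,12,14,15,16,18],3,[48,302,1063,0,0,29475,200101,58642]),
   (48,10,46376,[3,5,7,8,9],3,[0,233,0,1674,332,334,0,132244]),
   (48,10,111930,[2,4,5,6,8],1,[0,0,0,235,1594,0,4910,0,56431]),
   (48,18,52395,[6,9,12,15,18],1,[0,0,0,0,661,298,0,11375,38526]),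
   (49,16,73853,[7,8,10,12,14,15],3,[57,827,3133,14891,50294,123596]),
   (49,17,46376,[6,9,12,15],3,[25,0,0,1414,0,0,16439,111553]),
   (50,10,35960,[3,4,5,6,8,10],3,[1,0,0,0,6958,681,49194,41359]),
   (50,11,82251,[2,3,4,5],1,[0,0,0,0,0,28,4225,0,24373,30028]),
   (50,24,66082,[8,9,10,11,12,13,16,18,20,21,22],1,[0,0,1233,705,9872,25038,14827]),
   (51,12,17550,[4,5,7,8,10,12],3,[2,2,134,486,0,0,45322]),
   (51,12,52395,[5,6,7,8,10,11,12],3,[8,0,711,4935,13901,37511,92284])]"
  by code_simp

lemma certificates_7: "list_all valid_certificate [
   (51,22,135795,[5,10,15,20],1,[0,0,49,465,0,0,527,0,0,112267]),
   (51,24,73853,[7,8,9,12,14,15,16],1,[14,17,0,0,6333,15267,46965]),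
   (51,24,135795,[6,10,12,16,18],3,[0,0,944,0,0,0,65891,132035,207023]),
   (51,24,135795,[5,10,15,20],10,[25,0,0,5410,0,0,0,0,0,1180320]),
   (52,9,20503,[3,4,6,7,8],1,[0,111,0,0,284,16598]),
   (52,12,35992,[4,5,8,9,10],1,[0,84,0,0,0,5492,19885,6324]),
   (52,12,249951,[6,8,10,11],1,[0,26,336,4577]),
   (52,22,66082,[8,9,10,12,14,20],1,[0,50,1136,0,18908,29549]),
   (52,24,135795,[8,9,12,13,14,15,16,18,20,24],1,[20,24,0,0,6119,24136,65356,28811]),
   (53,13,91430,[6,7,8,9,10,12],1,[0,0,2072,2887,22556,35005]),
   (53,21,73853,[7,8,9,12,14,15,16,18,20],3,[61,1,0,0,18267,74074,125328]),
   (53,21,178412,[5,10,15,20],10,[41,0,0,4854,0,0,0,0,515753,1063590]),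
   (53,23,40953,[10,11,12,13,14,15,16,17,18,20,21,22],10,[391,4048,23004,69963,135342,111007]),
   (53,25,82290,[10,11,12,13,14,15,16,17,18,24],1,[56,573,3616,10784,23613,18990]),
   (54,9,40953,[2,4,5,6,8],1,[0,0,3,749,0,2161,0,33308])]"
  by code_simp

lemma certificates_8: "list_all valid_certificate [
   (54,18,82251,[6,10,11,12,16],1,[0,79,106,0,0,5730,0,72458]),
   (54,20,135795,[5,10,15,20],1000,[2311,0,0,465372,0,0,0,0,51789411,83451800]),
   (54,22,82290,[6,10,14,16,18],3,[17,0,0,1165,912,0,0,0,240490]),
   (54,25,163231,[6,12,15,18,24],1,[0,20,123,0,0,0,0,64409,93245]),
   (54,27,292878,[6,12,18,24],1,[0,0,347,0,0,0,0,0,144023]),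
   (55,10,58941,[2,3,4,6],1,[0,0,0,0,0,0,7875,5131,38396]),
   (55,10,82251,[3,5,7,8,9],1,[0,82,0,511,957,3982,0,74492]),
   (55,23,211925,[8,9,10,12,15,18,20],1,[0,0,254,1798,5198,19183,28956,120581]),
   (55,23,230350,[6,12,15,18],1,[0,0,62,0,0,0,0,105183,53055]),
   (56,10,111930,[2,3,4,5],1,[0,0,0,0,0,2710,4042,29699,65939]),
   (56,12,27435,[7,8,9,10,11,12],1,[39,482,2856,8616,10964]),
   (56,18,101270,[7,10,11,12,14,15],1,[0,116,417,428,0,0,96055]),
   (56,21,58905,[8,9,10,11,12,15,16,20],1,[0,0,0,2390,1097,5675,48407]),
   (56,26,194628,[9,12,15,18],1,[0,0,0,8707,10831,44217,0,124755]),
   (57,10,123410,[2,4,5,6,8],1,[0,0,0,187,2763,0,4395,0,98024])]"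
  by code_simp

lemma certificates_9: "list_all valid_certificate [
   (57,10,249900,[2,3,4,5],1,[0,0,0,0,0,2634,4230,30343,69575]),
   (57,26,249951,[6,12,18,24],1,[0,0,280,0,0,0,0,0,76160,168907]),
   (58,18,249951,[6,12,15,18],3,[0,104,0,0,0,0,747863]),
   (58,20,194628,[6,7,11,12,14,15,18,19],3,[0,254,68,0,0,0,16201,299617,0,255431]),
   (58,23,73853,[8,10,13,14,15,18,20],3,[23,119,8,0,17512,68569,129729]),
   (58,23,211925,[8,9,12,13,14,15,20,21],1,[0,144,0,0,7734,0,97302,72691]),
   (58,24,40953,[8,13,14,18,20,21],1,[0,0,98,0,1332,10701,22859,1589]),
   (58,24,101311,[8,9,10,12,13,16,18,21,24],1,[0,0,0,1364,4161,635,87234]),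
   (58,24,395067,[6,12,18,24],1,[0,0,124,0,0,0,0,0,329809]),
   (58,25,270777,[6,12,18,24],1,[0,0,333,0,0,0,0,0,0,92421,168802]),
   (58,26,12650,[11,13,15,16],1,[0,248,0,4583,2457]),
   (58,26,135795,[9,12,15,24],1,[0,0,0,748,11628,0,15446,87780]),
   (58,26,395067,[6,12,18,24],3,[0,0,749,0,0,0,0,0,319669,776230]),
   (58,27,316305,[6,12,18,24],1,[0,0,366,0,0,0,0,0,0,45901,256192]),
   (58,28,211925,[9,10,11,12,15,16,17,20,24],1,[0,0,0,130,12050,0,5234,95011])]"
  by code_simp

lemma certificates_10: "list_all valid_certificate [
   (58,28,292878,[7,14,21,28],1,[0,156,115,0,0,0,0,120870,133048]),
   (58,28,395067,[6,12,18,24],1,[0,0,386,0,0,0,0,0,0,62447,258611]),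
   (58,29,149040,[8,10,14,15,16,18,20],1,[19,0,0,0,0,29430,11755,83133]),
   (58,29,230350,[10,11,12,13,14,15,16,17,18],1,[0,362,616,10216,20717,54396,121031]),
   (58,29,341110,[6,12,18,24],1,[0,0,390,0,0,0,0,0,0,68893,257048]),
   (58,29,395067,[7,14,21,28],1,[0,154,108,0,0,0,0,120641,133704]),
   (59,15,23751,[8,9,10,12,13,14],3,[98,1139,5127,57886]),
   (59,15,66045,[7,8,9,10,11,14,15],1,[0,0,880,2927,10421,34273]),
   (59,20,46376,[8,9,10,13,14,15,16,17,18],1,[15,0,0,1335,8458,29606,5383]),
   (59,25,135795,[9,10,11,12,15,20,24],1,[0,0,0,605,12303,0,16977,91620]),
   (59,26,211925,[8,9,10,14,15,16,18,20,21,24],3,[99,0,0,0,8801,90190,265585,256417]),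
   (59,28,211925,[8,12,16,18,20,24],100,[614,0,11826,36408,275093,0,2467213,10725378,7639413]),
   (60,11,111930,[3,4,6,7,8],1,[0,0,300,153,0,0,12738,82625]),
   (60,17,123453,[8,9,10,11,12,14,15],1,[0,229,591,11564,8428,87741]),
   (60,18,1380,[9,10,14,16],10,[31,0,249,13402])]"
  by code_simp

lemma certificates_11: "list_all valid_certificate [
   (60,20,211925,[6,10,14,16,18],3,[23,0,207,1088,2529,0,0,0,526445]),
   (60,22,194628,[7,9,12,15,16,18,20],100,[405,0,4983,6788,0,1485752,373060,17529984]),
   (60,23,111972,[9,10,12,16,18,20,21],1,[4,0,349,1449,8445,1678,89504]),
   (60,29,230350,[8,9,12,13,18,20,21],1,[2,0,152,544,0,3717,0,128345]),
   (61,15,91430,[5,6,8,9,12,14,15],1,[0,0,0,48,1747,956,0,77543]),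
   (61,15,91430,[6,7,9,10,12,13],3,[0,73,0,2712,16228,0,227406]),
   (61,15,194580,[6,7,10,11,12,13,14,15],3,[110,507,531,0,14915,128141,321053]),
   (61,16,135795,[6,10,12,14,16],10,[140,2679,0,0,346,0,1125913]),
   (61,18,194628,[7,8,9,12,13,14,15,16,17,18],3,[47,18,0,0,30766,90555,250197]),
   (61,19,82251,[10,11,12,13,14,15,16,17,18,19],1,[36,358,2383,8653,21130,25970]),
   (61,19,395067,[6,9,12,15,18],1,[0,0,0,0,0,365,20407,0,0,224606]),
   (61,20,230350,[9,10,12,13,14,15,16,20],1,[0,250,577,6414,20153,49196,118041]),
   (61,21,73853,[10,11,12,13,14,15,16,17],1,[0,313,277,8983,4907,48015]),
   (61,22,111930,[8,10,14,15,16,18,20],100,[2419,0,0,0,594367,3344734,7229275]),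
   (61,22,194628,[8,12,13,14,16,17,18,20,21],3,[58,382,1648,259,0,0,472844])]"
  by code_simp

lemma certificates_12: "list_all valid_certificate [
   (61,23,211925,[10,12,13,14,15,16,17,18],1,[0,454,462,14950,14712,94732,75756]),
   (61,24,211925,[11,12,13,14,15,16,18,19,20,21],1,[105,1125,8760,29121,76078,79722]),
   (61,28,211925,[8,12,13,14,18,20,21],1,[1,0,384,505,0,2671,0,207730]),
   (61,29,211925,[9,10,11,14,15,16,18,20,21,22,24,27],3,[58,69,584,0,26930,131688,405081]),
   (61,29,395067,[8,9,12,15,16,20,24],3,[0,79,0,0,4644,41952,21791,0,1059760]),
   (62,17,211876,[8,9,10,12,13],1,[0,28,1408,0,29399,8799,111130]),
   (62,24,66082,[9,10,14,15,16,17,18,19,20,21,22,23,24],3,[47,125,114,0,10200,47714,117161]),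
   (62,27,211925,[9,10,12,13,16,18,21],1,[1,0,0,136,8162,0,2360,167110]),
   (62,27,211925,[8,12,16,18,20,24],10,[84,0,0,6196,5682,0,0,0,2034341]),
   (62,28,58941,[12,13,14,15,16,17,18,19,20,21,22,24],100,[4538,42610,310266,924663,2438649,2134328]),
   (63,11,148995,[3,4,5,6,8],1,[0,0,0,0,0,6120,990,51739,56934]),
   (63,11,292825,[2,4,6,8],3,[0,0,565,0,957,0,0,134885,0,737334]),
   (63,12,249951,[2,3,4,5],1,[0,0,0,0,0,0,0,7636,3564,57724,101440]),
   (63,27,211925,[10,11,12,15,16,17,18,20,21,22],3,[53,210,2023,13585,72301,189507,346784]),
   (64,12,27405,[5,6,8,9,11,12],1,[0,0,242,241,0,21760,3772])]"
  by code_simp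

lemma certificates_13: "list_all valid_certificate [
   (64,18,194628,[8,9,10,11,12,16,18],1,[0,0,441,2940,8730,32532,71246]),
   (64,29,211925,[12,13,14,15,16,17,18,19,20,21,22,23,24,25,26,27,28,29],3,[107,1318,9228,39386,110590,190864,191771]),
   (64,29,211925,[10,11,12,13,14,15,18,20,24,25,28],1,[0,0,108,4399,3457,16489,137615]),
   (66,11,395010,[2,4,6,8],1,[0,0,0,0,592,9337,0,12314,0,327634]),
   (68,11,73815,[4,5,6,7,9],1,[0,0,0,0,3523,1019,34388,29003]),
   (69,10,135795,[4,5,7,8,9,10],1,[21,146,272,0,15359,99337]),
   (69,10,230300,[2,4,6,8],3,[0,19,0,0,10449,0,42276,0,626823]),
   (69,11,211925,[2,3,4,6],1,[0,0,0,0,0,0,0,24166,27270,159949]),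
   (70,6,814385,[2,4,5,6],1,[33,410,1916,0,51188]), (70,6,814385,[2,3,4,6],1,[8,0,947,8814,57166]),
   (70,8,720720,[4,6,7,8],1,[22,155,229,0,16527]),
   (70,10,230300,[3,5,7,8,9],1,[0,97,20,0,695,16925,0,151747]),
   (70,11,230300,[4,5,7,8,9,10],1,[0,134,198,907,0,28438,135106]),
   (70,11,316251,[3,4,6,7,8],1,[0,0,249,662,0,0,14656,159704,72446]),
   (71,6,766480,[2,3,4,5],1,[0,175,2642,29259,189506])]"
  by code_simp

lemma certificates_14: "list_all valid_certificate [
   (71,7,720720,[3,4,5,6],1,[49,1091,14364,116322,494368]),
   (71,8,595665,[2,3,4,6,7],1,[0,77,0,0,12298,61800,296019]),
   (71,8,677040,[2,3,4,5],1,[0,0,0,914,6176,47118,209098]),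
   (71,8,720720,[2,4,5,6,7],1,[0,161,1288,7848,18892,0,476133]),
   (71,9,249900,[2,4,5,6,8],1,[0,0,0,1933,1553,11906,0,213095]),
   (71,9,595665,[3,5,6,7,8],1,[0,155,860,4028,3803,0,237258]),
   (71,9,677040,[3,4,5,6,8,9],10,[137,0,0,57774,259041,1612361,4549577]),
   (71,9,677040,[2,3,4,5],1,[0,0,0,0,1706,7972,55122,207832]),
   (71,9,677040,[2,3,4,6],1,[0,0,72,0,0,9696,37033,159099]),
   (71,10,91390,[4,5,6,7],1,[0,0,0,1577,3352,25558,44123]),
   (71,10,101270,[4,6,7,9,10],1,[7,0,174,1677,0,18041,66637]),
   (71,10,123410,[3,4,6,7,8,10],1,[0,17,434,0,0,0,77877,38432]),
   (71,10,249900,[4,5,7,8,9,10],1,[21,146,253,0,19256,125664]),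
   (71,10,635376,[5,6,7,8,9],1,[0,216,1630,12223,48527,99193]),
   (71,11,23751,[6,7,8,9,11],1,[0,0,1156,306,16095])]"
  by code_simp

lemma certificates_15: "list_all valid_certificate [
   (71,11,82290,[5,6,8,9,10,11],3,[53,288,124,0,41461,202651]),
   (71,11,123410,[4,5,6,8,10],1,[8,0,0,2,0,19852,0,93503]),
   (71,11,211876,[2,4,5,6],1,[0,0,0,0,300,3309,0,12460,0,181760]),
   (71,11,211876,[4,6,9,10],1,[17,55,0,0,3583,0,0,190277]),
   (71,11,249900,[3,5,7,8],1,[0,0,222,0,0,3987,16276,0,210205]),
   (71,11,292825,[3,5,8,9],1,[0,87,4,0,0,8542,0,0,208827]),
   (71,11,292825,[4,5,6,7,9],1,[0,0,0,0,3668,2047,39234,40536]),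
   (71,11,292825,[3,4,5,6,8],1,[0,0,0,0,0,9293,6873,103164,160849]),
   (71,11,316251,[2,3,4,6],1,[0,0,0,0,0,0,0,26657,34067,191224]),
   (71,11,341110,[2,3,4,5],1,[0,0,0,0,0,0,5043,10369,74001,202415]),
   (71,11,487635,[2,4,6,8],1,[0,0,0,0,87,10020,0,16321,0,382880]),
   (71,12,82290,[5,6,7,8,10,12],1,[0,0,21,191,5932,0,54789])]"
  by code_simp

text \<open>Conditional rewrite rules: an entry of a table selects its rule by \<open>n\<close>,
  \<open>w\<close> and \<open>V\<close>, and the conditions are memberships of the four distances in
  the set of the certificate.\<close>

lemmas family_bounds = certificates_1[THEN valid_certificates_bound, unfolded list.pred_inject, simplified]
  certificates_2[THEN valid_certificates_bound, unfolded list.pred_inject, simplified]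
  certificates_3[THEN valid_certificates_bound, unfolded list.pred_inject, simplified]
  certificates_4[THEN valid_certificates_bound, unfolded list.pred_inject, simplified]
  certificates_5[THEN valid_certificates_bound, unfolded list.pred_inject, simplified]
  certificates_6[THEN valid_certificates_bound, unfolded list.pred_inject, simplified]
  certificates_7[THEN valid_certificates_bound, unfolded list.pred_inject, simplified]
  certificates_8[THEN valid_certificates_bound, unfolded list.pred_inject, simplified]
  certificates_9[THEN valid_certificates_bound, unfolded list.pred_inject, simplified]
  certificates_10[THEN valid_certificates_bound, unfolded list.pred_inject, simplified]
  certificates_11[THEN valid_certificates_bound, unfolded list.pred_inject, simplified]
  certificates_12[THEN valid_certificates_bound, unfolded list.pred_inject, simplified]
  certificates_13[THEN valid_certificates_bound, unfolded list.pred_inject, simplified]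
  certificates_14[THEN valid_certificates_bound, unfolded list.pred_inject, simplified]
  certificates_15[THEN valid_certificates_bound, unfolded list.pred_inject, simplified]

text \<open>Each quadruple of distances is listed with the triples \<open>(n, w, V)\<close> of the certificates used for it,
  ordered by \<open>n - w\<close> as required by \<open>chain\<close>.\<close>

definition quad_data_1 :: "quad_entry list" where
  "quad_data_1 = [
   ((1,2,3,4),[]),
   ((2,3,4,5),[(17,6,728),(22,7,1380),(29,8,4845),(30,9,12650),(36,9,14950),(37,10,23751),(44,10,31496),(50,11,82251),(56,10,111930),(57,10,249900),(63,12,249951),(71,11,341110),(71,9,677040),(71,8,677040),(71,6,766480)]),
   ((2,3,4,6),[(20,9,728),(28,8,1380),(38,11,20503),(38,9,8855),(42,10,35960),(55,10,58941),(69,11,211925),(71,11,316251),(71,9,677040),(71,8,595665),(70,6,814385)]),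
   ((2,4,5,6),[(19,8,728),(22,7,728),(30,9,12650),(30,8,3876),(40,10,14950),(48,10,111930),(54,9,40953),(57,10,123410),(71,11,211876),(71,9,249900),(71,8,720720),(70,6,814385)]),
   ((2,4,6,8),[(25,9,1820),(28,8,1380),(38,11,20503),(38,9,8855),(42,10,35960),(48,10,111930),(54,9,40953),(57,10,123410),(63,11,292825),(66,11,395010),(69,10,230300),(71,11,487635),(71,9,249900)]),
   ((3,4,5,6),[(20,9,728),(27,8,1380),(32,10,6006),(38,10,10650),(50,10,35960),(63,11,148995),(71,11,292825),(71,9,677040),(71,7,720720)]),
   ((3,4,5,8),[(20,9,728),(27,8,1380),(32,10,6006),(38,10,10650),(50,10,35960),(63,11,148995),(71,11,292825),(71,9,677040)]),
   ((3,4,6,7),[(20,9,728),(31,8,1365),(37,10,12650),(40,10,14976),(52,9,20503),(60,11,111930),(70,11,316251),(71,10,123410),(71,8,595665)]),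
   ((3,5,6,8),[(21,10,1836),(29,11,4845),(27,8,1380),(32,10,6006),(38,10,10650),(50,10,35960),(63,11,148995),(71,11,292825),(71,9,677040)]),
   ((3,5,7,8),[(22,11,1380),(27,13,6006),(34,9,3895),(36,10,12650),(42,10,31465),(48,10,46376),(55,10,82251),(70,10,230300),(71,11,249900),(71,9,595665)]),
   ((3,5,8,9),[(21,10,1836),(27,13,8878),(29,11,4845),(36,10,12650),(42,10,31465),(48,10,46376),(55,10,82251),(70,10,230300),(71,11,292825),(71,9,677040)]),
   ((3,6,9,12),[(30,14,6006),(38,13,14976)]),
   ((4,5,6,7),[(19,8,728),(25,10,3060),(25,9,1836),(32,9,4865),(43,10,12650),(68,11,73815),(71,11,292825),(71,10,91390),(71,8,720720)]),
   ((4,5,6,8),[(20,9,728),(25,10,3060),(29,11,4845),(30,8,3876),(38,10,10650),(50,10,35960),(71,11,123410),(71,9,249900)]),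
   ((4,5,6,9),[(25,10,3060),(25,9,1836),(29,11,4845),(43,10,12650),(68,11,73815),(71,11,292825),(71,9,677040)]),
   ((4,5,6,10),[(25,10,3060),(29,12,5985),(43,10,12650),(50,10,35960),(71,11,123410)]),
   ((4,5,8,9),[(25,10,3060),(25,9,1836),(34,14,4845),(41,11,6006),(52,12,35992),(69,10,135795),(70,11,230300),(71,10,249900)]),
   ((4,5,9,10),[(25,10,3060),(34,14,4845),(43,10,12650),(52,12,35992),(69,10,135795),(70,11,230300),(71,10,249900)]),
   ((4,6,7,8),[(22,11,6006),(25,10,3060),(28,13,7337),(25,9,1836),(31,8,1365),(37,10,12650),(40,10,14976),(52,9,20503),(60,11,111930),(70,11,316251),(71,10,123410),(70,8,720720)]),
   ((4,6,8,10),[(27,13,8878),(25,10,3060),(28,13,17577),(29,12,5985),(38,11,20503),(38,10,10650),(50,10,35960),(71,11,123410)]),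
   ((4,6,8,12),[(28,13,7337),(34,14,17577)]),
   ((4,6,9,10),[(25,10,3060),(30,14,6006),(38,13,14976),(43,10,12650),(71,11,211876),(71,10,101270)]),
   ((4,7,9,10),[(25,10,3060),(30,14,6006),(38,13,14976),(40,13,58941),(43,10,12650),(70,11,230300),(71,10,101270)]),
   ((4,8,9,10),[(25,10,3060),(35,16,14976),(34,14,4845),(41,11,6006),(52,12,35992),(69,10,135795),(70,11,230300),(71,10,249900)]),
   ((4,8,10,12),[(35,16,14976),(34,14,4845),(39,15,27435),(40,13,58941),(51,12,17550)]),
   ((4,8,12,16),[(44,22,52395),(43,17,31496),(43,16,40953)]),
   ((5,6,7,8),[(19,8,728),(25,9,1836),(29,12,3895),(32,9,4865),(42,10,10650),(51,12,52395),(71,12,82290),(71,10,635376),(71,9,595665)]),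
   ((5,6,7,12),[(37,14,3895)]),
   ((5,6,8,9),[(25,9,1836),(29,12,3895),(35,14,10650),(42,10,10650),(64,12,27405),(71,11,82290),(71,9,677040)]),
   ((5,6,8,10),[(29,12,3895),(35,17,12675),(38,11,14976),(50,10,35960),(71,11,123410)]),
   ((5,7,8,9),[(25,9,1836),(29,12,3895),(35,14,10650),(38,11,14976),(42,10,10650),(48,10,46376),(55,10,82251),(70,11,230300),(71,10,635376)]),
   ((5,7,8,12),[(29,12,3895),(34,16,17577),(35,14,10650),(51,12,17550)]),
   ((5,7,10,12),[(34,16,17577),(34,15,40953),(37,14,3895),(40,13,58941),(51,12,52395)]),
   ((5,8,9,10),[(29,12,3895),(35,17,12675),(39,15,27435),(41,11,6006),(52,12,35992),(71,11,82290)]),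
   ((5,8,9,11),[(35,16,14976),(34,14,4845),(39,15,27435),(64,12,27405),(71,11,82290)]),
   ((5,9,12,14),[(41,18,17550),(46,19,66082),(61,15,91430)]),
   ((5,10,15,20),[(46,22,66082),(51,24,135795),(51,22,135795),(53,21,178412),(54,20,135795)])]"

definition quad_data_2 :: "quad_entry list" where
  "quad_data_2 = [
   ((6,7,8,9),[(25,9,1836),(29,12,3895),(35,14,10650),(42,10,10650),(71,11,23751),(71,10,635376)]),
   ((6,7,8,10),[(29,12,3895),(35,15,14976),(34,13,4865),(45,16,23751),(47,17,40953),(71,12,82290),(71,10,123410)]),
   ((6,7,8,14),[(35,15,14976),(46,19,27405)]),
   ((6,7,10,12),[(35,15,14976),(41,19,31496),(37,14,3895),(42,14,31496),(61,15,91430)]),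
   ((6,8,9,10),[(29,12,3895),(35,17,12675),(34,13,4865),(38,11,14976),(42,14,31496),(42,10,35960),(53,13,91430),(71,11,82290)]),
   ((6,8,9,12),[(35,15,14976),(34,13,4865),(40,19,27435),(42,14,31496),(61,15,91430)]),
   ((6,8,10,11),[(35,15,14976),(34,13,4865),(41,19,31496),(45,16,23751),(51,12,52395),(52,12,249951),(71,11,82290)]),
   ((6,8,10,12),[(35,15,14976),(34,13,4865),(41,19,31496),(42,14,31496),(53,13,91430),(71,12,82290)]),
   ((6,8,10,16),[(41,19,31496),(47,17,40953)]),
   ((6,8,12,14),[(35,15,14976),(46,19,27405),(61,15,91430)]),
   ((6,9,10,12),[(34,13,4865),(41,18,17550),(43,16,12650),(42,14,31496),(61,15,91430)]),
   ((6,9,12,15),[(40,19,27435),(41,18,17550),(45,22,73853),(48,18,52395),(49,17,46376),(61,15,91430)]),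
   ((6,9,12,18),[(45,22,73853),(47,21,91430),(46,19,66082),(48,18,52395)]),
   ((6,10,11,12),[(35,15,14976),(34,13,4865),(41,19,31496),(45,20,40953),(42,14,31496),(54,18,82251),(61,15,194580)]),
   ((6,10,12,16),[(41,18,17550),(47,23,101311),(45,20,40953),(51,24,135795),(54,18,82251),(61,16,135795)]),
   ((6,10,14,16),[(41,18,17550),(45,20,40953),(54,22,82290),(60,20,211925),(61,16,135795)]),
   ((6,10,16,18),[(45,20,40953),(51,24,135795),(54,22,82290),(60,20,211925)]),
   ((6,12,15,18),[(47,23,101311),(45,20,40953),(47,21,91430),(46,19,27405),(54,25,163231),(48,18,52395),(55,23,230350),(58,20,194628),(58,18,249951),(61,19,395067)]),
   ((6,12,18,24),[(54,27,292878),(54,25,163231),(58,29,341110),(58,28,395067),(57,26,249951),(58,27,316305),(58,26,395067),(58,25,270777),(58,24,395067)]),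
   ((7,8,9,10),[(29,12,3895),(34,13,4865),(42,18,17577),(38,11,14976),(56,12,27435),(59,15,66045),(69,10,135795),(70,11,230300),(71,10,249900)]),
   ((7,8,9,11),[(34,13,4865),(42,18,17577),(56,12,27435),(59,15,66045),(71,11,23751)]),
   ((7,8,9,16),[(40,19,27435),(42,16,31496),(53,21,73853)]),
   ((7,8,10,12),[(34,13,4865),(42,18,17577),(42,14,31496),(49,16,73853),(53,13,91430),(71,12,82290)]),
   ((7,8,10,15),[(41,19,31496),(42,18,17577),(49,16,73853)]),
   ((7,8,12,15),[(42,18,17577),(46,19,27405),(53,21,73853),(49,16,73853),(61,18,194628)]),
   ((7,8,14,15),[(35,15,14976),(46,19,27405),(53,21,73853),(61,18,194628),(59,15,66045)]),
   ((7,9,10,12),[(34,13,4865),(42,18,17577),(42,16,31496),(42,14,31496),(61,15,91430)]),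
   ((7,9,15,16),[(40,19,27435),(42,16,31496),(51,24,73853),(53,21,73853),(61,18,194628)]),
   ((7,10,11,12),[(34,13,4865),(42,18,17577),(45,20,40953),(42,16,31496),(42,14,31496),(56,18,101270),(56,12,27435),(61,15,194580)]),
   ((7,10,12,14),[(35,15,14976),(47,23,101311),(45,20,40953),(42,16,31496),(49,16,73853),(56,18,101270),(61,15,194580)]),
   ((7,10,12,15),[(42,18,17577),(47,23,101311),(45,20,40953),(45,19,135795),(49,16,73853),(56,18,101270),(61,15,194580)]),
   ((7,12,14,15),[(35,15,14976),(46,19,27405),(51,24,73853),(53,21,73853),(56,18,101270),(58,20,194628),(61,18,194628)]),
   ((7,12,15,16),[(46,19,27405),(51,24,73853),(53,21,73853),(60,22,194628),(61,18,194628)]),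
   ((7,14,21,28),[(58,29,395067),(58,28,292878)])]"

definition quad_data_3 :: "quad_entry list" where
  "quad_data_3 = [
   ((8,9,10,11),[(34,14,4845),(47,18,20475),(59,15,66045),(64,18,194628),(71,11,82290)]),
   ((8,9,10,12),[(34,13,4865),(42,18,17577),(56,21,58905),(59,15,23751),(64,18,194628)]),
   ((8,9,10,13),[(35,15,14976),(34,13,4865),(47,18,20475),(59,20,46376),(62,17,211876)]),
   ((8,9,10,14),[(35,17,12675),(59,20,46376),(59,15,23751)]),
   ((8,9,10,18),[(58,24,101311),(59,20,46376)]),
   ((8,9,11,12),[(34,13,4865),(42,18,17577),(56,21,58905),(64,18,194628),(64,12,27405)]),
   ((8,9,14,15),[(35,17,12675),(35,15,14976),(51,24,73853),(59,20,46376),(60,17,123453)]),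
   ((8,10,11,12),[(34,13,4865),(42,18,17577),(56,21,58905),(56,12,27435),(64,18,194628)]),
   ((8,10,12,13),[(35,15,14976),(34,13,4865),(50,24,66082),(47,18,20475),(58,24,101311),(59,15,23751),(62,17,211876)]),
   ((8,10,12,14),[(35,15,14976),(47,18,20475),(52,22,66082),(60,17,123453),(59,15,23751)]),
   ((8,10,12,16),[(41,19,31496),(58,24,101311),(56,21,58905),(64,18,194628)]),
   ((8,10,12,18),[(41,19,31496),(50,24,66082),(58,24,101311),(64,18,194628)]),
   ((8,10,12,20),[(50,24,66082),(52,22,66082),(55,23,211925),(56,21,58905)]),
   ((8,10,14,15),[(35,17,12675),(42,16,31496),(58,23,73853),(59,20,46376),(60,17,123453)]),
   ((8,10,16,18),[(59,26,211925),(58,24,101311),(59,20,46376),(64,18,194628)]),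
   ((8,10,18,20),[(58,29,149040),(59,26,211925),(58,23,73853),(61,22,111930)]),
   ((8,12,14,15),[(35,15,14976),(46,19,27405),(51,24,73853),(53,21,73853),(58,23,211925),(61,18,194628),(61,15,91430)]),
   ((8,12,14,16),[(46,19,27405),(51,24,73853),(53,21,73853),(61,22,194628),(61,18,194628)]),
   ((8,12,16,20),[(50,24,66082),(56,21,58905),(62,27,211925),(61,22,194628)]),
   ((8,12,16,24),[(59,28,211925),(61,29,395067),(58,24,101311),(62,27,211925)]),
   ((8,12,18,20),[(50,24,66082),(53,21,73853),(61,28,211925),(62,27,211925),(61,22,194628)]),
   ((8,13,14,15),[(35,15,14976),(40,19,27435),(52,24,135795),(58,23,73853),(59,20,46376),(61,18,194628)]),
   ((8,13,20,21),[(60,29,230350),(61,28,211925),(58,24,40953),(58,23,211925),(61,22,194628)]),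
   ((8,14,15,16),[(46,19,27405),(51,24,73853),(59,26,211925),(61,22,111930),(61,18,194628)]),
   ((8,14,15,18),[(58,29,149040),(59,26,211925),(58,23,73853),(59,20,46376),(61,22,111930),(61,18,194628)]),
   ((8,14,18,20),[(58,29,149040),(61,28,211925),(58,24,40953),(58,23,73853),(61,22,111930)]),
   ((8,16,18,20),[(58,29,149040),(59,28,211925),(53,21,73853),(62,27,211925),(61,22,111930)]),
   ((8,16,20,24),[(52,24,135795),(59,28,211925),(61,29,395067),(62,27,211925)]),
   ((9,10,11,12),[(34,13,4865),(42,18,17577),(56,21,58905),(56,12,27435),(64,18,194628)]),
   ((9,10,11,20),[(50,24,66082),(59,25,135795)]),
   ((9,10,12,13),[(35,15,14976),(34,13,4865),(50,24,66082),(47,18,20475),(58,24,101311),(62,17,211876),(61,15,91430)]),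
   ((9,10,12,14),[(41,18,17550),(52,22,66082),(60,17,123453),(59,15,23751)]),
   ((9,10,12,15),[(42,18,17577),(46,22,66082),(56,21,58905),(60,17,123453)]),
   ((9,10,14,16),[(62,24,66082),(60,18,1380)]),
   ((9,12,14,15),[(40,19,27435),(41,18,17550),(51,24,73853),(53,21,73853),(58,23,211925),(61,20,230350),(60,17,123453)]),
   ((9,12,15,18),[(44,22,52395),(52,24,135795),(56,26,194628),(53,21,73853),(55,23,211925),(60,22,194628),(61,19,395067),(61,18,194628)]),
   ((9,12,15,24),[(58,28,211925),(58,26,135795),(61,29,395067),(59,25,135795)]),
   ((9,12,18,21),[(60,29,230350),(58,24,101311),(62,27,211925),(60,23,111972)]),
   ((9,14,15,16),[(43,17,31496),(59,26,211925),(62,24,66082),(59,20,46376),(61,18,194628)]),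
   ((9,15,16,21),[(61,29,211925),(59,26,211925),(62,24,66082)]),
   ((9,15,18,24),[(61,29,211925),(59,26,211925),(62,24,66082)]),
   ((9,15,21,24),[(61,29,211925),(59,26,211925),(62,24,66082)]), ((9,15,24,27),[(61,29,211925)])]"

definition quad_data_4 :: "quad_entry list" where
  "quad_data_4 = [

   ((10,11,12,13),[(35,15,14976),(34,13,4865),(47,18,20475),(53,23,40953),(61,19,82251),(61,15,194580)]),
   ((10,11,12,14),[(35,15,14976),(47,18,20475),(53,23,40953),(61,19,82251),(61,15,194580)]),
   ((10,11,12,15),[(42,18,17577),(53,23,40953),(61,19,82251),(61,15,194580)]),
   ((10,11,12,16),[(41,19,31496),(53,25,82290),(56,21,58905),(61,19,82251)]),
   ((10,11,12,22),[(50,24,66082),(53,23,40953),(63,27,211925)]),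
   ((10,11,15,16),[(41,19,31496),(53,25,82290),(61,29,211925),(61,21,73853),(61,19,82251)]),
   ((10,12,13,14),[(35,15,14976),(53,25,82290),(47,18,20475),(53,23,40953),(61,20,230350),(61,19,82251),(61,15,194580)]),
   ((10,12,13,15),[(35,15,14976),(42,16,31496),(53,25,82290),(53,23,40953),(61,21,73853),(61,19,82251),(61,15,194580)]),
   ((10,12,14,15),[(41,18,17550),(53,25,82290),(53,23,40953),(61,21,73853),(60,17,123453)]),
   ((10,12,14,16),[(42,16,31496),(53,25,82290),(53,23,40953),(61,23,211925),(61,19,82251)]),
   ((10,12,14,17),[(53,25,82290),(58,29,230350),(53,23,40953),(61,23,211925),(61,19,82251)]),
   ((10,12,14,24),[(53,25,82290),(64,29,211925)]),
   ((10,12,15,16),[(41,19,31496),(53,25,82290),(63,27,211925),(61,21,73853),(61,19,82251)]),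
   ((10,12,16,18),[(53,23,40953),(58,24,101311),(63,27,211925),(61,23,211925),(61,19,82251)]),
   ((10,12,16,20),[(50,24,66082),(58,28,211925),(63,27,211925),(60,23,111972),(61,20,230350)]),
   ((10,13,16,18),[(58,29,230350),(58,24,101311),(62,27,211925),(61,23,211925),(59,20,46376),(61,19,82251)]),
   ((10,14,15,16),[(41,18,17550),(61,29,211925),(62,24,66082),(61,19,82251)]),
   ((10,14,15,20),[(64,29,211925),(62,24,66082)]),
   ((10,14,16,18),[(61,29,211925),(59,26,211925),(62,24,66082),(59,20,46376),(61,19,82251)]),
   ((10,14,16,24),[(61,29,211925),(59,26,211925),(62,24,66082)]),
   ((10,14,20,24),[(64,29,211925),(62,24,66082)]),
   ((10,15,16,18),[(61,29,211925),(63,27,211925),(62,24,66082),(59,20,46376),(61,19,82251)]),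
   ((10,15,16,20),[(61,29,211925),(63,27,211925),(62,24,66082)]), ((10,15,20,25),[(64,29,211925)]),
   ((10,16,18,20),[(61,29,211925),(63,27,211925),(62,24,66082)]),
   ((10,16,18,22),[(61,29,211925),(63,27,211925),(62,24,66082)]), ((10,18,24,28),[(64,29,211925)]),
   ((10,20,21,22),[(61,29,211925),(63,27,211925),(62,24,66082)]),
   ((11,12,13,14),[(35,15,14976),(53,25,82290),(47,18,20475),(53,23,40953),(61,21,73853),(61,19,82251),(61,15,194580)]),
   ((11,12,13,24),[(53,25,82290),(64,29,211925)]),
   ((11,12,14,15),[(35,15,14976),(42,16,31496),(53,25,82290),(53,23,40953),(61,24,211925),(61,21,73853),(60,17,123453)]),
   ((11,12,14,18),[(53,25,82290),(53,23,40953),(64,29,211925),(61,24,211925),(58,20,194628),(61,19,82251)]),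
   ((11,12,15,16),[(41,19,31496),(53,25,82290),(63,27,211925),(61,21,73853),(61,19,82251)]),
   ((11,13,15,16),[(58,29,230350),(58,26,12650),(61,24,211925),(61,21,73853),(61,19,82251)]),
   ((11,14,15,16),[(42,16,31496),(53,25,82290),(53,23,40953),(61,29,211925),(61,24,211925),(61,21,73853),(61,19,82251)]),
   ((11,15,16,17),[(53,25,82290),(58,29,230350),(53,23,40953),(58,28,211925),(63,27,211925),(61,21,73853),(61,19,82251)]),
   ((11,18,20,21),[(50,24,66082),(53,23,40953),(61,29,211925),(63,27,211925),(61,24,211925)])]"

definition quad_data_5 :: "quad_entry list" where
  "quad_data_5 = [

   ((12,13,14,15),[(35,15,14976),(40,19,27435),(62,28,58941),(58,23,211925),(61,21,73853),(61,18,194628)]),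
   ((12,13,14,16),[(40,19,27435),(62,28,58941),(61,23,211925),(61,19,82251)]),
   ((12,13,14,26),[(64,29,211925)]),
   ((12,13,15,16),[(40,19,27435),(62,28,58941),(61,23,211925),(61,19,82251)]),
   ((12,13,15,18),[(53,23,40953),(62,28,58941),(61,23,211925),(61,19,82251)]),
   ((12,14,15,16),[(46,19,27405),(62,28,58941),(61,23,211925),(61,19,82251)]),
   ((12,14,15,17),[(53,23,40953),(62,28,58941),(61,23,211925),(61,19,82251)]),
   ((12,14,15,18),[(53,23,40953),(62,28,58941),(64,29,211925),(61,23,211925),(61,19,82251)]),
   ((12,14,15,19),[(62,28,58941),(64,29,211925),(61,24,211925),(58,20,194628),(61,19,82251)]),
   ((12,14,16,18),[(53,23,40953),(62,28,58941),(64,29,211925),(61,22,194628),(61,18,194628)]),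
   ((12,14,16,20),[(62,28,58941),(64,29,211925),(61,22,194628)]), ((12,14,16,28),[(64,29,211925)]),
   ((12,14,18,21),[(62,28,58941),(64,29,211925),(61,22,194628)]),
   ((12,14,20,24),[(62,28,58941),(64,29,211925)]),
   ((12,15,16,17),[(53,23,40953),(62,28,58941),(64,29,211925),(61,23,211925),(61,19,82251)]),
   ((12,15,16,18),[(53,23,40953),(62,28,58941),(64,29,211925),(61,23,211925),(61,19,82251)]),
   ((12,15,16,20),[(62,28,58941),(64,29,211925),(60,22,194628)]),
   ((12,15,17,18),[(53,23,40953),(62,28,58941),(64,29,211925),(61,23,211925),(61,19,82251)]),
   ((12,15,18,21),[(62,28,58941),(64,29,211925),(61,24,211925)]),
   ((12,15,18,24),[(62,28,58941),(64,29,211925)]), ((12,15,18,27),[(64,29,211925)]),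
   ((12,15,24,27),[(64,29,211925)]), ((12,16,17,20),[(62,28,58941),(64,29,211925),(61,22,194628)]),
   ((12,16,18,20),[(62,28,58941),(64,29,211925),(61,22,194628)]),
   ((12,16,18,24),[(62,28,58941),(64,29,211925)]),
   ((12,16,20,22),[(62,28,58941),(64,29,211925),(63,27,211925)]),
   ((12,16,20,24),[(62,28,58941),(64,29,211925)]), ((12,16,24,28),[(64,29,211925)]),
   ((12,18,19,21),[(62,28,58941),(64,29,211925),(61,24,211925)]),
   ((12,18,20,24),[(62,28,58941),(64,29,211925)]), ((12,18,21,24),[(62,28,58941),(64,29,211925)]),
   ((12,20,22,24),[(62,28,58941),(64,29,211925)])]"

definition quad_data_6 :: "quad_entry list" where
  "quad_data_6 = [
   ((13,14,15,16),[(40,19,27435),(62,28,58941),(61,23,211925),(61,19,82251)]),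
   ((13,14,15,20),[(62,28,58941),(64,29,211925),(61,24,211925),(61,20,230350)]),
   ((13,14,15,28),[(64,29,211925)]), ((13,14,18,20),[(62,28,58941),(64,29,211925),(61,22,194628)]),
   ((13,14,20,21),[(62,28,58941),(64,29,211925),(61,22,194628)]),
   ((13,15,16,17),[(53,23,40953),(62,28,58941),(64,29,211925),(61,23,211925),(61,19,82251)]),
   ((13,15,16,18),[(62,28,58941),(64,29,211925),(61,23,211925),(59,20,46376),(61,18,194628)]),
   ((13,15,16,21),[(62,28,58941),(64,29,211925),(61,24,211925)]),
   ((13,16,20,21),[(62,28,58941),(64,29,211925),(61,22,194628)]),
   ((13,18,20,21),[(62,28,58941),(64,29,211925),(61,22,194628)]), ((13,18,25,28),[(64,29,211925)]),
   ((13,20,21,26),[(64,29,211925)]), ((13,21,22,24),[(62,28,58941),(64,29,211925)]),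
   ((14,15,16,17),[(53,23,40953),(64,29,211925),(62,24,66082),(61,19,82251)]),
   ((14,15,16,18),[(64,29,211925),(62,24,66082),(59,20,46376),(61,18,194628)]),
   ((14,15,16,19),[(64,29,211925),(62,24,66082),(61,19,82251)]),
   ((14,15,16,20),[(64,29,211925),(62,24,66082)]), ((14,15,16,21),[(64,29,211925),(62,24,66082)]),
   ((14,15,16,22),[(64,29,211925),(62,24,66082)]), ((14,15,18,20),[(64,29,211925),(62,24,66082)]),
   ((14,15,18,24),[(64,29,211925),(62,24,66082)]), ((14,15,19,20),[(64,29,211925),(62,24,66082)]),
   ((14,15,20,21),[(64,29,211925),(62,24,66082)]),
   ((14,16,17,18),[(64,29,211925),(62,24,66082),(59,20,46376),(61,18,194628)]),
   ((14,16,18,20),[(64,29,211925),(62,24,66082)]), ((14,16,18,22),[(64,29,211925),(62,24,66082)]),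
   ((14,16,20,21),[(64,29,211925),(62,24,66082)]), ((14,16,20,24),[(64,29,211925),(62,24,66082)]),
   ((14,17,18,20),[(64,29,211925),(62,24,66082)]), ((14,18,19,20),[(64,29,211925),(62,24,66082)]),
   ((14,18,20,21),[(64,29,211925),(62,24,66082)]), ((14,18,20,24),[(64,29,211925),(62,24,66082)]),
   ((14,19,20,21),[(64,29,211925),(62,24,66082)]), ((14,20,21,24),[(64,29,211925),(62,24,66082)]),
   ((14,20,22,24),[(64,29,211925),(62,24,66082)]), ((14,20,24,28),[(64,29,211925)]),
   ((14,20,26,27),[(64,29,211925)]), ((14,22,24,25),[(64,29,211925)]),
   ((14,26,27,28),[(64,29,211925)])]"

definition quad_data_7 :: "quad_entry list" where
  "quad_data_7 = [
   ((15,16,17,18),[(64,29,211925),(62,24,66082),(59,20,46376),(61,18,194628)]),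
   ((15,16,17,19),[(64,29,211925),(62,24,66082),(61,19,82251)]),
   ((15,16,17,20),[(64,29,211925),(62,24,66082)]), ((15,16,17,21),[(64,29,211925),(62,24,66082)]),
   ((15,16,18,19),[(64,29,211925),(62,24,66082),(61,19,82251)]),
   ((15,16,18,20),[(64,29,211925),(62,24,66082)]), ((15,16,18,21),[(64,29,211925),(62,24,66082)]),
   ((15,16,18,24),[(64,29,211925),(62,24,66082)]), ((15,16,19,20),[(64,29,211925),(62,24,66082)]),
   ((15,16,19,21),[(64,29,211925),(62,24,66082)]), ((15,16,20,21),[(64,29,211925),(62,24,66082)]),
   ((15,16,21,22),[(64,29,211925),(62,24,66082)]), ((15,16,21,23),[(64,29,211925),(62,24,66082)]),
   ((15,16,21,25),[(64,29,211925)]), ((15,17,18,20),[(64,29,211925),(62,24,66082)]),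
   ((15,18,19,20),[(64,29,211925),(62,24,66082)]), ((15,18,19,24),[(64,29,211925),(62,24,66082)]),
   ((15,18,20,21),[(64,29,211925),(62,24,66082)]), ((15,18,20,23),[(64,29,211925),(62,24,66082)]),
   ((15,18,20,24),[(64,29,211925),(62,24,66082)]), ((15,18,21,24),[(64,29,211925),(62,24,66082)]),
   ((15,18,23,24),[(64,29,211925),(62,24,66082)]), ((15,18,24,27),[(64,29,211925)]),
   ((15,20,21,22),[(64,29,211925),(62,24,66082)]), ((15,21,24,27),[(64,29,211925)]),
   ((15,22,26,28),[(64,29,211925)]), ((15,24,25,27),[(64,29,211925)]),
   ((16,17,18,19),[(64,29,211925),(62,24,66082),(61,19,82251)]),
   ((16,17,18,20),[(64,29,211925),(62,24,66082)]), ((16,17,20,21),[(64,29,211925),(62,24,66082)]),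
   ((16,18,19,20),[(64,29,211925),(62,24,66082)]), ((16,18,19,22),[(64,29,211925),(62,24,66082)]),
   ((16,18,20,21),[(64,29,211925),(62,24,66082)]), ((16,18,20,22),[(64,29,211925),(62,24,66082)]),
   ((16,18,20,24),[(64,29,211925),(62,24,66082)]), ((16,18,20,26),[(64,29,211925)]),
   ((16,18,20,28),[(64,29,211925)]), ((16,18,21,25),[(64,29,211925)]),
   ((16,18,22,24),[(64,29,211925),(62,24,66082)]), ((16,19,20,21),[(64,29,211925),(62,24,66082)]),
   ((16,19,20,24),[(64,29,211925),(62,24,66082)]), ((16,20,21,22),[(64,29,211925),(62,24,66082)]),
   ((16,20,21,23),[(64,29,211925),(62,24,66082)]), ((16,20,21,24),[(64,29,211925),(62,24,66082)]),
   ((16,20,21,28),[(64,29,211925)]), ((16,20,22,24),[(64,29,211925),(62,24,66082)]),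
   ((16,20,24,26),[(64,29,211925)]), ((16,20,24,28),[(64,29,211925)]),
   ((16,21,24,25),[(64,29,211925)]), ((16,22,25,27),[(64,29,211925)])]"

definition quad_data_8 :: "quad_entry list" where
  "quad_data_8 = [
   ((17,18,19,20),[(64,29,211925),(62,24,66082)]), ((17,18,20,21),[(64,29,211925),(62,24,66082)]),
   ((17,18,20,22),[(64,29,211925),(62,24,66082)]), ((17,18,20,23),[(64,29,211925),(62,24,66082)]),
   ((17,18,21,24),[(64,29,211925),(62,24,66082)]), ((17,20,21,22),[(64,29,211925),(62,24,66082)]),
   ((17,20,21,24),[(64,29,211925),(62,24,66082)]), ((17,21,23,24),[(64,29,211925),(62,24,66082)]),
   ((18,19,20,21),[(64,29,211925),(62,24,66082)]), ((18,19,20,22),[(64,29,211925),(62,24,66082)]),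
   ((18,19,20,23),[(64,29,211925),(62,24,66082)]), ((18,19,20,24),[(64,29,211925),(62,24,66082)]),
   ((18,20,21,22),[(64,29,211925),(62,24,66082)]), ((18,20,21,23),[(64,29,211925),(62,24,66082)]),
   ((18,20,21,24),[(64,29,211925),(62,24,66082)]), ((18,20,21,25),[(64,29,211925)]),
   ((18,20,21,27),[(64,29,211925)]), ((18,20,22,23),[(64,29,211925),(62,24,66082)]),
   ((18,20,22,24),[(64,29,211925),(62,24,66082)]), ((18,20,23,24),[(64,29,211925),(62,24,66082)]),
   ((18,20,24,26),[(64,29,211925)]), ((18,20,24,28),[(64,29,211925)]),
   ((18,21,22,24),[(64,29,211925),(62,24,66082)]), ((18,21,24,25),[(64,29,211925)]),
   ((18,21,24,27),[(64,29,211925)]), ((18,21,25,28),[(64,29,211925)]),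
   ((18,22,25,28),[(64,29,211925)]), ((18,23,25,28),[(64,29,211925)]),
   ((18,24,25,28),[(64,29,211925)]), ((18,24,26,27),[(64,29,211925)]),
   ((18,25,27,28),[(64,29,211925)])]"

definition quad_data_9 :: "quad_entry list" where
  "quad_data_9 = [
   ((19,20,21,22),[(64,29,211925),(62,24,66082)]), ((19,20,21,24),[(64,29,211925),(62,24,66082)]),
   ((19,20,21,26),[(64,29,211925)]), ((19,20,22,24),[(64,29,211925),(62,24,66082)]),
   ((19,20,23,24),[(64,29,211925),(62,24,66082)]), ((19,20,24,25),[(64,29,211925)]),
   ((19,21,24,25),[(64,29,211925)]), ((19,23,24,25),[(64,29,211925)]),
   ((19,24,25,29),[(64,29,211925)]), ((19,26,27,28),[(64,29,211925)]),
   ((20,21,22,23),[(64,29,211925),(62,24,66082)]), ((20,21,22,24),[(64,29,211925),(62,24,66082)]),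
   ((20,21,22,25),[(64,29,211925)]), ((20,21,22,26),[(64,29,211925)]),
   ((20,21,22,27),[(64,29,211925)]), ((20,21,23,24),[(64,29,211925),(62,24,66082)]),
   ((20,21,24,25),[(64,29,211925)]), ((20,21,24,26),[(64,29,211925)]),
   ((20,21,24,27),[(64,29,211925)]), ((20,21,24,28),[(64,29,211925)]),
   ((20,21,24,29),[(64,29,211925)]), ((20,21,25,26),[(64,29,211925)]),
   ((20,21,26,27),[(64,29,211925)]), ((20,22,23,24),[(64,29,211925),(62,24,66082)]),
   ((20,22,24,25),[(64,29,211925)]), ((20,22,24,26),[(64,29,211925)]),
   ((20,22,24,28),[(64,29,211925)]), ((20,23,24,25),[(64,29,211925)]),
   ((20,23,24,28),[(64,29,211925)]), ((20,24,25,26),[(64,29,211925)]),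
   ((20,24,25,28),[(64,29,211925)]), ((20,24,26,28),[(64,29,211925)]),
   ((20,24,27,28),[(64,29,211925)])]"

definition quad_data_10 :: "quad_entry list" where
  "quad_data_10 = [
   ((21,22,23,24),[(64,29,211925),(62,24,66082)]), ((21,22,24,25),[(64,29,211925)]),
   ((21,22,24,28),[(64,29,211925)]), ((21,22,28,29),[(64,29,211925)]),
   ((21,23,24,25),[(64,29,211925)]), ((21,23,24,27),[(64,29,211925)]),
   ((21,24,25,26),[(64,29,211925)]), ((21,24,25,27),[(64,29,211925)]),
   ((21,24,25,28),[(64,29,211925)]), ((21,24,27,28),[(64,29,211925)]),
   ((21,25,26,28),[(64,29,211925)]), ((22,23,24,25),[(64,29,211925)]),
   ((22,23,24,26),[(64,29,211925)]), ((22,24,25,26),[(64,29,211925)]),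
   ((22,24,25,27),[(64,29,211925)]), ((22,24,26,28),[(64,29,211925)]),
   ((22,25,27,28),[(64,29,211925)]), ((23,24,25,26),[(64,29,211925)]),
   ((23,24,25,27),[(64,29,211925)]), ((23,24,25,28),[(64,29,211925)]),
   ((23,24,25,29),[(64,29,211925)]), ((23,24,26,27),[(64,29,211925)]),
   ((24,25,26,27),[(64,29,211925)]), ((24,25,26,28),[(64,29,211925)]),
   ((24,25,26,29),[(64,29,211925)]), ((24,25,27,28),[(64,29,211925)]),
   ((24,25,27,29),[(64,29,211925)]), ((24,25,28,29),[(64,29,211925)]),
   ((24,26,27,28),[(64,29,211925)]), ((25,26,27,28),[(64,29,211925)])]"

definition quad_data_11 :: "quad_entry list" where
  "quad_data_11 = [
   ((26,27,28,29),[(64,29,211925)])]"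

text \<open>Equality with the enumeration shows that no admissible quadruple with these smallest
  distances is missing. The tables are divided by the smallest distance, so each evaluation stays
  moderate.\<close>

lemma quad_data_1_complete: "map fst quad_data_1 = admissible_quads [1,2,3,4,5]"
  by code_simp

lemma quad_data_1_checks: "list_all quad_check_1 quad_data_1" "list_all quad_check_2 quad_data_1"
  by code_simp+

lemma quad_data_1_bounds: "list_all entry_bounds quad_data_1"
  by (simp add: quad_data_1_def entry_bounds_def family_bounds)

lemma quad_data_2_complete: "map fst quad_data_2 = admissible_quads [6,7]"
  by code_simp

lemma quad_data_2_checks: "list_all quad_check_1 quad_data_2" "list_all quad_check_2 quad_data_2"
  by code_simp+

lemma quad_data_2_bounds: "list_all entry_bounds quad_data_2"
  by (simp add: quad_data_2_def entry_bounds_def family_bounds)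

lemma quad_data_3_complete: "map fst quad_data_3 = admissible_quads [8,9]"
  by code_simp

lemma quad_data_3_checks: "list_all quad_check_1 quad_data_3" "list_all quad_check_2 quad_data_3"
  by code_simp+

lemma quad_data_3_bounds: "list_all entry_bounds quad_data_3"
  by (simp add: quad_data_3_def entry_bounds_def family_bounds)

lemma quad_data_4_complete: "map fst quad_data_4 = admissible_quads [10,11]"
  by code_simp

lemma quad_data_4_checks: "list_all quad_check_1 quad_data_4" "list_all quad_check_2 quad_data_4"
  by code_simp+

lemma quad_data_4_bounds: "list_all entry_bounds quad_data_4"
  by (simp add: quad_data_4_def entry_bounds_def family_bounds)

lemma quad_data_5_complete: "map fst quad_data_5 = admissible_quads [12]"
  by code_simp

lemma quad_data_5_checks: "list_all quad_check_1 quad_data_5" "list_all quad_check_2 quad_data_5"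
  by code_simp+

lemma quad_data_5_bounds: "list_all entry_bounds quad_data_5"
  by (simp add: quad_data_5_def entry_bounds_def family_bounds)

lemma quad_data_6_complete: "map fst quad_data_6 = admissible_quads [13,14]"
  by code_simp

lemma quad_data_6_checks: "list_all quad_check_1 quad_data_6" "list_all quad_check_2 quad_data_6"
  by code_simp+

lemma quad_data_6_bounds: "list_all entry_bounds quad_data_6"
  by (simp add: quad_data_6_def entry_bounds_def family_bounds)

lemma quad_data_7_complete: "map fst quad_data_7 = admissible_quads [15,16]"
  by code_simp

lemma quad_data_7_checks: "list_all quad_check_1 quad_data_7" "list_all quad_check_2 quad_data_7"
  by code_simp+

lemma quad_data_7_bounds: "list_all entry_bounds quad_data_7"
  by (simp add: quad_data_7_def entry_bounds_def family_bounds)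

lemma quad_data_8_complete: "map fst quad_data_8 = admissible_quads [17,18]"
  by code_simp

lemma quad_data_8_checks: "list_all quad_check_1 quad_data_8" "list_all quad_check_2 quad_data_8"
  by code_simp+

lemma quad_data_8_bounds: "list_all entry_bounds quad_data_8"
  by (simp add: quad_data_8_def entry_bounds_def family_bounds)

lemma quad_data_9_complete: "map fst quad_data_9 = admissible_quads [19,20]"
  by code_simp

lemma quad_data_9_checks: "list_all quad_check_1 quad_data_9" "list_all quad_check_2 quad_data_9"
  by code_simp+

lemma quad_data_9_bounds: "list_all entry_bounds quad_data_9"
  by (simp add: quad_data_9_def entry_bounds_def family_bounds)

lemma quad_data_10_complete: "map fst quad_data_10 = admissible_quads [21,22,23,24,25]"
  by code_simp

lemma quad_data_10_checks: "list_all quad_check_1 quad_data_10" "list_all quad_check_2 quad_data_10"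
  by code_simp+

lemma quad_data_10_bounds: "list_all entry_bounds quad_data_10"
  by (simp add: quad_data_10_def entry_bounds_def family_bounds)

lemma quad_data_11_complete: "map fst quad_data_11 = admissible_quads [26]"
  by code_simp

lemma quad_data_11_checks: "list_all quad_check_1 quad_data_11" "list_all quad_check_2 quad_data_11"
  by code_simp+

lemma quad_data_11_bounds: "list_all entry_bounds quad_data_11"
  by (simp add: quad_data_11_def entry_bounds_def family_bounds)

section \<open>Bounds for four-distance families\<close>

definition family_distances :: "nat set set \<Rightarrow> nat set" where
  "family_distances X = {card (S - T) | S T. S \<in> X \<and> T \<in> X \<and> S \<noteq> T}"

text \<open>The first inequality is \<open>n choose 3 \<le> (n - w + 4) choose 4\<close> times 24:
  families too small for the integrality argument already satisfy the bound. The second controls the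
  last eigenvalues of Wilson's matrix.\<close>

fun wilson_region :: "int \<times> int \<times> int \<Rightarrow> bool" where
  "wilson_region (w, lo, hi) = list_all (\<lambda>n. 4 * (n * (n - 1) * (n - 2)) \<le> quartic_2 w n
     \<and> wilson_inequalities w (n - 2 * w)) [lo..hi]"

lemma wilson_regions: "list_all wilson_region regions"
  by code_simp

lemma quad_entry_exists_aux:
  assumes R: "map fst R = admissible_quads as" "list_all quad_check_1 R \<and> list_all quad_check_2 R" "list_all entry_bounds R"
    and a: "a \<in> set as" and q: "a \<in> {1..29}" "a < b" "b < c" "c < d" "d \<le> 29" "b \<le> 2 * a" "admissible a b c d"
  shows "\<exists>bs. quad_check_1 ((a, b, c, d), bs) \<and> quad_check_2 ((a, b, c, d), bs) \<and> entry_bounds ((a, b, c, d), bs)"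
proof -
  have range: "set distance_range = {1..29}"
    by (simp add: distance_range_def upto_rec1[of 1] flip: set_upto)
  have concatI: "x \<in> set (f y) \<Longrightarrow> y \<in> set ys \<Longrightarrow> x \<in> set (concat (map f ys))"
    for x :: "int \<times> int \<times> int \<times> int" and f and y :: int and ys
    by auto
  have "(a, b, c, d) \<in> set (admissible_quads as)"
    unfolding admissible_quads_def using a q by (intro concatI) (auto simp: range)
  then have "(a, b, c, d) \<in> fst ` set R" by (simp flip: R(1))
  then show ?thesis using R(2,3) by (force simp: list_all_iff)
qed

lemma quad_entry_exists:
  assumes "1 \<le> a" "a < b" "b < c" "c < d" "d \<le> 29" "b \<le> 2 * a" "admissible a b c d"
  shows "\<exists>bs. quad_check_1 ((a, b, c, d), bs) \<and> quad_check_2 ((a, b, c, d), bs) \<and> entry_bounds ((a, b, c, d), bs)"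
proof -
  \<comment> \<open>\<open>a < b < c < d \<le> 29\<close> leaves \<open>a \<le> 26\<close>.\<close>
  have "a \<in> {1, 2, 3, 4, 5} \<or> a \<in> {6, 7} \<or> a \<in> {8, 9} \<or> a \<in> {10, 11} \<or> a \<in> {12} \<or> a \<in> {13, 14} \<or>
    a \<in> {15, 16} \<or> a \<in> {17, 18} \<or> a \<in> {19, 20} \<or> a \<in> {21, 22, 23, 24, 25} \<or> a \<in> {26}"
    using assms by simp presburger
  then show ?thesis
    using quad_entry_exists_aux[OF quad_data_1_complete conjI[OF quad_data_1_checks] quad_data_1_bounds]
      quad_entry_exists_aux[OF quad_data_2_complete conjI[OF quad_data_2_checks] quad_data_2_bounds]
      quad_entry_exists_aux[OF quad_data_3_complete conjI[OF quad_data_3_checks] quad_data_3_bounds]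
      quad_entry_exists_aux[OF quad_data_4_complete conjI[OF quad_data_4_checks] quad_data_4_bounds]
      quad_entry_exists_aux[OF quad_data_5_complete conjI[OF quad_data_5_checks] quad_data_5_bounds]
      quad_entry_exists_aux[OF quad_data_6_complete conjI[OF quad_data_6_checks] quad_data_6_bounds]
      quad_entry_exists_aux[OF quad_data_7_complete conjI[OF quad_data_7_checks] quad_data_7_bounds]
      quad_entry_exists_aux[OF quad_data_8_complete conjI[OF quad_data_8_checks] quad_data_8_bounds]
      quad_entry_exists_aux[OF quad_data_9_complete conjI[OF quad_data_9_checks] quad_data_9_bounds]
      quad_entry_exists_aux[OF quad_data_10_complete conjI[OF quad_data_10_checks] quad_data_10_bounds]
      quad_entry_exists_aux[OF quad_data_11_complete conjI[OF quad_data_11_checks] quad_data_11_bounds]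
      assms
    by (elim disjE) simp_all
qed

lemma four_element_set_sorted:
  fixes D :: "int set"
  assumes "card D = 4"
  obtains a b c d where "D = {a, b, c, d}" "a < b" "b < c" "c < d"
proof -
  have fin: "finite D" using assms card.infinite by fastforce
  define xs where "xs = sorted_list_of_set D"
  have "length xs = 4" using assms fin by (simp add: xs_def)
  then obtain a b c d where xs: "xs = [a, b, c, d]"
    by (auto simp: length_Suc_conv numeral_eq_Suc)
  have "sorted_wrt (<) xs" "set xs = D" using fin by (auto simp: xs_def)
  then show thesis using that[of a b c d] by (auto simp: xs)
qed

lemma entry_bounds_apply:
  assumes bounds: "entry_bounds ((a, b, c, d), bs)" and mem: "(n', w', V) \<in> set bs"
    and X: "X \<subseteq> layer {..<n} w" and le: "int w \<le> w'" "int n \<le> n' - w' + int w"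
    and dist: "\<And>S T. S \<in> X \<Longrightarrow> T \<in> X \<Longrightarrow> S \<noteq> T \<Longrightarrow> int (card (S - T)) \<in> {a, b, c, d}"
  shows "int (card X) \<le> V"
proof -
  have fb: "family_bound n' w' V a b c d"
    using bounds mem by (auto simp: entry_bounds_def list_all_iff)
  obtain Y where Y: "Y \<subseteq> layer {..<nat n'} (nat w')" "card Y = card X"
    "\<And>S T. S \<in> Y \<Longrightarrow> T \<in> Y \<Longrightarrow> S \<noteq> T \<Longrightarrow> \<exists>S'\<in>X. \<exists>T'\<in>X. S' \<noteq> T' \<and> S - T = S' - T'"
    by (rule family_embedding[OF X, of "nat w'" "nat n'"]) (use le in \<open>auto simp: nat_diff_distrib\<close>)
  have "int (card (S - T)) \<in> {a, b, c, d}" if ST: "S \<in> Y" "T \<in> Y" "S \<noteq> T" for S T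
  proof -
    obtain S' T' where "S' \<in> X" "T' \<in> X" "S' \<noteq> T'" "S - T = S' - T'" using Y(3)[OF ST] by blast
    then show ?thesis using dist by metis
  qed
  then have "int (card Y) \<le> V" using fb Y(1) unfolding family_bound_def by blast
  then show ?thesis by (simp add: Y(2))
qed

lemma large_four_distance_family:
  assumes X: "X \<subseteq> layer {..<n} w" and w: "5 \<le> w" "2 * w \<le> n" "w \<le> 29"
    and four: "card (family_distances X) = 4" and big: "n choose 3 < card X"
  obtains a b c d bs where "1 \<le> a" "a < b" "b < c" "c < d" "d \<le> int w"
    "\<forall>S\<in>X. \<forall>T\<in>X. S \<noteq> T \<longrightarrow> int (card (S - T)) \<in> {a, b, c, d}"
    "quad_check_1 ((a, b, c, d), bs)" "quad_check_2 ((a, b, c, d), bs)" "entry_bounds ((a, b, c, d), bs)"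
proof -
  let ?N = "{..<n}"
  have N: "finite ?N" "card ?N = n" by simp_all
  have "card (int ` family_distances X) = 4" using four by (simp add: card_image)
  then obtain a b c d where D: "int ` family_distances X = {a, b, c, d}" "a < b" "b < c" "c < d"
    by (rule four_element_set_sorted)
  have dist: "int (card (S - T)) \<in> {a, b, c, d}" if "S \<in> X" "T \<in> X" "S \<noteq> T" for S T
    unfolding D(1)[symmetric] family_distances_def using that by blast
  have dist': "int (card (T - S)) \<in> {a, b, c, d}" if "S \<in> X" "T \<in> X" "S \<noteq> T" for S T
    using dist[OF that(2,1)] that(3) by blast
  have range: "1 \<le> x \<and> x \<le> int w" if "x \<in> {a, b, c, d}" for x
  proof -
    have "x \<in> int ` family_distances X" using that D(1) by simp
    then obtain S T where ST: "S \<in> X" "T \<in> X" "S \<noteq> T" "x = int (card (S - T))"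
      by (auto simp: family_distances_def)
    then have "S \<in> layer ?N w" "T \<in> layer ?N w" using X by auto
    then have "card (S - T) \<noteq> 0" "card (S - T) \<le> w"
      using card_diff_eq_0_iff[OF N(1), of S w T] card_diff_layer(1)[OF N(1), of T w S] ST(3) by auto
    then show ?thesis using ST(4) by simp
  qed
  have r: "1 \<le> a" "1 \<le> b" "1 \<le> c" "1 \<le> d" "d \<le> int w" using range[of a] range[of b] range[of c] range[of d] by auto
  have w3: "3 \<le> w" using w by simp
  \<comment> \<open>Applied once for each choice of the distinguished distance, giving the four
    divisibilities in \<open>admissible\<close>.\<close>
  note dvd = distance_product_dvd[OF N X w3 big]
  have "(b - a) * (c - a) * (d - a) dvd b * c * d"
    by (rule dvd) (use dist' r in auto)
  moreover have "(a - b) * (c - b) * (d - b) dvd a * c * d"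
    by (rule dvd) (use dist' r in auto)
  moreover have "(a - c) * (b - c) * (d - c) dvd a * b * d"
    by (rule dvd) (use dist' r in auto)
  moreover have "(a - d) * (b - d) * (c - d) dvd a * b * c"
    by (rule dvd) (use dist' r in auto)
  ultimately have adm: "admissible a b c d" by (simp add: admissible_def)
  have "b \<le> 2 * a"
  proof (rule ccontr)
    assume "\<not> b \<le> 2 * a"
    then have "card X \<le> n choose 3"
      using D r by (intro card_le_choose_3_if_clusters[OF N X w3 dist']) auto
    then show False using big by simp
  qed
  then obtain bs where "quad_check_1 ((a, b, c, d), bs)" "quad_check_2 ((a, b, c, d), bs)" "entry_bounds ((a, b, c, d), bs)"
    using quad_entry_exists[of a b c d] D r w adm by auto
  with r(1,5) D(2-4) dist show thesis by (intro that[of a b c d bs]) auto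
qed

lemma quartic_1_mono: "7 \<le> x \<Longrightarrow> x \<le> y \<Longrightarrow> quartic_1 x \<le> quartic_1 y"
  unfolding quartic_1_def by (intro mult_mono add_mono mult_nonneg_nonneg add_nonneg_nonneg) auto

lemma quartic_2_mono: "w \<le> x \<Longrightarrow> x \<le> y \<Longrightarrow> quartic_2 w x \<le> quartic_2 w y"
  unfolding quartic_2_def by (intro mult_mono mult_nonneg_nonneg) auto

lemma four_distance_bound_1:
  assumes X: "X \<subseteq> layer {..<n} w" and w: "5 \<le> w" "2 * w \<le> n" and n: "14 \<le> n" "n \<le> 58"
    and four: "card (family_distances X) = 4"
  shows "int (card X) \<le> int (n choose 4) - int (n choose 3) + int (n choose 2)"
proof -
  have T: "24 * (int (n choose 4) - int (n choose 3) + int (n choose 2)) = quartic_1 (int n)"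
    using int_choose_4[of n] int_choose_3[of n] int_choose_2[of n]
    by (simp add: quartic_1_def algebra_simps)
  have "24 * int (card X) \<le> quartic_1 (int n)"
  proof (cases "card X \<le> n choose 3")
    case True
    then have "24 * int (card X) \<le> 4 * (6 * int (n choose 3))" by simp
    also have "\<dots> = int n * (int n - 1) * (4 * (int n - 2))" unfolding int_choose_3 by simp
    also have "\<dots> \<le> quartic_1 (int n)"
    proof -
      \<comment> \<open>This is where the target exceeds \<open>n choose 3\<close>: the two differ
        by a positive multiple of \<open>(n - 2) * (n - 11) + 12\<close>.\<close>
      have "0 \<le> (int n - 2) * (int n - 11)" using n by (intro mult_nonneg_nonneg) auto
      then have "4 * (int n - 2) \<le> (int n - 2) * (int n - 7) + 12" by (simp add: algebra_simps)
      then show ?thesis unfolding quartic_1_def using n by (intro mult_left_mono) auto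
    qed
    finally show ?thesis .
  next
    case False
    then have big: "n choose 3 < card X" by simp
    have w29: "w \<le> 29" using w n by simp
    obtain a b c d bs where q: "1 \<le> a" "a < b" "b < c" "c < d" "d \<le> int w"
      "\<forall>S\<in>X. \<forall>T\<in>X. S \<noteq> T \<longrightarrow> int (card (S - T)) \<in> {a, b, c, d}"
      "quad_check_1 ((a, b, c, d), bs)" "quad_check_2 ((a, b, c, d), bs)" "entry_bounds ((a, b, c, d), bs)"
      using large_four_distance_family[OF X w w29 four big] .
    define hi where "hi = chain quartic_1 (int w) (max 14 (2 * int w)) bs"
    have "int w \<in> {5..29}" using w w29 by simp
    also have "{5..29} = set [5,6,7,8,9,10,11,12,13,14,15,16,17,18,19,20,21,22,23,24,25,26,27,28,29::int]"
      by (simp flip: set_upto)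
    finally have reach: "reaches (a + b + c + d) (int w) hi"
      using q(7) q(5) unfolding quad_check_1_def hi_def by (simp only: list_all_iff case_prod_conv)
    have lo: "max 14 (2 * int w) \<le> int n" using w n by simp
    show ?thesis
    proof (cases "int n < hi")
      case True
      have "\<exists>(n', w', V)\<in>set bs. int w \<le> w' \<and> int n \<le> n' - w' + int w \<and> 24 * V \<le> quartic_1 (int n)"
        using True lo unfolding hi_def by (intro chain_covers[of "max 14 (2 * int w)"] quartic_1_mono) auto
      then obtain n' w' V where V: "(n', w', V) \<in> set bs" "int w \<le> w'" "int n \<le> n' - w' + int w" "24 * V \<le> quartic_1 (int n)"
        by blast
      then have "int (card X) \<le> V" by (intro entry_bounds_apply[OF q(9) _ X _ _ q(6)[rule_format]])
      then show ?thesis using V(4) by linarith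
    next
      case False
      \<comment> \<open>Supplies \<open>6 < hi\<close> for the monotonicity of
        \<open>small_sum\<close>; the alternative \<open>58 < hi\<close> in \<open>reaches\<close>
        is excluded by \<open>hi \<le> n \<le> 58\<close>.\<close>
      have "14 \<le> hi" using chain_ge[of "max 14 (2 * int w)" quartic_1 "int w" bs] by (simp add: hi_def)
      then have "small_sum (a + b + c + d) (int n) (int w)"
        using small_sum_mono[of "a + b + c + d" hi "int w" "int n"] reach False n w
        by (auto simp: reaches_def split: if_splits)
      then have "card X + (n choose 3) \<le> (n choose 4) + (n choose 2)"
        using w q(1-4) unfolding small_sum_def by (intro harmonic_bound[OF _ _ X _ _ q(6)[rule_format]]) auto
      then have "int (card X) + int (n choose 3) \<le> int (n choose 4) + int (n choose 2)"
        unfolding of_nat_add[symmetric] of_nat_le_iff .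
      then have "int (card X) \<le> int (n choose 4) - int (n choose 3) + int (n choose 2)"
        by (simp only: diff_add_eq le_diff_eq)
      then show ?thesis unfolding T[symmetric] by (intro mult_left_mono) simp_all
    qed
  qed
  then show ?thesis unfolding T[symmetric] by (simp only: mult_le_cancel_left_pos zero_less_numeral)
qed

lemma four_distance_bound_2:
  assumes X: "X \<subseteq> layer {..<n} w" and r: "(int w, lo, hi) \<in> set regions" "lo \<le> int n" "int n \<le> hi"
    and four: "card (family_distances X) = 4"
  shows "card X \<le> (n - w + 4) choose 4"
proof -
  have w: "5 \<le> w" "w \<le> 11" "2 * w \<le> n" using r by (auto simp: regions_def)
  have T: "24 * int ((n - w + 4) choose 4) = quartic_2 (int w) (int n)"
    unfolding int_choose_4 using w by (simp add: quartic_2_def of_nat_diff algebra_simps)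
  have check: "4 * (int n * (int n - 1) * (int n - 2)) \<le> quartic_2 (int w) (int n)"
    "wilson_inequalities (int w) (int n - 2 * int w)"
  proof -
    have "wilson_region (int w, lo, hi)" using wilson_regions r(1) by (simp only: list_all_iff)
    then show "4 * (int n * (int n - 1) * (int n - 2)) \<le> quartic_2 (int w) (int n)"
      "wilson_inequalities (int w) (int n - 2 * int w)"
      using r(2,3) by (auto simp: list_all_iff)
  qed
  show ?thesis
  proof (cases "card X \<le> n choose 3")
    case True
    then have "24 * int (card X) \<le> 4 * (6 * int (n choose 3))" by simp
    also have "\<dots> \<le> 24 * int ((n - w + 4) choose 4)" unfolding int_choose_3 T by (rule check(1))
    finally show ?thesis by simp
  next
    case False
    then have big: "n choose 3 < card X" by simp
    have w29: "w \<le> 29" using w by simp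
    obtain a b c d bs where q: "1 \<le> a" "a < b" "b < c" "c < d" "d \<le> int w"
      "\<forall>S\<in>X. \<forall>T\<in>X. S \<noteq> T \<longrightarrow> int (card (S - T)) \<in> {a, b, c, d}"
      "quad_check_1 ((a, b, c, d), bs)" "quad_check_2 ((a, b, c, d), bs)" "entry_bounds ((a, b, c, d), bs)"
      using large_four_distance_family[OF X w(1,3) w29 four big] .
    show ?thesis
    proof (cases "d \<le> 4")
      case True
      have y: "2 * w + (n - 2 * w) = n" using w by simp
      show ?thesis
      proof (rule intersecting_family_bound[OF _ _ X])
        show "card (S - T) \<le> 4" if "S \<in> X" "T \<in> X" for S T
          using q(6)[rule_format, OF that] q(1-4) True by (cases "S = T") auto
        show "- 1 \<le> eigenvalue n w (wilson_coeff n w) i" if "i \<le> w" "w < i + 4" for i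
          using eigenvalue_wilson_high[of w "n - 2 * w" i] that w check(2) unfolding y
          by (simp add: of_nat_diff)
      qed (use w in auto)
    next
      case False
      have "list_all (region_check d bs) regions"
        using q(8) False q(5) w by (simp add: quad_check_2_def)
      then have "region_check d bs (int w, lo, hi)" using r(1) by (simp only: list_all_iff)
      then have "int n < chain (quartic_2 (int w)) (int w) lo bs" using q(5) r(3) by simp
      moreover have "int w \<le> lo" using r(1) by (auto simp: regions_def)
      ultimately have "\<exists>(n', w', V)\<in>set bs. int w \<le> w' \<and> int n \<le> n' - w' + int w \<and> 24 * V \<le> quartic_2 (int w) (int n)"
        using r(2) by (intro chain_covers[of lo] quartic_2_mono) auto
      then obtain n' w' V where V: "(n', w', V) \<in> set bs" "int w \<le> w'" "int n \<le> n' - w' + int w"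
        "24 * V \<le> quartic_2 (int w) (int n)" by blast
      then have "int (card X) \<le> V" by (intro entry_bounds_apply[OF q(9) _ X _ _ q(6)[rule_format]])
      then have "24 * int (card X) \<le> 24 * int ((n - w + 4) choose 4)" using V(4) unfolding T by linarith
      then show ?thesis by simp
    qed
  qed
qed

section \<open>Binary vectors and their supports\<close>

definition support :: "bit list \<Rightarrow> nat set" where
  "support x = {i. i < length x \<and> x ! i = 1}"

lemma support_inj: "length x = length y \<Longrightarrow> support x = support y \<Longrightarrow> x = y"
proof (rule nth_equalityI)
  fix i assume "length x = length y" "support x = support y" "i < length x"
  then have "x ! i = 1 \<longleftrightarrow> y ! i = 1" by (auto simp: support_def)
  then show "x ! i = y ! i" by (cases "x ! i"; cases "y ! i") auto
qed

lemma support_johnson_space: "support ` johnson_space n w = layer {..<n} w"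
proof safe
  fix x assume "x \<in> johnson_space n w"
  then show "support x \<in> layer {..<n} w" by (auto simp: johnson_space_def layer_def support_def)
next
  fix S assume S: "S \<in> layer {..<n} w"
  define x :: "bit list" where "x = map (\<lambda>i. if i \<in> S then 1 else 0) [0..<n]"
  have "support x = S" using S by (auto simp: support_def x_def layer_def split: if_splits)
  moreover have "x \<in> johnson_space n w"
  proof -
    have "{i. i < n \<and> x ! i = 1} = S" using S by (auto simp: x_def layer_def split: if_splits)
    then show ?thesis using S by (simp add: johnson_space_def x_def layer_def)
  qed
  ultimately show "S \<in> support ` johnson_space n w" by blast
qed

lemma inj_on_support: "inj_on support (johnson_space n w)"
  by (rule inj_onI, rule support_inj) (auto simp: johnson_space_def)

text \<open>The positions of disagreement form the symmetric difference of the supports, whose two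
  halves have equal size because the weights agree; this cancels the factor 2 in
  \<open>tau\<close>.\<close>

lemma tau_eq_card_diff:
  assumes "x \<in> johnson_space n w" "y \<in> johnson_space n w"
  shows "tau x y = real (card (support x - support y))"
proof -
  have len: "length x = n" "length y = n" using assms by (auto simp: johnson_space_def)
  have L: "support x \<in> layer {..<n} w" "support y \<in> layer {..<n} w"
    using assms support_johnson_space by blast+
  have bit: "p \<noteq> q \<longleftrightarrow> (p = 1 \<and> q \<noteq> 1) \<or> (q = 1 \<and> p \<noteq> 1)" for p q :: bit
    by (cases p; cases q) auto
  have "{i. i < length x \<and> x ! i \<noteq> y ! i} = (support x - support y) \<union> (support y - support x)"
    unfolding support_def len using bit by blast
  moreover have "card ((support x - support y) \<union> (support y - support x))
      = card (support x - support y) + card (support y - support x)"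
    by (intro card_Un_disjoint) (auto simp: support_def)
  moreover have "card (support y - support x) = card (support x - support y)"
    by (rule card_diff_layer(3)[OF _ L]) simp
  ultimately show ?thesis by (simp add: tau_def)
qed

lemma distances_tau:
  assumes "X \<subseteq> johnson_space n w"
  shows "distances tau X = real ` family_distances (support ` X)"
proof (intro equalityI subsetI)
  fix t assume "t \<in> distances tau X"
  then obtain x y where xy: "x \<in> X" "y \<in> X" "x \<noteq> y" "t = tau x y" by (auto simp: distances_def)
  then have "support x \<noteq> support y" "t = real (card (support x - support y))"
    using assms inj_on_support[of n w] tau_eq_card_diff[of x n w y] by (auto simp: inj_on_def)
  then show "t \<in> real ` family_distances (support ` X)" using xy by (auto simp: family_distances_def)
next
  fix t assume "t \<in> real ` family_distances (support ` X)"
  then obtain x y where xy: "x \<in> X" "y \<in> X" "support x \<noteq> support y" "t = real (card (support x - support y))"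
    by (auto simp: family_distances_def)
  then have "x \<in> johnson_space n w" "y \<in> johnson_space n w" using assms by auto
  then have "t = tau x y" using xy(4) by (simp add: tau_eq_card_diff)
  then show "t \<in> distances tau X" using xy by (auto simp: distances_def)
qed

section \<open>The extremal family and the maximum\<close>

lemma family_distances_star:
  assumes "5 \<le> w" "2 * w \<le> n"
  shows "family_distances {S \<in> layer {..<n} w. {..<w - 4} \<subseteq> S} = {1, 2, 3, 4}"
proof (intro equalityI subsetI)
  fix k assume "k \<in> family_distances {S \<in> layer {..<n} w. {..<w - 4} \<subseteq> S}"
  then obtain S T where ST: "S \<in> layer {..<n} w" "T \<in> layer {..<n} w" "{..<w - 4} \<subseteq> S" "{..<w - 4} \<subseteq> T"
    "S \<noteq> T" "k = card (S - T)" by (auto simp: family_distances_def)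
  have fin: "finite S" using ST finite_in_layer[of "{..<n}"] by auto
  have "card (S - T) \<le> card (S - {..<w - 4})" using ST fin by (intro card_mono) auto
  also have "\<dots> = 4" using ST fin assms by (simp add: card_Diff_subset layer_def)
  finally have "k \<le> 4" using ST by simp
  moreover have "k \<noteq> 0" using card_diff_eq_0_iff[of "{..<n}" S w T] ST by simp
  ultimately show "k \<in> {1, 2, 3, 4}" by auto
next
  fix k assume "k \<in> {1, 2, 3, 4 :: nat}"
  then have k: "1 \<le> k" "k \<le> 4" by auto
  \<comment> \<open>Exchanges the last \<open>k\<close> elements of \<open>{..<w}\<close> for the
    next \<open>k\<close> points; they fit since \<open>k \<le> 4 < w\<close> and
    \<open>2 * w \<le> n\<close>.\<close>
  define T where "T = {..<w - k} \<union> {w..<w + k}"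
  have diff: "{..<w} - T = {w - k..<w}" by (auto simp: T_def)
  have "card T = w" unfolding T_def using k assms by (subst card_Un_disjoint) auto
  then have "T \<in> layer {..<n} w" "{..<w - 4} \<subseteq> T" using k assms by (auto simp: layer_def T_def)
  moreover have "{..<w} \<in> layer {..<n} w" "{..<w - 4} \<subseteq> {..<w}" using assms by (auto simp: layer_def)
  moreover have "card ({..<w} - T) = k" unfolding diff using k assms by simp
  moreover from this have "{..<w} \<noteq> T" using k by auto
  ultimately show "k \<in> family_distances {S \<in> layer {..<n} w. {..<w - 4} \<subseteq> S}"
    unfolding family_distances_def by blast
qed

lemma star_in_johnson_space:
  assumes "5 \<le> w" "2 * w \<le> n"
  obtains X where "X \<subseteq> johnson_space n w" "card (distances tau X) = 4" "card X = (n - w + 4) choose 4"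
proof -
  let ?Y = "{S \<in> layer {..<n} w. {..<w - 4} \<subseteq> S}"
  define X where "X = {x \<in> johnson_space n w. {..<w - 4} \<subseteq> support x}"
  have X: "X \<subseteq> johnson_space n w" by (auto simp: X_def)
  have img: "support ` X = ?Y"
    unfolding X_def support_johnson_space[symmetric] by blast
  have "card (distances tau X) = card (real ` {1, 2, 3, 4 :: nat})"
    unfolding distances_tau[OF X] img family_distances_star[OF assms] ..
  also have "\<dots> = 4" by (subst card_image) auto
  finally have "card (distances tau X) = 4" .
  moreover have "card X = (n - w + 4) choose 4"
  proof -
    have "card X = card ?Y"
      unfolding img[symmetric] using inj_on_support X by (metis card_image inj_on_subset)
    also have "\<dots> = (n - (w - 4)) choose (w - (w - 4))"
      using assms by (subst card_layer_supersets) auto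
    also have "n - (w - 4) = n - w + 4" using assms by simp
    also have "w - (w - 4) = 4" using assms by simp
    finally show ?thesis .
  qed
  ultimately show thesis using X that by blast
qed

text \<open>\<open>Max\<close> needs a finite nonempty set. The family of all sets containing
  \<open>w - 4\<close> given points provides an element, and at the same time the lower
  bound.\<close>

lemma
  assumes "5 \<le> w" "2 * w \<le> n"
  shows max_s_distance_le: "(\<And>X. X \<subseteq> layer {..<n} w \<Longrightarrow> card (family_distances X) = 4 \<Longrightarrow> card X \<le> B)
      \<Longrightarrow> max_s_distance n w 4 \<le> B"
    and max_s_distance_ge: "(n - w + 4) choose 4 \<le> max_s_distance n w 4"
proof -
  let ?F = "{X. X \<subseteq> johnson_space n w \<and> card (distances tau X) = 4}"
  have "finite (johnson_space n w)"
    using inj_on_support support_johnson_space by (metis finite_imageD finite_layer finite_lessThan)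
  then have fin: "finite (card ` ?F)" by simp
  obtain X where X: "X \<in> ?F" "card X = (n - w + 4) choose 4"
    using star_in_johnson_space[OF assms] by blast
  show "(n - w + 4) choose 4 \<le> max_s_distance n w 4"
    unfolding max_s_distance_def X(2)[symmetric] using fin X(1) by (intro Max_ge) auto
  assume B: "\<And>X. X \<subseteq> layer {..<n} w \<Longrightarrow> card (family_distances X) = 4 \<Longrightarrow> card X \<le> B"
  have "card Y \<le> B" if Y: "Y \<in> ?F" for Y
  proof -
    have sub: "Y \<subseteq> johnson_space n w" using Y by simp
    have "card (support ` Y) \<le> B"
    proof (rule B)
      show "support ` Y \<subseteq> layer {..<n} w" using sub support_johnson_space by blast
      show "card (family_distances (support ` Y)) = 4"
        using Y distances_tau[OF sub] by (simp add: card_image)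
    qed
    then show ?thesis using card_image[OF inj_on_subset[OF inj_on_support sub]] by simp
  qed
  then show "max_s_distance n w 4 \<le> B"
    unfolding max_s_distance_def using fin X(1) by (subst Max_le_iff) auto
qed

theorem theorem3p6:
  fixes n w :: nat
  assumes "2 * w \<le> n"
  shows "(14 \<le> n \<and> n \<le> 58 \<and> 5 \<le> w \<and> real w \<le> real n / 2 \<longrightarrow>
      int (max_s_distance n w 4) \<le> int (n choose 4) - int (n choose 3) + int (n choose 2))
    \<and>
    ((15 \<le> n \<and> n \<le> 16 \<and> w = 5) \<or>
      (17 \<le> n \<and> n \<le> 19 \<and> 5 \<le> w \<and> w \<le> 6) \<or>
      (20 \<le> n \<and> n \<le> 24 \<and> 5 \<le> w \<and> w \<le> 7) \<or>
      (25 \<le> n \<and> n \<le> 29 \<and> 5 \<le> w \<and> w \<le> 8) \<or>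
      ((30 \<le> n \<and> n \<le> 34 \<or> 41 \<le> n \<and> n \<le> 47) \<and> 5 \<le> w \<and> w \<le> 9) \<or>
      ((35 \<le> n \<and> n \<le> 40 \<or> 48 \<le> n \<and> n \<le> 59) \<and> 5 \<le> w \<and> w \<le> 10) \<or>
      (60 \<le> n \<and> n \<le> 70 \<and> 5 \<le> w \<and> w \<le> 11) \<longrightarrow>
      max_s_distance n w 4 = (n - w + 4) choose 4)"
proof (intro conjI impI)
  assume asm: "14 \<le> n \<and> n \<le> 58 \<and> 5 \<le> w \<and> real w \<le> real n / 2"
  define B where "B = nat (int (n choose 4) - int (n choose 3) + int (n choose 2))"
  have bound: "int (card X) \<le> int (n choose 4) - int (n choose 3) + int (n choose 2)"
    if "X \<subseteq> layer {..<n} w" "card (family_distances X) = 4" for X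
    using four_distance_bound_1[OF that(1) _ assms] asm that(2) by blast
  \<comment> \<open>Needed to pass between \<open>int\<close> and \<open>nat\<close>. It follows
    from the existence of a four-distance family: the cardinality of that family is nonnegative and
    below the bound.\<close>
  have nonneg: "0 \<le> int (n choose 4) - int (n choose 3) + int (n choose 2)"
  proof -
    obtain X where X: "X \<subseteq> johnson_space n w" "card (distances tau X) = 4"
      using star_in_johnson_space[of w n] asm assms by blast
    have "card (family_distances (support ` X)) = 4"
      using X(2) distances_tau[OF X(1)] by (simp add: card_image)
    then have "int (card (support ` X)) \<le> int (n choose 4) - int (n choose 3) + int (n choose 2)"
      using X(1) support_johnson_space by (intro bound) blast+
    then show ?thesis by linarith
  qed
  have "max_s_distance n w 4 \<le> B"
  proof (rule max_s_distance_le)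
    show "card X \<le> B" if "X \<subseteq> layer {..<n} w" "card (family_distances X) = 4" for X
      using bound[OF that] unfolding B_def le_nat_iff[OF nonneg] .
  qed (use asm assms in auto)
  then show "int (max_s_distance n w 4) \<le> int (n choose 4) - int (n choose 3) + int (n choose 2)"
    unfolding B_def le_nat_iff[OF nonneg] .
next
  assume asm: "(15 \<le> n \<and> n \<le> 16 \<and> w = 5) \<or>
      (17 \<le> n \<and> n \<le> 19 \<and> 5 \<le> w \<and> w \<le> 6) \<or>
      (20 \<le> n \<and> n \<le> 24 \<and> 5 \<le> w \<and> w \<le> 7) \<or>
      (25 \<le> n \<and> n \<le> 29 \<and> 5 \<le> w \<and> w \<le> 8) \<or>
      ((30 \<le> n \<and> n \<le> 34 \<or> 41 \<le> n \<and> n \<le> 47) \<and> 5 \<le> w \<and> w \<le> 9) \<or>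
      ((35 \<le> n \<and> n \<le> 40 \<or> 48 \<le> n \<and> n \<le> 59) \<and> 5 \<le> w \<and> w \<le> 10) \<or>
      (60 \<le> n \<and> n \<le> 70 \<and> 5 \<le> w \<and> w \<le> 11)"
  have w5: "5 \<le> w" using asm by auto
  have "w \<in> {5, 6, 7, 8, 9, 10, 11}" using asm by auto
  \<comment> \<open>The hypotheses are grouped by \<open>n\<close> and \<open>regions\<close> by
    \<open>w\<close>, so the match is made for each \<open>w\<close> separately.\<close>
  then have "\<exists>(w', lo, hi)\<in>set regions. w' = int w \<and> lo \<le> int n \<and> int n \<le> hi"
    unfolding regions_def using asm by (elim insertE) auto
  then obtain lo hi where r: "(int w, lo, hi) \<in> set regions" "lo \<le> int n" "int n \<le> hi" by blast
  have "max_s_distance n w 4 \<le> (n - w + 4) choose 4"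
    using four_distance_bound_2[OF _ r] by (intro max_s_distance_le[OF w5 assms]) blast
  then show "max_s_distance n w 4 = (n - w + 4) choose 4"
    using max_s_distance_ge[OF w5 assms] by simp
qed

end
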